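(* Let $S$ be a complex manifold, let $p:X\to S$ be a holomorphic submersion which is also a fibration, and let $H$ be a homotopy fixing endpoints between paths $\gamma,\gamma'$ in $S$. Let $\Pi_1(\Gamma^*X)\xrightarrow{\iota_\gamma}\Pi_1(H^*X)\xleftarrow{\iota_{\gamma'}}\Pi_1(\Gamma'^*X)$ be the maps induced by inclusion, and let $\eta_H:Q_\gamma\to Q_{\gamma'}$ be defined by $\eta_H(\alpha)=\iota_{\gamma'}^{-1}\circ\iota_\gamma(\alpha)$. Then $\eta_H$ is a morphism of Morita equivalences (between $\Pi_1(X_{\gamma(0)})$ and $\Pi_1(X_{\gamma(1)})$).
   Context: $X_s=p^{-1}(s)$; $I=[0,1]$; "fibration" means Serre fibration. **Fundamental groupoid.** For a complex manifold $Y$, $\Pi_1(Y)$ is the holomorphic Lie groupoid of homotopy classes (fixing endpoints) of paths in $Y$; the charts on arrows come from the local homeomorphism $(t,s):\Pi_1(Y)\to Y\times Y$ (end and start points). $[\alpha].[\beta]$ means first $\alpha$, then $\beta$. **Definition of $Q_\gamma$.** For a path $\gamma:I\to S$ choose a contractible open $\mathbb{D}_\gamma\subset S\times\mathbb{C}$ containing the graph $\{(\gamma(t),t):t\in I\}$, and let $\Gamma:\mathbb{D}_\gamma\to S$ be the projection. Let $\Gamma^*X=X\times_S\mathbb{D}_\gamma$, with projection $\pi:\Gamma^*X\to\mathbb{D}_\gamma$, and let $\pi_*:\Pi_1(\Gamma^*X)\to\Pi_1(\mathbb{D}_\gamma)$ be the induced holomorphic submersion. Let $e$ be the path $t\mapsto(\gamma(t),t)$.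 Define $Q_\gamma=\pi_*^{-1}([e])$, a complex submanifold of the space of arrows of $\Pi_1(\Gamma^*X)$. The fibres of $\pi$ over $(\gamma(0),0)$ and $(\gamma(1),1)$ are identified with $X_{\gamma(0)}$ and $X_{\gamma(1)}$; let $\iota_i:\Pi_1(X_{\gamma(i)})\to\Pi_1(\Gamma^*X)$, $i=0,1$, be induced by inclusion. $Q_\gamma$ is a Morita equivalence (biprincipal bibundle) between $\Pi_1(X_{\gamma(0)})$ and $\Pi_1(X_{\gamma(1)})$ with moment maps $\mu_0,\mu_1$ sending an arrow to its start and end point, left action $g*\alpha=\iota_0(g).\alpha$ and right action $\alpha*h=\alpha.\iota_1(h)$. $\Gamma'$, $\mathbb{D}_{\gamma'}$, $\Gamma'^*X$ and $Q_{\gamma'}$ are constructed in the same way from $\gamma'$. **Thickening of the homotopy.** View $H$ as a map $H:B^2\to S$ on the closed unit disk $B^2\subset\mathbb{C}$, with $\gamma$ and $\gamma'$ the restrictions of $H$ to two boundary arcs from a marked point $b_0$ to a marked point $b_1$. Choose a contractible open $\mathbb{D}^2\subset S\times\mathbb{C}$ containing the graph of $H$, with projection $H:\mathbb{D}^2\to S$ (same notation), extending $\mathbb{D}_\gamma$ and $\mathbb{D}_{\gamma'}$: there are holomorphic open embeddings $\mathbb{D}_\gamma\hookrightarrow\mathbb{D}^2\hookleftarrow\mathbb{D}_{\gamma'}$ over $S$, carrying the graphs of $\gamma$ and $\gamma'$ to the parts of the graph of $H$ over the respective arcs (so both initial points go to $(H(b_0),b_0)$ and both terminal points to $(H(b_1),b_1)$).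 Put $H^*X=X\times_S\mathbb{D}^2$. The induced inclusions $\Gamma^*X\hookrightarrow H^*X\hookleftarrow\Gamma'^*X$ induce $\iota_\gamma$ and $\iota_{\gamma'}$. The expression $\iota_{\gamma'}^{-1}\circ\iota_\gamma(\alpha)$ denotes the unique arrow of $\Pi_1(\Gamma'^*X)$ whose image under $\iota_{\gamma'}$ is $\iota_\gamma(\alpha)$. **Morphism of Morita equivalences.** Let $Q,Q'$ be Morita equivalences between $\mathcal{G}$ and $\mathcal{H}$. A morphism $Q\to Q'$ is a holomorphic map $\eta$ compatible with the moment maps and with $\eta(g*q)=g*\eta(q)$ and $\eta(q*h)=\eta(q)*h$ for $g\in\mathcal{G}$, $h\in\mathcal{H}$ whenever the actions are defined. *)

theory Defs
  imports "HOL-Analysis.Analysis"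
begin

section \<open>Holomorphic functions of several variables\<close>

text \<open>The complex analogue of \<^const>\<open>Euclidean_space\<close>: the space of n-tuples is realised inside
  \<^typ>\<open>nat \<Rightarrow> complex\<close> as the vectors whose coordinates vanish from index n on. In particular
  the space of k-tuples is literally a coordinate subspace of the space of n-tuples for k at most n.\<close>

definition cspace :: "nat \<Rightarrow> (nat \<Rightarrow> complex) set" where
  "cspace n = {v. \<forall>i\<ge>n. v i = 0}"

text \<open>Complex Frechet differentiability, with differential \<open>v \<mapsto> (\<Sum>i<n. c i * v i)\<close>.
  The topology on \<^typ>\<open>nat \<Rightarrow> complex\<close> is the product topology, which on \<^term>\<open>cspace n\<close> is the
  usual one.\<close>

definition has_cgradient ::
    "nat \<Rightarrow> ((nat \<Rightarrow> complex) \<Rightarrow> complex) \<Rightarrow> (nat \<Rightarrow> complex) \<Rightarrow> (nat \<Rightarrow> complex) \<Rightarrow> bool" where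
  "has_cgradient n f c z \<longleftrightarrow>
     ((\<lambda>w. cmod (f w - f z - (\<Sum>i<n. c i * (w i - z i))) / (\<Sum>i<n. cmod (w i - z i)))
        \<longlongrightarrow> 0) (at z within cspace n)"

text \<open>To be used for a relatively open subset \<open>A\<close> of \<^term>\<open>cspace n\<close>.\<close>

definition cholomorphic ::
    "nat \<Rightarrow> nat \<Rightarrow> (nat \<Rightarrow> complex) set \<Rightarrow> ((nat \<Rightarrow> complex) \<Rightarrow> (nat \<Rightarrow> complex)) \<Rightarrow> bool" where
  "cholomorphic n m A F \<longleftrightarrow>
     F ` A \<subseteq> cspace m \<and> (\<forall>z\<in>A. \<forall>j<m. \<exists>c. has_cgradient n (\<lambda>w. F w j) c z)"

section \<open>Complex manifolds\<close>

type_synonym 'a chart = "'a set \<times> ('a \<Rightarrow> nat \<Rightarrow> complex)"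

record 'a cmfd =
  mtop :: "'a topology"
  cdim :: nat
  atlas :: "'a chart set"

abbreviation points :: "'a cmfd \<Rightarrow> 'a set" where
  "points M \<equiv> topspace (mtop M)"

definition is_chart :: "'a cmfd \<Rightarrow> 'a chart \<Rightarrow> bool" where
  "is_chart M = (\<lambda>(U, \<phi>).
     openin (mtop M) U \<and>
     openin (top_of_set (cspace (cdim M))) (\<phi> ` U) \<and>
     homeomorphic_map (subtopology (mtop M) U) (top_of_set (\<phi> ` U)) \<phi>)"

definition compatible :: "nat \<Rightarrow> 'a chart \<Rightarrow> 'a chart \<Rightarrow> bool" where
  "compatible n = (\<lambda>(U, \<phi>) (V, \<psi>).
     cholomorphic n n (\<phi> ` (U \<inter> V)) (\<psi> \<circ> inv_into U \<phi>) \<and>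
     cholomorphic n n (\<psi> ` (U \<inter> V)) (\<phi> \<circ> inv_into V \<psi>))"

definition complex_manifold :: "'a cmfd \<Rightarrow> bool" where
  "complex_manifold M \<longleftrightarrow>
     Hausdorff_space (mtop M) \<and> second_countable (mtop M) \<and>
     (\<forall>c\<in>atlas M. is_chart M c) \<and>
     (\<Union>(U, \<phi>)\<in>atlas M. U) = points M \<and>
     (\<forall>c\<in>atlas M. \<forall>d\<in>atlas M. compatible (cdim M) c d)"

text \<open>The maximal atlas.\<close>

definition charts :: "'a cmfd \<Rightarrow> 'a chart set" where
  "charts M = {c. is_chart M c \<and> (\<forall>d\<in>atlas M. compatible (cdim M) c d)}"

definition holomorphic_map :: "'a cmfd \<Rightarrow> 'b cmfd \<Rightarrow> ('a \<Rightarrow> 'b) \<Rightarrow> bool" where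
  "holomorphic_map M N f \<longleftrightarrow>
     continuous_map (mtop M) (mtop N) f \<and>
     (\<forall>(U, \<phi>)\<in>atlas M. \<forall>(V, \<psi>)\<in>atlas N.
        cholomorphic (cdim M) (cdim N) (\<phi> ` (U \<inter> f -` V)) (\<psi> \<circ> f \<circ> inv_into U \<phi>))"

text \<open>\<open>C j i\<close> is the Jacobian matrix of \<open>f\<close> in charts.\<close>

definition holomorphic_submersion :: "'a cmfd \<Rightarrow> 'b cmfd \<Rightarrow> ('a \<Rightarrow> 'b) \<Rightarrow> bool" where
  "holomorphic_submersion M N f \<longleftrightarrow>
     holomorphic_map M N f \<and>
     (\<forall>x\<in>points M. \<forall>(U, \<phi>)\<in>atlas M. \<forall>(V, \<psi>)\<in>atlas N. x \<in> U \<and> f x \<in> V \<longrightarrow>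
        (\<exists>C. (\<forall>j<cdim N.
                has_cgradient (cdim M) (\<lambda>z. \<psi> (f (inv_into U \<phi> z)) j) (C j) (\<phi> x)) \<and>
             (\<forall>b. \<exists>v. \<forall>j<cdim N. (\<Sum>i<cdim M. C j i * v i) = b j)))"

definition cappend :: "nat \<Rightarrow> (nat \<Rightarrow> complex) \<Rightarrow> (nat \<Rightarrow> complex) \<Rightarrow> (nat \<Rightarrow> complex)" where
  "cappend n u v = (\<lambda>i. if i < n then u i else v (i - n))"

definition prod_mfd :: "'a cmfd \<Rightarrow> 'b cmfd \<Rightarrow> ('a \<times> 'b) cmfd" where
  "prod_mfd M N =
     \<lparr>mtop = prod_topology (mtop M) (mtop N),
      cdim = cdim M + cdim N,
      atlas = {(U \<times> V, \<lambda>(x, y). cappend (cdim M) (\<phi> x) (\<psi> y)) | U \<phi> V \<psi>.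
                 (U, \<phi>) \<in> atlas M \<and> (V, \<psi>) \<in> atlas N}\<rparr>"

definition complex_line :: "complex cmfd" where
  "complex_line =
     \<lparr>mtop = euclidean, cdim = 1, atlas = {(UNIV, \<lambda>z i. if i = 0 then z else 0)}\<rparr>"

text \<open>The structure of a k-dimensional complex submanifold on a subset \<open>Q\<close> of \<open>M\<close>: the charts are
  the restrictions of the slice charts of \<open>M\<close>, i.e. of the charts of the maximal atlas in which
  \<open>Q\<close> is given by the vanishing of the coordinates from index k on.\<close>

definition submanifold :: "'a cmfd \<Rightarrow> nat \<Rightarrow> 'a set \<Rightarrow> 'a cmfd" where
  "submanifold M k Q =
     \<lparr>mtop = subtopology (mtop M) Q,
      cdim = k,
      atlas = {(U \<inter> Q, \<phi>) | U \<phi>. (U, \<phi>) \<in> charts M \<and> (\<forall>x\<in>U. x \<in> Q \<longleftrightarrow> \<phi> x \<in> cspace k)}\<rparr>"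

abbreviation open_submanifold :: "'a cmfd \<Rightarrow> 'a set \<Rightarrow> 'a cmfd" where
  "open_submanifold M U \<equiv> submanifold M (cdim M) U"

definition holomorphic_open_embedding :: "'a cmfd \<Rightarrow> 'b cmfd \<Rightarrow> ('a \<Rightarrow> 'b) \<Rightarrow> bool" where
  "holomorphic_open_embedding M N f \<longleftrightarrow>
     inj_on f (points M) \<and> openin (mtop N) (f ` points M) \<and>
     holomorphic_map M N f \<and>
     holomorphic_map (open_submanifold N (f ` points M)) M (inv_into (points M) f)"

text \<open>Fibre products, to be used when \<open>p\<close> or \<open>f\<close> is a submersion.\<close>

definition pullback :: "'x cmfd \<Rightarrow> ('x \<Rightarrow> 's) \<Rightarrow> 's cmfd \<Rightarrow> ('d \<Rightarrow> 's) \<Rightarrow> 'd cmfd \<Rightarrow> ('x \<times> 'd) cmfd" where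
  "pullback X p S f D =
     submanifold (prod_mfd X D) (cdim X + cdim D - cdim S)
       {(x, d). x \<in> points X \<and> d \<in> points D \<and> p x = f d}"

definition fibre :: "'x cmfd \<Rightarrow> ('x \<Rightarrow> 's) \<Rightarrow> 's cmfd \<Rightarrow> 's \<Rightarrow> 'x cmfd" where
  "fibre X p S s = submanifold X (cdim X - cdim S) {x \<in> points X. p x = s}"

section \<open>Serre fibrations\<close>

abbreviation unit_interval :: "real topology" where
  "unit_interval \<equiv> top_of_set {0..1}"

definition cube :: "nat \<Rightarrow> (nat \<Rightarrow> real) topology" where
  "cube n = product_topology (\<lambda>i. unit_interval) {..<n}"

definition serre_fibration :: "'x topology \<Rightarrow> 's topology \<Rightarrow> ('x \<Rightarrow> 's) \<Rightarrow> bool" where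
  "serre_fibration X S p \<longleftrightarrow>
     continuous_map X S p \<and>
     (\<forall>n f h. continuous_map (cube n) X f \<and>
              continuous_map (prod_topology (cube n) unit_interval) S h \<and>
              (\<forall>c\<in>topspace (cube n). h (c, 0) = p (f c)) \<longrightarrow>
        (\<exists>k. continuous_map (prod_topology (cube n) unit_interval) X k \<and>
             (\<forall>c\<in>topspace (cube n). k (c, 0) = f c) \<and>
             (\<forall>c\<in>topspace (cube n). \<forall>t\<in>{0..1}. p (k (c, t)) = h (c, t))))"

section \<open>The fundamental groupoid\<close>

text \<open>An arrow is a homotopy class of paths, as a set of functions on \<^typ>\<open>real\<close>; values outside
  the unit interval are irrelevant to \<^const>\<open>homotopic_with\<close>.\<close>

definition path_class :: "'a topology \<Rightarrow> (real \<Rightarrow> 'a) \<Rightarrow> (real \<Rightarrow> 'a) set" where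
  "path_class Y g =
     {k. homotopic_with (\<lambda>r. r 0 = g 0 \<and> r 1 = g 1) unit_interval Y g k}"

definition rep :: "(real \<Rightarrow> 'a) set \<Rightarrow> real \<Rightarrow> 'a" where
  "rep a = (SOME g. g \<in> a)"

definition start :: "(real \<Rightarrow> 'a) set \<Rightarrow> 'a" where
  "start a = rep a 0"

definition finish :: "(real \<Rightarrow> 'a) set \<Rightarrow> 'a" where
  "finish a = rep a 1"

text \<open>First \<open>g\<close>, then \<open>k\<close>.\<close>

definition concat_path :: "(real \<Rightarrow> 'a) \<Rightarrow> (real \<Rightarrow> 'a) \<Rightarrow> real \<Rightarrow> 'a" where
  "concat_path g k = (\<lambda>t. if t \<le> 1/2 then g (2 * t) else k (2 * t - 1))"

definition arrow_comp :: "'a topology \<Rightarrow> (real \<Rightarrow> 'a) set \<Rightarrow> (real \<Rightarrow> 'a) set \<Rightarrow> (real \<Rightarrow> 'a) set" where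
  "arrow_comp Y a b = path_class Y (concat_path (rep a) (rep b))"

definition arrow_set :: "'a topology \<Rightarrow> (real \<Rightarrow> 'a) set set" where
  "arrow_set Y = path_class Y ` {g. pathin Y g}"

text \<open>The classes obtained from \<open>a\<close> by moving its start point inside \<open>U\<close> and its end point
  inside \<open>V\<close>; for a locally path connected space they form a basis of the usual topology.\<close>

definition arrow_nbhd ::
    "'a topology \<Rightarrow> (real \<Rightarrow> 'a) set \<Rightarrow> 'a set \<Rightarrow> 'a set \<Rightarrow> (real \<Rightarrow> 'a) set set" where
  "arrow_nbhd Y a U V =
     {arrow_comp Y (arrow_comp Y (path_class Y u) a) (path_class Y v) | u v.
        pathin (subtopology Y U) u \<and> u 1 = start a \<and>
        pathin (subtopology Y V) v \<and> v 0 = finish a}"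

definition arrow_topology :: "'a topology \<Rightarrow> (real \<Rightarrow> 'a) set topology" where
  "arrow_topology Y =
     topology_generated_by
       {arrow_nbhd Y a U V | a U V.
          a \<in> arrow_set Y \<and> openin Y U \<and> start a \<in> U \<and> openin Y V \<and> finish a \<in> V}"

record ('o, 'g) lie_groupoid =
  objects :: "'o cmfd"
  arrows :: "'g cmfd"
  src :: "'g \<Rightarrow> 'o"
  tgt :: "'g \<Rightarrow> 'o"
  comp :: "'g \<Rightarrow> 'g \<Rightarrow> 'g"
  ident :: "'o \<Rightarrow> 'g"
  ginv :: "'g \<Rightarrow> 'g"

text \<open>The charts on arrows are the pullbacks of product charts along the restrictions of
  \<open>(finish, start)\<close> to open sets which it maps homeomorphically onto open sets.\<close>

definition arrow_mfd :: "'a cmfd \<Rightarrow> (real \<Rightarrow> 'a) set cmfd" where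
  "arrow_mfd Y =
     \<lparr>mtop = arrow_topology (mtop Y),
      cdim = 2 * cdim Y,
      atlas = {(W, \<lambda>a. cappend (cdim Y) (\<phi> (finish a)) (\<psi> (start a))) | W U \<phi> V \<psi>.
         (U, \<phi>) \<in> atlas Y \<and> (V, \<psi>) \<in> atlas Y \<and>
         openin (arrow_topology (mtop Y)) W \<and> finish ` W \<subseteq> U \<and> start ` W \<subseteq> V \<and>
         openin (prod_topology (mtop Y) (mtop Y)) ((\<lambda>a. (finish a, start a)) ` W) \<and>
         homeomorphic_map (subtopology (arrow_topology (mtop Y)) W)
           (subtopology (prod_topology (mtop Y) (mtop Y)) ((\<lambda>a. (finish a, start a)) ` W))
           (\<lambda>a. (finish a, start a))}\<rparr>"

definition Pi1 :: "'a cmfd \<Rightarrow> ('a, (real \<Rightarrow> 'a) set) lie_groupoid" where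
  "Pi1 Y =
     \<lparr>objects = Y,
      arrows = arrow_mfd Y,
      src = start,
      tgt = finish,
      comp = arrow_comp (mtop Y),
      ident = (\<lambda>y. path_class (mtop Y) (\<lambda>_. y)),
      ginv = (\<lambda>a. path_class (mtop Y) (\<lambda>t. rep a (1 - t)))\<rparr>"

definition Pi1_map :: "'b cmfd \<Rightarrow> ('a \<Rightarrow> 'b) \<Rightarrow> (real \<Rightarrow> 'a) set \<Rightarrow> (real \<Rightarrow> 'b) set" where
  "Pi1_map Z f a = path_class (mtop Z) (f \<circ> rep a)"

section \<open>Bibundles and their morphisms\<close>

record ('q, 'a, 'b, 'g, 'h) bibundle =
  total :: "'q cmfd"
  lmom :: "'q \<Rightarrow> 'a"
  rmom :: "'q \<Rightarrow> 'b"
  lact :: "'g \<Rightarrow> 'q \<Rightarrow> 'q"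
  ract :: "'q \<Rightarrow> 'h \<Rightarrow> 'q"

text \<open>Arrows compose from left to right, so \<open>g * q\<close> is defined when the target of \<open>g\<close> is the left
  moment of \<open>q\<close>, and \<open>q * h\<close> when the source of \<open>h\<close> is the right moment of \<open>q\<close>. Morphisms of Morita
  equivalences are the morphisms of the underlying bibundles; biprincipality is a property of
  source and target and puts no further condition on the map.\<close>

definition morita_morphism ::
    "('a, 'g) lie_groupoid \<Rightarrow> ('b, 'h) lie_groupoid \<Rightarrow>
     ('q, 'a, 'b, 'g, 'h) bibundle \<Rightarrow> ('r, 'a, 'b, 'g, 'h) bibundle \<Rightarrow> ('q \<Rightarrow> 'r) \<Rightarrow> bool" where
  "morita_morphism G H Q Q' \<eta> \<longleftrightarrow>
     holomorphic_map (total Q) (total Q') \<eta> \<and>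
     (\<forall>q\<in>points (total Q). lmom Q' (\<eta> q) = lmom Q q \<and> rmom Q' (\<eta> q) = rmom Q q) \<and>
     (\<forall>g\<in>points (arrows G). \<forall>q\<in>points (total Q).
        tgt G g = lmom Q q \<longrightarrow> \<eta> (lact Q g q) = lact Q' g (\<eta> q)) \<and>
     (\<forall>q\<in>points (total Q). \<forall>h\<in>points (arrows H).
        src H h = rmom Q q \<longrightarrow> \<eta> (ract Q q h) = ract Q' (\<eta> q) h)"

section \<open>The bibundle of a path\<close>

definition path_graph :: "(real \<Rightarrow> 's) \<Rightarrow> real \<Rightarrow> 's \<times> complex" where
  "path_graph \<gamma> = (\<lambda>t. (\<gamma> t, of_real t))"

definition contractible_thickening :: "'s cmfd \<Rightarrow> ('s \<times> complex) set \<Rightarrow> ('s \<times> complex) set \<Rightarrow> bool" where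
  "contractible_thickening S A D \<longleftrightarrow>
     openin (mtop (prod_mfd S complex_line)) D \<and> A \<subseteq> D \<and>
     contractible_space (subtopology (mtop (prod_mfd S complex_line)) D)"

abbreviation thick_mfd :: "'s cmfd \<Rightarrow> ('s \<times> complex) set \<Rightarrow> ('s \<times> complex) cmfd" where
  "thick_mfd S D \<equiv> open_submanifold (prod_mfd S complex_line) D"

abbreviation thick_pullback ::
    "'x cmfd \<Rightarrow> ('x \<Rightarrow> 's) \<Rightarrow> 's cmfd \<Rightarrow> ('s \<times> complex) set \<Rightarrow> ('x \<times> 's \<times> complex) cmfd" where
  "thick_pullback X p S D \<equiv> pullback X p S fst (thick_mfd S D)"

definition Q_set ::
    "'x cmfd \<Rightarrow> ('x \<Rightarrow> 's) \<Rightarrow> 's cmfd \<Rightarrow> (real \<Rightarrow> 's) \<Rightarrow> ('s \<times> complex) set \<Rightarrow>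
     (real \<Rightarrow> 'x \<times> 's \<times> complex) set set" where
  "Q_set X p S \<gamma> D =
     {\<alpha> \<in> points (arrows (Pi1 (thick_pullback X p S D))).
        Pi1_map (thick_mfd S D) snd \<alpha> = path_class (mtop (thick_mfd S D)) (path_graph \<gamma>)}"

text \<open>The map on fundamental groupoids induced by the inclusion of the fibre over
  \<open>(\<gamma> i, i)\<close>, for \<open>i\<close> equal to 0 or 1.\<close>

definition fibre_incl ::
    "'x cmfd \<Rightarrow> ('x \<Rightarrow> 's) \<Rightarrow> 's cmfd \<Rightarrow> (real \<Rightarrow> 's) \<Rightarrow> ('s \<times> complex) set \<Rightarrow> real \<Rightarrow>
     (real \<Rightarrow> 'x) set \<Rightarrow> (real \<Rightarrow> 'x \<times> 's \<times> complex) set" where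
  "fibre_incl X p S \<gamma> D i = Pi1_map (thick_pullback X p S D) (\<lambda>x. (x, path_graph \<gamma> i))"

definition Q_bibundle ::
    "'x cmfd \<Rightarrow> ('x \<Rightarrow> 's) \<Rightarrow> 's cmfd \<Rightarrow> (real \<Rightarrow> 's) \<Rightarrow> ('s \<times> complex) set \<Rightarrow>
     ((real \<Rightarrow> 'x \<times> 's \<times> complex) set, 'x, 'x, (real \<Rightarrow> 'x) set, (real \<Rightarrow> 'x) set) bibundle" where
  "Q_bibundle X p S \<gamma> D =
     (let E = thick_pullback X p S D in
      \<lparr>total = submanifold (arrows (Pi1 E))
                 (cdim (arrows (Pi1 E)) - cdim (arrows (Pi1 (thick_mfd S D)))) (Q_set X p S \<gamma> D),
       lmom = (\<lambda>\<alpha>. fst (src (Pi1 E) \<alpha>)),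
       rmom = (\<lambda>\<alpha>. fst (tgt (Pi1 E) \<alpha>)),
       lact = (\<lambda>g \<alpha>. comp (Pi1 E) (fibre_incl X p S \<gamma> D 0 g) \<alpha>),
       ract = (\<lambda>\<alpha> h. comp (Pi1 E) \<alpha> (fibre_incl X p S \<gamma> D 1 h))\<rparr>)"

section \<open>Thickened homotopies\<close>

definition homotopy_fixing_endpoints ::
    "'s topology \<Rightarrow> (real \<times> real \<Rightarrow> 's) \<Rightarrow> (real \<Rightarrow> 's) \<Rightarrow> (real \<Rightarrow> 's) \<Rightarrow> bool" where
  "homotopy_fixing_endpoints S h \<gamma> \<gamma>' \<longleftrightarrow>
     continuous_map (prod_topology unit_interval unit_interval) S h \<and>
     (\<forall>t\<in>{0..1}. h (0, t) = \<gamma> t \<and> h (1, t) = \<gamma>' t) \<and>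
     (\<forall>s\<in>{0..1}. h (s, 0) = \<gamma> 0 \<and> h (s, 1) = \<gamma> 1)"

text \<open>\<open>q\<close> exhibits the closed disk as the quotient of the square by collapsing the sides \<open>t = 0\<close> and
  \<open>t = 1\<close> to the points \<open>b0\<close> and \<open>b1\<close>; the sides \<open>s = 0\<close> and \<open>s = 1\<close> become the two boundary arcs
  from \<open>b0\<close> to \<open>b1\<close>.\<close>

definition disk_collapse :: "(real \<times> real \<Rightarrow> complex) \<Rightarrow> complex \<Rightarrow> complex \<Rightarrow> bool" where
  "disk_collapse q b0 b1 \<longleftrightarrow>
     continuous_on ({0..1} \<times> {0..1}) q \<and>
     q ` ({0..1} \<times> {0..1}) = cball 0 1 \<and>
     q ` ({0} \<times> {0..1}) \<union> q ` ({1} \<times> {0..1}) = sphere 0 1 \<and>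
     (\<forall>s\<in>{0..1}. q (s, 0) = b0 \<and> q (s, 1) = b1) \<and>
     inj_on q ({0..1} \<times> {0<..<1} \<union> {(0, 0), (0, 1)})"

definition disk_graph :: "(complex \<Rightarrow> 's) \<Rightarrow> complex set \<Rightarrow> ('s \<times> complex) set" where
  "disk_graph H B = (\<lambda>b. (H b, b)) ` B"

text \<open>A holomorphic open embedding over \<open>S\<close> of the thickening of \<open>\<gamma>\<close> into that of \<open>H\<close>, where \<open>\<gamma>\<close>
  is the restriction of \<open>H\<close> to the boundary arc \<open>A\<close> from \<open>b0\<close> to \<open>b1\<close>.\<close>

definition thickening_embedding ::
    "'s cmfd \<Rightarrow> (real \<Rightarrow> 's) \<Rightarrow> ('s \<times> complex) set \<Rightarrow> (complex \<Rightarrow> 's) \<Rightarrow> complex set \<Rightarrow>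
     complex \<Rightarrow> complex \<Rightarrow> ('s \<times> complex) set \<Rightarrow> ('s \<times> complex \<Rightarrow> 's \<times> complex) \<Rightarrow> bool" where
  "thickening_embedding S \<gamma> D H A b0 b1 D2 j \<longleftrightarrow>
     holomorphic_open_embedding (thick_mfd S D) (thick_mfd S D2) j \<and>
     (\<forall>d\<in>D. fst (j d) = fst d) \<and>
     j ` (path_graph \<gamma> ` {0..1}) = disk_graph H A \<and>
     j (path_graph \<gamma> 0) = (H b0, b0) \<and>
     j (path_graph \<gamma> 1) = (H b1, b1)"

text \<open>The map on fundamental groupoids induced by an inclusion of pullbacks \<open>(x, d) \<mapsto> (x, j d)\<close>.\<close>

definition pullback_incl ::
    "'x cmfd \<Rightarrow> ('x \<Rightarrow> 's) \<Rightarrow> 's cmfd \<Rightarrow> ('s \<times> complex) set \<Rightarrow> ('s \<times> complex \<Rightarrow> 's \<times> complex) \<Rightarrow>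
     (real \<Rightarrow> 'x \<times> 's \<times> complex) set \<Rightarrow> (real \<Rightarrow> 'x \<times> 's \<times> complex) set" where
  "pullback_incl X p S D2 j = Pi1_map (thick_pullback X p S D2) (\<lambda>(x, d). (x, j d))"

text \<open>\<open>j\<close> and \<open>j'\<close> are the embeddings of \<open>D\<close> and \<open>D'\<close> into \<open>D2\<close>; the domain \<open>D\<close> enters only
  through \<open>\<alpha>\<close>.\<close>

definition eta ::
    "'x cmfd \<Rightarrow> ('x \<Rightarrow> 's) \<Rightarrow> 's cmfd \<Rightarrow> ('s \<times> complex) set \<Rightarrow> ('s \<times> complex) set \<Rightarrow>
     ('s \<times> complex \<Rightarrow> 's \<times> complex) \<Rightarrow> ('s \<times> complex \<Rightarrow> 's \<times> complex) \<Rightarrow>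
     (real \<Rightarrow> 'x \<times> 's \<times> complex) set \<Rightarrow> (real \<Rightarrow> 'x \<times> 's \<times> complex) set" where
  "eta X p S D' D2 j j' \<alpha> =
     (THE \<beta>. \<beta> \<in> points (arrows (Pi1 (thick_pullback X p S D'))) \<and>
             pullback_incl X p S D2 j' \<beta> = pullback_incl X p S D2 j \<alpha>)"

end

theory Submission
  imports Defs
begin

text \<open>
  Write \<open>E\<close>, \<open>E'\<close> and \<open>E2\<close> for the pullbacks of \<open>X\<close> to the thickenings \<open>D\<close>, \<open>D'\<close> and \<open>D2\<close> of
  \<open>\<gamma>\<close>, \<open>\<gamma>'\<close> and of the homotopy, and \<open>J\<close>, \<open>J'\<close> for the open embeddings of \<open>E\<close> and \<open>E'\<close> into \<open>E2\<close>.

  \<^emph>\<open>Why the map exists.\<close> Since \<open>E2 \<rightarrow> D2\<close> is a Serre fibration over a contractible base and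
  \<open>E'\<close> is its restriction to a contractible open part of the base, the functor
  \<open>\<Pi>\<^sub>1(E') \<rightarrow> \<Pi>\<^sub>1(E2)\<close> is fully faithful. To see that it is full, take a path of \<open>E2\<close> with end points
  over \<open>D'\<close>. Its projection is homotopic to a path in \<open>D'\<close>, and lifting the homotopy moves the given
  path into \<open>E'\<close>. It is faithful for the same reason one dimension higher: a homotopy in \<open>E2\<close>
  between two paths of \<open>E'\<close> projects to a square in \<open>D2\<close> whose boundary also bounds a square in \<open>D'\<close>,
  and the homotopy can be pushed into \<open>E'\<close> without moving its boundary. Both cases are instances of
  \<open>lift_rel_boundary\<close>. An arrow of \<open>Q\<^sub>\<gamma>\<close> starts and ends over the end points of the graph of \<open>\<gamma>\<close>,
  whose images in \<open>D2\<close> are those of the end points of the graph of \<open>\<gamma>'\<close>; hence its image in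
  \<open>\<Pi>\<^sub>1(E2)\<close> comes from a unique arrow of \<open>\<Pi>\<^sub>1(E')\<close>, which lies over the class of the graph
  of \<open>\<gamma>'\<close> because \<open>D'\<close> is contractible.

  \<^emph>\<open>Why it is holomorphic.\<close> The same recipe transports every arrow of \<open>E\<close> whose two end points lie
  over \<open>D \<inter> D'\<close> (the intersection being taken in \<open>D2\<close>), which is an open set of arrows containing \<open>Q\<^sub>\<gamma>\<close>.
  An arrow space has the end points of an arrow as local coordinates, and in them the transport is
  the map \<open>(x, d) \<mapsto> (x, j'\<^sup>-\<^sup>1 (j d))\<close> applied to both end points. This
  reduces holomorphy to that of \<open>j\<close> and \<open>j'\<^sup>-\<^sup>1\<close>, provided that the arrow spaces and the
  fibre products have enough charts. A fibre product \<open>{(x, s, z). p x = s}\<close> is a graph, so subtracting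
  \<open>p\<close> in local coordinates yields slice charts; an arrow space has charts because each point of a
  manifold has a basis of contractible neighbourhoods. Finally a map that is holomorphic near a
  submanifold and maps it into another one is holomorphic in all slice charts.

  \<^emph>\<open>Why it is equivariant.\<close> By uniqueness an identity between arrows of \<open>E'\<close> may be checked in
  \<open>\<Pi>\<^sub>1(E2)\<close>, and there both fibre inclusions become the inclusion of the same fibre of \<open>E2\<close>.
\<close>

section \<open>Homotopy classes of paths\<close>

abbreviation unit_square :: "(real \<times> real) topology" where
  "unit_square \<equiv> prod_topology unit_interval unit_interval"

definition path_homotopic :: "'a topology \<Rightarrow> (real \<Rightarrow> 'a) \<Rightarrow> (real \<Rightarrow> 'a) \<Rightarrow> bool" where
  "path_homotopic Y g k \<longleftrightarrow> homotopic_with (\<lambda>r. r 0 = g 0 \<and> r 1 = g 1) unit_interval Y g k"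

lemma path_class_eq_Collect: "path_class Y g = Collect (path_homotopic Y g)"
  by (auto simp: path_class_def path_homotopic_def)

lemma path_homotopic_iff_square:
  "path_homotopic Y g k \<longleftrightarrow>
     (\<exists>h. continuous_map unit_square Y h \<and>
          (\<forall>t\<in>{0..1}. h (0, t) = g t \<and> h (1, t) = k t) \<and>
          (\<forall>s\<in>{0..1}. h (s, 0) = g 0 \<and> h (s, 1) = g 1))"
  unfolding path_homotopic_def by (subst homotopic_with) auto

lemma path_homotopic_imp_pathin:
  assumes "path_homotopic Y g k"
  shows "pathin Y g" "pathin Y k" "k 0 = g 0" "k 1 = g 1"
  using assms homotopic_with_imp_continuous_maps[of _ unit_interval Y g k]
    homotopic_with_imp_property[of _ unit_interval Y g k]
  unfolding path_homotopic_def pathin_def by blast+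

lemma path_homotopic_refl: "pathin Y g \<Longrightarrow> path_homotopic Y g g"
  by (simp add: path_homotopic_def pathin_def homotopic_with_refl)

lemma path_homotopic_sym: "path_homotopic Y g k \<Longrightarrow> path_homotopic Y k g"
  using path_homotopic_imp_pathin[of Y g k] unfolding path_homotopic_def
  by (metis (no_types, lifting) homotopic_with_mono homotopic_with_sym)

lemma path_homotopic_trans:
  "path_homotopic Y f g \<Longrightarrow> path_homotopic Y g k \<Longrightarrow> path_homotopic Y f k"
  using path_homotopic_imp_pathin[of Y f g] unfolding path_homotopic_def
  by (metis (no_types, lifting) homotopic_with_mono homotopic_with_trans)

lemma path_homotopic_cong:
  assumes "path_homotopic Y g k" "\<And>t. t \<in> {0..1} \<Longrightarrow> g' t = g t" "\<And>t. t \<in> {0..1} \<Longrightarrow> k' t = k t"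
  shows "path_homotopic Y g' k'"
  using assms unfolding path_homotopic_iff_square by simp

lemma path_homotopic_map:
  "path_homotopic Y g k \<Longrightarrow> continuous_map Y Z f \<Longrightarrow> path_homotopic Z (f \<circ> g) (f \<circ> k)"
  unfolding path_homotopic_iff_square
  by (elim exE, rule_tac x = "f \<circ> h" in exI) (auto intro: continuous_map_compose)

lemma pathin_map: "pathin Y g \<Longrightarrow> continuous_map Y Z f \<Longrightarrow> pathin Z (f \<circ> g)"
  by (simp add: pathin_def continuous_map_compose)

lemma unit_square_topology:
  "unit_square = top_of_set ({0..1} \<times> {0..1})"
  by (simp add: subtopology_Times flip: euclidean_product_topology)

lemma continuous_map_unit_square:
  "continuous_on ({0..1} \<times> {0..1}) f \<Longrightarrow> f \<in> {0..1} \<times> {0..1} \<rightarrow> A \<Longrightarrow>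
    continuous_map unit_square (top_of_set A) f"
  by (simp add: unit_square_topology)

text \<open>The unit interval is convex, so two reparametrisations with the same end points are joined by a
  straight line homotopy. The unit and associativity laws below are instances.\<close>

lemma path_homotopic_reparam:
  assumes g: "pathin Y g" and \<phi>: "continuous_on {0..1} \<phi>" "\<phi> \<in> {0..1} \<rightarrow> {0..1}"
    and \<psi>: "continuous_on {0..1} \<psi>" "\<psi> \<in> {0..1} \<rightarrow> {0..1}"
    and eq: "\<phi> 0 = \<psi> 0" "\<phi> 1 = \<psi> 1"
  shows "path_homotopic Y (g \<circ> \<phi>) (g \<circ> \<psi>)"
  unfolding path_homotopic_iff_square
proof (intro exI conjI)
  let ?h = "\<lambda>x. (1 - fst x) * \<phi> (snd x) + fst x * \<psi> (snd x)"
  have "continuous_on ({0..1} \<times> {0..1}) ?h"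
    by (intro continuous_intros continuous_on_compose2[OF \<phi>(1)] continuous_on_compose2[OF \<psi>(1)]) auto
  moreover have "?h \<in> {0..1} \<times> {0..1} \<rightarrow> {0..1}"
  proof safe
    fix s t :: real assume "s \<in> {0..1}" "t \<in> {0..1}"
    then show "?h (s, t) \<in> {0..1}"
      using \<phi>(2) \<psi>(2) convexD_alt[of "{0..1::real}" "\<phi> t" "\<psi> t" s] by (auto simp: Pi_iff)
  qed
  ultimately have "continuous_map unit_square unit_interval ?h"
    by (rule continuous_map_unit_square)
  then show "continuous_map unit_square Y (g \<circ> ?h)"
    using g unfolding pathin_def by (rule continuous_map_compose)
qed (use eq in \<open>auto simp: algebra_simps\<close>)

lemma pathin_concat:
  assumes "pathin Y g" "pathin Y k" "g 1 = k 0"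
  shows "pathin Y (concat_path g k)"
  unfolding pathin_def concat_path_def
proof (rule continuous_map_cases_le)
  have "continuous_on {0..1/2} (\<lambda>t::real. 2 * t)" "continuous_on {1/2..1} (\<lambda>t::real. 2 * t - 1)"
    by (auto intro!: continuous_intros)
  have "continuous_map (subtopology unit_interval {x \<in> topspace unit_interval. x \<le> 1/2}) unit_interval (\<lambda>t. 2 * t)"
    by (auto simp: continuous_map_in_subtopology subtopology_subtopology intro!: continuous_intros)
  from continuous_map_compose[OF this assms(1)[unfolded pathin_def]] show "continuous_map (subtopology unit_interval {x \<in> topspace unit_interval. x \<le> 1/2}) Y (\<lambda>t. g (2 * t))"
    unfolding o_def .
  have "continuous_map (subtopology unit_interval {x \<in> topspace unit_interval. 1/2 \<le> x}) unit_interval (\<lambda>t. 2 * t - 1)"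
    by (auto simp: continuous_map_in_subtopology subtopology_subtopology intro!: continuous_intros)
  from continuous_map_compose[OF this assms(2)[unfolded pathin_def]] show "continuous_map (subtopology unit_interval {x \<in> topspace unit_interval. 1/2 \<le> x}) Y (\<lambda>t. k (2 * t - 1))"
    unfolding o_def .
qed (use assms(3) in \<open>auto simp: mult.commute[of 2] intro: continuous_map_into_fulltopology\<close>)

lemma path_homotopic_concat:
  assumes "path_homotopic Y g g'" "path_homotopic Y k k'" "g 1 = k 0"
  shows "path_homotopic Y (concat_path g k) (concat_path g' k')"
proof -
  obtain h1 where h1: "continuous_map unit_square Y h1"
     "\<And>t. t\<in>{0..1} \<Longrightarrow> h1 (0, t) = g t \<and> h1 (1, t) = g' t"
     "\<And>t. t\<in>{0..1} \<Longrightarrow> h1 (t, 0) = g 0 \<and> h1 (t, 1) = g 1"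
    using assms(1) unfolding path_homotopic_iff_square by blast
  obtain h2 where h2: "continuous_map unit_square Y h2"
     "\<And>t. t\<in>{0..1} \<Longrightarrow> h2 (0, t) = k t \<and> h2 (1, t) = k' t"
     "\<And>t. t\<in>{0..1} \<Longrightarrow> h2 (t, 0) = k 0 \<and> h2 (t, 1) = k 1"
    using assms(2) unfolding path_homotopic_iff_square by blast
  let ?I = "unit_square"
  let ?h = "\<lambda>x. if snd x \<le> 1/2 then h1 (fst x, 2 * snd x) else h2 (fst x, 2 * snd x - 1)"
  have "continuous_map ?I Y ?h"
  proof (rule continuous_map_cases_le)
    show "continuous_map ?I euclideanreal snd" "continuous_map ?I euclideanreal (\<lambda>x. 1/2)"
      by (auto simp: unit_square_topology intro!: continuous_intros)
    have "continuous_map (subtopology ?I {x \<in> topspace ?I. snd x \<le> 1/2}) ?I (\<lambda>x. (fst x, 2 * snd x))"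
      unfolding unit_square_topology by (auto simp: subtopology_subtopology intro!: continuous_intros)
    from continuous_map_compose[OF this h1(1)] show "continuous_map (subtopology ?I {x \<in> topspace ?I. snd x \<le> 1/2}) Y (\<lambda>x. h1 (fst x, 2 * snd x))"
      unfolding o_def .
    have "continuous_map (subtopology ?I {x \<in> topspace ?I. 1/2 \<le> snd x}) ?I (\<lambda>x. (fst x, 2 * snd x - 1))"
      unfolding unit_square_topology by (auto simp: subtopology_subtopology intro!: continuous_intros)
    from continuous_map_compose[OF this h2(1)] show "continuous_map (subtopology ?I {x \<in> topspace ?I. 1/2 \<le> snd x}) Y (\<lambda>x. h2 (fst x, 2 * snd x - 1))"
      unfolding o_def .
  qed (use h1(3) h2(3) assms(3) in \<open>auto simp: mult.commute[of 2]\<close>)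
  then show ?thesis
    unfolding path_homotopic_iff_square using h1(2,3) h2(2,3)
    by (intro exI[of _ ?h]) (auto simp: concat_path_def)
qed

lemma path_homotopic_reparam_id:
  assumes g: "pathin Y g" and \<phi>: "continuous_on {0..1} \<phi>" "\<phi> \<in> {0..1} \<rightarrow> {0..1}"
    and eq: "\<phi> 0 = 0" "\<phi> 1 = 1"
  shows "path_homotopic Y (g \<circ> \<phi>) g"
  using path_homotopic_reparam[OF g \<phi>, of "\<lambda>t. t"] eq unfolding o_def by auto

lemma path_homotopic_const_concat:
  assumes "pathin Y g"
  shows "path_homotopic Y (concat_path (\<lambda>_. g 0) g) g"
proof (rule path_homotopic_cong[OF path_homotopic_reparam_id[OF assms, of "\<lambda>t. max 0 (2 * t - 1)"]])
  show "continuous_on {0..1} (\<lambda>t::real. max 0 (2 * t - 1))" by (intro continuous_intros)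
qed (auto simp: concat_path_def max_def intro!: arg_cong[of _ _ g])

lemma path_homotopic_concat_const:
  assumes "pathin Y g"
  shows "path_homotopic Y (concat_path g (\<lambda>_. g 1)) g"
proof (rule path_homotopic_cong[OF path_homotopic_reparam_id[OF assms, of "\<lambda>t. min 1 (2 * t)"]])
  show "continuous_on {0..1} (\<lambda>t::real. min 1 (2 * t))" by (intro continuous_intros)
qed (auto simp: concat_path_def min_def intro!: arg_cong[of _ _ g])

lemma path_homotopic_concat_assoc:
  assumes "pathin Y f" "pathin Y g" "pathin Y k" "f 1 = g 0" "g 1 = k 0"
  shows "path_homotopic Y (concat_path (concat_path f g) k) (concat_path f (concat_path g k))"
proof -
  have "pathin Y (concat_path f (concat_path g k))"
    using assms by (intro pathin_concat) (auto simp: concat_path_def)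
  \<comment> \<open>The change of parameter has slopes 2, 1 and 1/2 in this order; being concave, it is a minimum of
    three affine functions.\<close>
  then show ?thesis
  proof (rule path_homotopic_cong[OF path_homotopic_reparam_id
        [of _ _ "\<lambda>t. min (min (2 * t) (t + 1/4)) ((t + 1) / 2)"]])
    show "continuous_on {0..1} (\<lambda>t::real. min (min (2 * t) (t + 1/4)) ((t + 1) / 2))"
      by (intro continuous_intros) auto
    fix t :: real assume t: "t \<in> {0..1}"
    consider "t \<le> 1/4" | "1/4 < t" "t \<le> 1/2" | "1/2 < t" by linarith
    then show "concat_path (concat_path f g) k t =
        (concat_path f (concat_path g k) \<circ> (\<lambda>t. min (min (2 * t) (t + 1/4)) ((t + 1) / 2))) t"
    proof cases
      case 1
      then have "min (min (2 * t) (t + 1/4)) ((t + 1) / 2) = 2 * t" by auto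
      with 1 show ?thesis by (simp add: concat_path_def)
    next
      case 2
      then have "min (min (2 * t) (t + 1/4)) ((t + 1) / 2) = t + 1/4" by (auto simp: min_def)
      with 2 show ?thesis by (simp add: concat_path_def algebra_simps)
    next
      case 3
      then have "min (min (2 * t) (t + 1/4)) ((t + 1) / 2) = (t + 1) / 2" by (auto simp: min_def)
      with 3 show ?thesis by (auto simp: concat_path_def field_simps intro!: arg_cong[of _ _ k])
    qed
  qed (auto simp: min_def)
qed

section \<open>Lifting relative to the boundary over a contractible base\<close>

text \<open>\<open>squeeze\<close> is constant on the outer quarters of the interval and \<open>height\<close> equals 1 on the rest. A path
  reparametrised by \<open>squeeze\<close> thus has a collar at each end, on which \<open>height\<close> grows from 0 to 1 and
  which leaves room for a detour along a contraction that does not move the end point itself.\<close>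

definition squeeze :: "real \<Rightarrow> real" where
  "squeeze x = max 0 (min 1 (2 * x - 1/2))"

definition height :: "real \<Rightarrow> real" where
  "height x = max 0 (min 1 (min (4 * x) (4 * (1 - x))))"

lemma squeeze_simps [simp]: "squeeze 0 = 0" "squeeze 1 = 1" "0 \<le> squeeze x" "squeeze x \<le> 1"
  by (auto simp: squeeze_def)

lemma height_simps [simp]: "height 0 = 0" "height 1 = 0" "0 \<le> height x" "height x \<le> 1"
  by (auto simp: height_def)

lemma min_height_0 [simp]: "min (height x) 0 = 0" "min 0 (height x) = 0"
  by (simp_all add: min_absorb1 min_absorb2)

lemma height_less_1_imp_squeeze: "height x < 1 \<Longrightarrow> squeeze x = 0 \<or> squeeze x = 1"
  by (auto simp: height_def squeeze_def max_def min_def split: if_splits)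

lemma continuous_on_squeeze [continuous_intros]:
  "continuous_on A f \<Longrightarrow> continuous_on A (\<lambda>x. squeeze (f x))"
  unfolding squeeze_def by (intro continuous_intros)

lemma continuous_on_height [continuous_intros]:
  "continuous_on A f \<Longrightarrow> continuous_on A (\<lambda>x. height (f x))"
  unfolding height_def by (intro continuous_intros)

lemma continuous_map_compose_apply:
  "continuous_map X Y f \<Longrightarrow> continuous_map Y Z g \<Longrightarrow> continuous_map X Z (\<lambda>x. g (f x))"
  using continuous_map_compose[of X Y f Z g] by (simp add: o_def)

lemma path_homotopic_squeeze: "pathin Y g \<Longrightarrow> path_homotopic Y (g \<circ> squeeze) g"
  by (rule path_homotopic_reparam_id) (auto intro!: continuous_intros)

lemma contractible_spaceE:
  assumes "contractible_space D"
  obtains C a where "continuous_map (prod_topology unit_interval D) D C"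
    "\<And>d. C (0, d) = d" "\<And>d. C (1, d) = a"
  using assms unfolding contractible_space_def homotopic_with_def by auto

text \<open>Each point of \<open>g\<close> is pulled along the contraction for a time limited by \<open>height\<close>, and then pushed out
  again along \<open>k\<close>. Half way both paths agree: away from the collars they have arrived at the centre of
  the contraction, and on the collars they are at their common end points.\<close>

lemma contractible_imp_path_homotopic:
  assumes D: "contractible_space D" and g: "pathin D g" and k: "pathin D k"
    and eq: "g 0 = k 0" "g 1 = k 1"
  shows "path_homotopic D g k"
proof -
  obtain C a where C: "continuous_map (prod_topology unit_interval D) D C"
    "\<And>d. C (0, d) = d" "\<And>d. C (1, d) = a"
    using contractible_spaceE[OF D] by blast
  let ?I = "unit_square"
  let ?v = "\<lambda>x. if fst x \<le> 1/2 then C (min (height (snd x)) (2 * fst x), g (squeeze (snd x)))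
                 else C (min (height (snd x)) (2 - 2 * fst x), k (squeeze (snd x)))"
  have cont: "continuous_map ?I D (\<lambda>x. C (min (height (snd x)) (u x), f (squeeze (snd x))))"
    if "pathin D f" "continuous_on ({0..1} \<times> {0..1}) u" "\<And>x. x \<in> {0..1} \<times> {0..1} \<Longrightarrow> 0 \<le> u x" for f u
  proof (rule continuous_map_compose_apply[OF _ C(1)], rule continuous_map_pairedI)
    show "continuous_map ?I unit_interval (\<lambda>x. min (height (snd x)) (u x))"
      using that by (intro continuous_map_unit_square) (auto intro!: continuous_intros simp: min_le_iff_disj)
    show "continuous_map ?I D (\<lambda>x. f (squeeze (snd x)))"
      by (rule continuous_map_compose_apply[OF continuous_map_unit_square that(1)[unfolded pathin_def]])
         (auto intro!: continuous_intros)
  qed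
  have "continuous_map ?I D ?v"
  proof (rule continuous_map_cases_le)
    show "continuous_map ?I euclideanreal fst" "continuous_map ?I euclideanreal (\<lambda>x. 1/2)"
      by (auto simp: unit_square_topology intro!: continuous_intros)
    fix x assume x: "x \<in> topspace ?I" "fst x = 1/2"
    have "C (height (snd x), g (squeeze (snd x))) = C (height (snd x), k (squeeze (snd x)))"
    proof (cases "height (snd x) < 1")
      case True
      then show ?thesis using height_less_1_imp_squeeze eq by metis
    next
      case False
      then have "height (snd x) = 1" using height_simps(4)[of "snd x"] by linarith
      then show ?thesis by (simp add: C(3))
    qed
    moreover have "min (height (snd x)) (2 * fst x) = height (snd x)"
      "min (height (snd x)) (2 - 2 * fst x) = height (snd x)"
      using x(2) by (auto simp: mult.commute[of 2])
    ultimately show "C (min (height (snd x)) (2 * fst x), g (squeeze (snd x))) =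
        C (min (height (snd x)) (2 - 2 * fst x), k (squeeze (snd x)))"
      by simp
  qed (intro continuous_map_from_subtopology cont g k; auto intro!: continuous_intros)+
  then have "path_homotopic D (g \<circ> squeeze) (k \<circ> squeeze)"
    unfolding path_homotopic_iff_square
    by (intro exI[of _ ?v]) (auto simp: C(2) eq)
  then show ?thesis
    using path_homotopic_squeeze[OF g] path_homotopic_squeeze[OF k]
    by (meson path_homotopic_sym path_homotopic_trans)
qed

text \<open>The homotopy lifting property for the single test space \<open>B\<close>.\<close>

definition lifts_homotopies :: "'b topology \<Rightarrow> 'x topology \<Rightarrow> 's topology \<Rightarrow> ('x \<Rightarrow> 's) \<Rightarrow> bool" where
  "lifts_homotopies B E D \<pi> \<longleftrightarrow>
     (\<forall>f h. continuous_map B E f \<and> continuous_map (prod_topology B unit_interval) D h \<and>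
            (\<forall>b\<in>topspace B. h (b, 0) = \<pi> (f b)) \<longrightarrow>
        (\<exists>k. continuous_map (prod_topology B unit_interval) E k \<and>
             (\<forall>b\<in>topspace B. k (b, 0) = f b) \<and>
             (\<forall>b\<in>topspace B. \<forall>t\<in>{0..1}. \<pi> (k (b, t)) = h (b, t))))"

lemma serre_fibration_lifts_cube: "serre_fibration X S p \<Longrightarrow> lifts_homotopies (cube n) X S p"
  unfolding serre_fibration_def lifts_homotopies_def by blast

text \<open>Cubes are spaces of functions on index sets; this lemma passes to the interval and the square
  as spaces of numbers and pairs.\<close>

lemma lifts_homotopies_retract:
  assumes lift: "lifts_homotopies B' E D \<pi>"
    and i: "continuous_map B B' i" and r: "continuous_map B' B r"
    and ri: "\<And>b. b \<in> topspace B \<Longrightarrow> r (i b) = b"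
  shows "lifts_homotopies B E D \<pi>"
  unfolding lifts_homotopies_def
proof (intro allI impI, elim conjE)
  fix f h assume f: "continuous_map B E f" and h: "continuous_map (prod_topology B unit_interval) D h"
    and eq: "\<forall>b\<in>topspace B. h (b, 0) = \<pi> (f b)"
  have "continuous_map B' E (f \<circ> r)" using r f by (rule continuous_map_compose)
  moreover have "continuous_map (prod_topology B' unit_interval) D (\<lambda>x. h (r (fst x), snd x))"
    by (intro continuous_map_compose_apply[OF _ h] continuous_map_pairedI
        continuous_map_compose_apply[OF continuous_map_fst r] continuous_map_snd)
  moreover have "\<forall>b\<in>topspace B'. h (r b, 0) = \<pi> ((f \<circ> r) b)"
    using r eq continuous_map_image_subset_topspace by fastforce
  ultimately obtain k where k: "continuous_map (prod_topology B' unit_interval) E k"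
      "\<And>b. b\<in>topspace B' \<Longrightarrow> k (b, 0) = f (r b)"
      "\<And>b t. b\<in>topspace B' \<Longrightarrow> t\<in>{0..1} \<Longrightarrow> \<pi> (k (b, t)) = h (r b, t)"
    using lift[unfolded lifts_homotopies_def, rule_format, of "f \<circ> r" "\<lambda>x. h (r (fst x), snd x)"]
    by auto
  have "continuous_map (prod_topology B unit_interval) E (\<lambda>x. k (i (fst x), snd x))"
    by (intro continuous_map_compose_apply[OF _ k(1)] continuous_map_pairedI
        continuous_map_compose_apply[OF continuous_map_fst i] continuous_map_snd)
  then show "\<exists>k. continuous_map (prod_topology B unit_interval) E k \<and>
             (\<forall>b\<in>topspace B. k (b, 0) = f b) \<and>
             (\<forall>b\<in>topspace B. \<forall>t\<in>{0..1}. \<pi> (k (b, t)) = h (b, t))"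
    using k(2,3) ri i continuous_map_image_subset_topspace
    by (intro exI[of _ "\<lambda>x. k (i (fst x), snd x)"]) (fastforce simp: image_subset_iff)
qed

lemma serre_fibration_lifts_interval:
  assumes "serre_fibration X S p" shows "lifts_homotopies unit_interval X S p"
proof (rule lifts_homotopies_retract[OF serre_fibration_lifts_cube[OF assms, of 1]])
  show "continuous_map unit_interval (cube 1) (\<lambda>x. \<lambda>i\<in>{..<1}. x)"
    unfolding cube_def by (rule continuous_map_coordinatewise_then_product) (auto simp: continuous_map_id[unfolded id_def])
  show "continuous_map (cube 1) unit_interval (\<lambda>c. c 0)"
    unfolding cube_def by (rule continuous_map_product_projection) simp
qed auto

lemma serre_fibration_lifts_square:
  assumes "serre_fibration X S p"
  shows "lifts_homotopies unit_square X S p"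
proof (rule lifts_homotopies_retract[OF serre_fibration_lifts_cube[OF assms, of 2]])
  show "continuous_map unit_square (cube 2)
      (\<lambda>x. \<lambda>i\<in>{..<2}. if i = 0 then fst x else snd x)"
    unfolding cube_def
  proof (rule continuous_map_coordinatewise_then_product)
    fix i :: nat assume i: "i \<in> {..<2}"
    show "continuous_map unit_square unit_interval
         (\<lambda>x. (\<lambda>i\<in>{..<2}. if i = 0 then fst x else snd x) i)"
      using i by (cases "i = 0") (auto simp: unit_square_topology intro!: continuous_intros)
  qed auto
  show "continuous_map (cube 2) unit_square (\<lambda>c. (c 0, c 1))"
    unfolding cube_def by (intro continuous_map_pairedI continuous_map_product_projection) auto
qed auto

lemma lifts_homotopies_pullback:
  assumes lift: "lifts_homotopies B X S p" and f: "continuous_map D S f"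
  shows "lifts_homotopies B
      (subtopology (prod_topology X D) {(x, d). x \<in> topspace X \<and> d \<in> topspace D \<and> p x = f d}) D snd"
    (is "lifts_homotopies B ?E D snd")
  unfolding lifts_homotopies_def
proof (intro allI impI, elim conjE)
  fix g h assume g: "continuous_map B ?E g" and h: "continuous_map (prod_topology B unit_interval) D h"
    and eq: "\<forall>b\<in>topspace B. h (b, 0) = snd (g b)"
  have gE: "g b \<in> topspace ?E" if "b \<in> topspace B" for b
    using g that continuous_map_image_subset_topspace by fastforce
  have "continuous_map B X (\<lambda>b. fst (g b))"
    using continuous_map_compose_apply[OF continuous_map_into_fulltopology[OF g] continuous_map_fst] .
  moreover have "continuous_map (prod_topology B unit_interval) S (\<lambda>x. f (h x))"
    by (rule continuous_map_compose_apply[OF h f])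
  moreover have "f (h (b, 0)) = p (fst (g b))" if "b \<in> topspace B" for b
    using gE[OF that] eq that by auto
  ultimately obtain k where k: "continuous_map (prod_topology B unit_interval) X k"
      "\<And>b. b\<in>topspace B \<Longrightarrow> k (b, 0) = fst (g b)"
      "\<And>b t. b\<in>topspace B \<Longrightarrow> t\<in>{0..1} \<Longrightarrow> p (k (b, t)) = f (h (b, t))"
    using lift[unfolded lifts_homotopies_def, rule_format, of "\<lambda>b. fst (g b)" "\<lambda>x. f (h x)"] by auto
  have "continuous_map (prod_topology B unit_interval) ?E (\<lambda>x. (k x, h x))"
    using k(1,3) h continuous_map_image_subset_topspace[OF k(1)] continuous_map_image_subset_topspace[OF h]
    by (auto intro!: continuous_map_into_subtopology continuous_map_pairedI simp: image_subset_iff)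
  then show "\<exists>k. continuous_map (prod_topology B unit_interval) ?E k \<and>
             (\<forall>b\<in>topspace B. k (b, 0) = g b) \<and>
             (\<forall>b\<in>topspace B. \<forall>t\<in>{0..1}. snd (k (b, t)) = h (b, t))"
    using k(2) eq by (intro exI[of _ "\<lambda>x. (k x, h x)"]) auto
qed

text \<open>The projection of \<open>K\<close> is pulled along the contraction of the base for time \<open>lam\<close> and then pushed out
  again along \<open>v\<close>; this makes sense because \<open>v\<close> agrees with the projection wherever the centre of the
  contraction has not been reached. The whole excursion takes time \<open>2 lam\<close>. A lift of it that is stopped
  at that moment lies over \<open>v\<close>, and it has not moved where \<open>lam\<close> vanishes. Stopping the clock early
  replaces the homotopy lifting property relative to a subspace.\<close>

lemma lift_rel_boundary:
  assumes lift: "lifts_homotopies B E D \<pi>" and D: "contractible_space D" and \<pi>: "continuous_map E D \<pi>"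
    and K: "continuous_map B E K" and v: "continuous_map B D v"
    and lam: "continuous_map B unit_interval lam"
    and eq: "\<And>b. b \<in> topspace B \<Longrightarrow> lam b < 1 \<Longrightarrow> v b = \<pi> (K b)"
  obtains l where "continuous_map (prod_topology B unit_interval) E l"
    "\<And>b. b \<in> topspace B \<Longrightarrow> l (b, 0) = K b"
    "\<And>b s. b \<in> topspace B \<Longrightarrow> lam b = 0 \<Longrightarrow> l (b, s) = K b"
    "\<And>b. b \<in> topspace B \<Longrightarrow> \<pi> (l (b, 1)) = v b"
proof -
  obtain C a where C: "continuous_map (prod_topology unit_interval D) D C"
    "\<And>d. C (0, d) = d" "\<And>d. C (1, d) = a"
    using contractible_spaceE[OF D] by blast
  let ?BI = "prod_topology B unit_interval"
  have lamI: "0 \<le> lam b" "lam b \<le> 1" if "b \<in> topspace B" for b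
    using continuous_map_image_subset_topspace[OF lam] that by (auto simp: image_subset_iff)
  let ?h = "\<lambda>x. if 2 * snd x \<le> lam (fst x) then C (min (2 * snd x) 1, \<pi> (K (fst x)))
                 else C (max 0 (min 1 (2 * lam (fst x) - 2 * snd x)), v (fst x))"
  have lamc: "continuous_map ?BI euclideanreal (\<lambda>x. lam (fst x))"
    using continuous_map_compose_apply[OF continuous_map_fst lam] by (rule continuous_map_into_fulltopology)
  have sndc: "continuous_map ?BI euclideanreal snd"
    using continuous_map_snd by (rule continuous_map_into_fulltopology)
  have h: "continuous_map ?BI D ?h"
  proof (rule continuous_map_cases_le)
    have "continuous_map ?BI unit_interval (\<lambda>x. min (2 * snd x) 1)"
      by (auto simp: continuous_map_in_subtopology intro!: continuous_intros sndc)
    then show "continuous_map (subtopology ?BI {x \<in> topspace ?BI. 2 * snd x \<le> lam (fst x)}) D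
        (\<lambda>x. C (min (2 * snd x) 1, \<pi> (K (fst x))))"
      by (intro continuous_map_from_subtopology continuous_map_compose_apply[OF _ C(1)] continuous_map_pairedI
          continuous_map_compose_apply[OF _ \<pi>] continuous_map_compose_apply[OF _ K] continuous_map_fst)
    have "continuous_map ?BI unit_interval (\<lambda>x. max 0 (min 1 (2 * lam (fst x) - 2 * snd x)))"
      by (auto simp: continuous_map_in_subtopology intro!: continuous_intros sndc lamc)
    then show "continuous_map (subtopology ?BI {x \<in> topspace ?BI. lam (fst x) \<le> 2 * snd x}) D
        (\<lambda>x. C (max 0 (min 1 (2 * lam (fst x) - 2 * snd x)), v (fst x)))"
      by (intro continuous_map_from_subtopology continuous_map_compose_apply[OF _ C(1)] continuous_map_pairedI
          continuous_map_compose_apply[OF _ v] continuous_map_fst)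
    fix x assume x: "x \<in> topspace ?BI" "2 * snd x = lam (fst x)"
    then have b: "fst x \<in> topspace B" by auto
    show "C (min (2 * snd x) 1, \<pi> (K (fst x))) =
        C (max 0 (min 1 (2 * lam (fst x) - 2 * snd x)), v (fst x))"
      using x(2) lamI[OF b] eq[OF b] C(3) by (cases "lam (fst x) = 1") auto
  qed (auto intro!: continuous_intros sndc lamc)
  have "?h (b, 0) = \<pi> (K b)" if "b \<in> topspace B" for b
    using lamI[OF that] by (simp add: C(2))
  then obtain k where k: "continuous_map ?BI E k" "\<And>b. b\<in>topspace B \<Longrightarrow> k (b, 0) = K b"
      "\<And>b t. b\<in>topspace B \<Longrightarrow> t\<in>{0..1} \<Longrightarrow> \<pi> (k (b, t)) = ?h (b, t)"
    using lift[unfolded lifts_homotopies_def, rule_format, of K ?h] K h by auto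
  \<comment> \<open>The homotopy \<open>?h\<close> runs at double speed, so the excursion over \<open>b\<close> ends at time \<open>lam b\<close>.\<close>
  let ?l = "\<lambda>x. k (fst x, snd x * lam (fst x))"
  have "continuous_map ?BI unit_interval (\<lambda>x. snd x * lam (fst x))"
    using lamI by (auto simp: continuous_map_in_subtopology mult_le_one intro!: continuous_intros sndc lamc)
  then have "continuous_map ?BI E ?l"
    by (intro continuous_map_compose_apply[OF _ k(1)] continuous_map_pairedI continuous_map_fst)
  moreover have "\<pi> (?l (b, 1)) = v b" if b: "b \<in> topspace B" for b
    using lamI[OF b] eq[OF b] k(3)[OF b, of "lam b"] by (auto simp: C(2))
  ultimately show thesis
    using k(2) by (intro that[of ?l]) auto
qed

text \<open>Squeezed paths satisfy the hypotheses of \<open>lift_rel_boundary\<close> with \<open>height\<close> as time, because they stay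
  at their end points on the collars. The lift is itself the required homotopy.\<close>

lemma lift_path:
  assumes lift: "lifts_homotopies unit_interval E D \<pi>" and D: "contractible_space D"
    and \<pi>: "continuous_map E D \<pi>" and c: "pathin E c" and d: "pathin D d"
    and eq: "d 0 = \<pi> (c 0)" "d 1 = \<pi> (c 1)"
  obtains c' where "path_homotopic E c c'" "\<And>t. t \<in> {0..1} \<Longrightarrow> \<pi> (c' t) = d (squeeze t)"
proof -
  have sq: "continuous_map unit_interval unit_interval squeeze"
    "continuous_map unit_interval unit_interval height"
    by (auto intro!: continuous_intros)
  obtain l where l: "continuous_map unit_square E l"
    "\<And>b. b \<in> {0..1} \<Longrightarrow> l (b, 0) = c (squeeze b)"
    "\<And>b s. b \<in> {0..1} \<Longrightarrow> height b = 0 \<Longrightarrow> l (b, s) = c (squeeze b)"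
    "\<And>b. b \<in> {0..1} \<Longrightarrow> \<pi> (l (b, 1)) = d (squeeze b)"
  proof -
    have bd: "d (squeeze b) = \<pi> (c (squeeze b))" if "height b < 1" for b
      using height_less_1_imp_squeeze[OF that] eq by auto
    show thesis
      by (rule lift_rel_boundary[OF lift D \<pi> continuous_map_compose_apply[OF sq(1) c[unfolded pathin_def]]
            continuous_map_compose_apply[OF sq(1) d[unfolded pathin_def]] sq(2) bd that]) simp_all
  qed
  have "continuous_map unit_square E (\<lambda>x. l (snd x, fst x))"
    by (intro continuous_map_compose_apply[OF _ l(1)] continuous_map_pairedI continuous_map_fst continuous_map_snd)
  then have "path_homotopic E (c \<circ> squeeze) (\<lambda>t. l (t, 1))"
    unfolding path_homotopic_iff_square
    by (intro exI[of _ "\<lambda>x. l (snd x, fst x)"]) (auto simp: l(2,3))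
  then have "path_homotopic E c (\<lambda>t. l (t, 1))"
    using path_homotopic_squeeze[OF c] path_homotopic_sym path_homotopic_trans by blast
  then show thesis using that l(4) by blast
qed

text \<open>Squeezing both parameters sends a collar of the square to its boundary, where \<open>v\<close> and the projection
  of \<open>K\<close> agree; the smaller of the two heights is then a time to which \<open>lift_rel_boundary\<close> applies.\<close>

lemma lift_square:
  assumes lift: "lifts_homotopies unit_square E D \<pi>" and D: "contractible_space D"
    and \<pi>: "continuous_map E D \<pi>"
    and K: "continuous_map unit_square E K"
    and v: "continuous_map unit_square D v"
    and eq: "\<And>s t. s \<in> {0..1} \<Longrightarrow> t \<in> {0..1} \<Longrightarrow> s \<in> {0, 1} \<or> t \<in> {0, 1} \<Longrightarrow> v (s, t) = \<pi> (K (s, t))"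
  obtains l where "continuous_map unit_square E l"
    "\<And>s t. s \<in> {0..1} \<Longrightarrow> t \<in> {0..1} \<Longrightarrow> s \<in> {0, 1} \<or> t \<in> {0, 1} \<Longrightarrow>
       l (s, t) = K (squeeze s, squeeze t)"
    "\<And>s t. s \<in> {0..1} \<Longrightarrow> t \<in> {0..1} \<Longrightarrow> \<pi> (l (s, t)) = v (squeeze s, squeeze t)"
proof -
  let ?I = "unit_square"
  let ?r = "\<lambda>x. (squeeze (fst x), squeeze (snd x))"
  have r: "continuous_map ?I ?I ?r" 
    unfolding unit_square_topology by (auto intro!: continuous_intros)
  have lam: "continuous_map ?I unit_interval (\<lambda>x. min (height (fst x)) (height (snd x)))"
    by (rule continuous_map_unit_square) (auto intro!: continuous_intros simp: min_le_iff_disj)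
  have "v (?r b) = \<pi> (K (?r b))" if "b \<in> topspace ?I" "min (height (fst b)) (height (snd b)) < 1" for b
    using that height_less_1_imp_squeeze by (intro eq) (auto simp: min_less_iff_disj)
  note bd = this
  obtain l where l: "continuous_map (prod_topology ?I unit_interval) E l"
    "\<And>b. b \<in> topspace ?I \<Longrightarrow> l (b, 0) = K (?r b)"
    "\<And>b s. b \<in> topspace ?I \<Longrightarrow> min (height (fst b)) (height (snd b)) = 0 \<Longrightarrow> l (b, s) = K (?r b)"
    "\<And>b. b \<in> topspace ?I \<Longrightarrow> \<pi> (l (b, 1)) = v (?r b)"
    by (rule lift_rel_boundary[OF lift D \<pi> continuous_map_compose_apply[OF r K]
        continuous_map_compose_apply[OF r v] lam bd that]) assumption+
  have "continuous_map ?I E (\<lambda>x. l (x, 1))"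
    by (intro continuous_map_compose_apply[OF _ l(1)] continuous_map_pairedI) (auto simp: continuous_map_id[unfolded id_def])
  then show thesis
    by (rule that) (auto simp: l(3,4))
qed

section \<open>The topology of the fundamental groupoid\<close>

lemma path_class_eq_iff:
  "pathin Y g \<Longrightarrow> path_class Y g = path_class Y k \<longleftrightarrow> path_homotopic Y g k"
  unfolding path_class_eq_Collect
  using path_homotopic_refl path_homotopic_sym path_homotopic_trans by blast

lemma rep_path_class: "pathin Y g \<Longrightarrow> path_homotopic Y g (rep (path_class Y g))"
  unfolding rep_def path_class_eq_Collect using path_homotopic_refl[of Y g] by (simp add: someI_ex) (metis someI)

lemma path_class_in_arrow_set: "pathin Y g \<Longrightarrow> path_class Y g \<in> arrow_set Y"
  by (simp add: arrow_set_def)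

lemma arrow_setE:
  assumes "a \<in> arrow_set Y" obtains g where "pathin Y g" "a = path_class Y g"
  using assms by (auto simp: arrow_set_def)

lemma start_path_class [simp]: "pathin Y g \<Longrightarrow> start (path_class Y g) = g 0"
  and finish_path_class [simp]: "pathin Y g \<Longrightarrow> finish (path_class Y g) = g 1"
  using rep_path_class path_homotopic_imp_pathin by (fastforce simp: start_def finish_def)+

lemma pathin_imp_endpoints: "pathin Y g \<Longrightarrow> g 0 \<in> topspace Y \<and> g 1 \<in> topspace Y"
  unfolding pathin_def by (drule continuous_map_image_subset_topspace) (auto simp: image_subset_iff)

lemma start_in_topspace: "a \<in> arrow_set Y \<Longrightarrow> start a \<in> topspace Y"
  and finish_in_topspace: "a \<in> arrow_set Y \<Longrightarrow> finish a \<in> topspace Y"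
  by (auto elim!: arrow_setE dest: pathin_imp_endpoints)

lemma arrow_comp_path_class:
  assumes "pathin Y g" "pathin Y k" "g 1 = k 0"
  shows "arrow_comp Y (path_class Y g) (path_class Y k) = path_class Y (concat_path g k)"
proof -
  have "path_homotopic Y (concat_path g k) (concat_path (rep (path_class Y g)) (rep (path_class Y k)))"
    using assms by (intro path_homotopic_concat rep_path_class)
  then show ?thesis
    unfolding arrow_comp_def using path_class_eq_iff path_homotopic_imp_pathin(1) by metis
qed

lemma concat_path_endpoints [simp]: "concat_path g k 0 = g 0" "concat_path g k 1 = k 1"
  by (auto simp: concat_path_def)

lemma
  assumes "a \<in> arrow_set Y" "b \<in> arrow_set Y" "finish a = start b"
  shows arrow_comp_in_arrow_set: "arrow_comp Y a b \<in> arrow_set Y"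
    and start_arrow_comp: "start (arrow_comp Y a b) = start a"
    and finish_arrow_comp: "finish (arrow_comp Y a b) = finish b"
  using assms
  by (auto elim!: arrow_setE simp: arrow_comp_path_class pathin_concat path_class_in_arrow_set)

lemma arrow_comp_assoc:
  assumes "a \<in> arrow_set Y" "b \<in> arrow_set Y" "c \<in> arrow_set Y" "finish a = start b" "finish b = start c"
  shows "arrow_comp Y (arrow_comp Y a b) c = arrow_comp Y a (arrow_comp Y b c)"
proof -
  obtain f g k where "pathin Y f" "a = path_class Y f" "pathin Y g" "b = path_class Y g"
      "pathin Y k" "c = path_class Y k"
    using assms(1-3) by (meson arrow_setE)
  then show ?thesis
    using assms(4,5)
    by (simp add: arrow_comp_path_class pathin_concat path_class_eq_iff path_homotopic_concat_assoc)
qed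

lemma pathin_const: "y \<in> topspace Y \<Longrightarrow> pathin Y (\<lambda>_. y)"
  by (simp add: pathin_def)

lemma arrow_comp_const_left:
  assumes "a \<in> arrow_set Y" shows "arrow_comp Y (path_class Y (\<lambda>_. start a)) a = a"
proof -
  obtain g where g: "pathin Y g" "a = path_class Y g" using assms by (rule arrow_setE)
  have "path_class Y (concat_path (\<lambda>_. g 0) g) = path_class Y g"
    using path_homotopic_const_concat[OF g(1)] path_class_eq_iff path_homotopic_imp_pathin(1) by blast
  then show ?thesis
    using g by (simp add: arrow_comp_path_class pathin_const pathin_imp_endpoints)
qed

lemma arrow_comp_const_right:
  assumes "a \<in> arrow_set Y" shows "arrow_comp Y a (path_class Y (\<lambda>_. finish a)) = a"
proof -
  obtain g where g: "pathin Y g" "a = path_class Y g" using assms by (rule arrow_setE)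
  have "path_class Y (concat_path g (\<lambda>_. g 1)) = path_class Y g"
    using path_homotopic_concat_const[OF g(1)] path_class_eq_iff path_homotopic_imp_pathin(1) by blast
  then show ?thesis
    using g by (simp add: arrow_comp_path_class pathin_const pathin_imp_endpoints)
qed

lemma Pi1_map_path_class:
  assumes "pathin Y g" "continuous_map Y (mtop Z) f"
  shows "Pi1_map Z f (path_class Y g) = path_class (mtop Z) (f \<circ> g)"
proof -
  have "path_homotopic (mtop Z) (f \<circ> g) (f \<circ> rep (path_class Y g))"
    by (intro path_homotopic_map[OF rep_path_class] assms)
  then show ?thesis
    unfolding Pi1_map_def using path_class_eq_iff path_homotopic_imp_pathin(1) by metis
qed

lemma
  assumes "a \<in> arrow_set Y" "continuous_map Y (mtop Z) f"
  shows Pi1_map_in_arrow_set: "Pi1_map Z f a \<in> arrow_set (mtop Z)"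
    and start_Pi1_map: "start (Pi1_map Z f a) = f (start a)"
    and finish_Pi1_map: "finish (Pi1_map Z f a) = f (finish a)"
  using assms
  by (auto elim!: arrow_setE simp: Pi1_map_path_class pathin_map path_class_in_arrow_set)

lemma comp_concat_path: "f \<circ> concat_path g k = concat_path (f \<circ> g) (f \<circ> k)"
  by (auto simp: concat_path_def)

lemma Pi1_map_arrow_comp:
  assumes "a \<in> arrow_set Y" "b \<in> arrow_set Y" "finish a = start b" "continuous_map Y (mtop Z) f"
  shows "Pi1_map Z f (arrow_comp Y a b) = arrow_comp (mtop Z) (Pi1_map Z f a) (Pi1_map Z f b)"
  using assms
  by (auto elim!: arrow_setE simp: arrow_comp_path_class Pi1_map_path_class pathin_map pathin_concat comp_concat_path)

lemma Pi1_map_compose: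
  assumes "a \<in> arrow_set Y" "continuous_map Y (mtop Z) f" "continuous_map (mtop Z) (mtop W) g"
  shows "Pi1_map W g (Pi1_map Z f a) = Pi1_map W (g \<circ> f) a"
proof -
  obtain k where k: "pathin Y k" "a = path_class Y k" using assms(1) by (rule arrow_setE)
  have "continuous_map Y (mtop W) (g \<circ> f)" using assms(2,3) by (rule continuous_map_compose)
  then show ?thesis
    using k assms(2,3) by (simp add: Pi1_map_path_class pathin_map o_assoc)
qed

lemma pathin_subtopologyD: "pathin (subtopology Y U) u \<Longrightarrow> pathin Y u \<and> u 0 \<in> U \<and> u 1 \<in> U"
  using pathin_imp_endpoints[of "subtopology Y U" u] by (auto simp: pathin_def continuous_map_in_subtopology)

lemma arrow_nbhdE:
  assumes "b \<in> arrow_nbhd Y a U V"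
  obtains u v where "b = arrow_comp Y (arrow_comp Y (path_class Y u) a) (path_class Y v)"
    "pathin (subtopology Y U) u" "u 1 = start a" "pathin (subtopology Y V) v" "v 0 = finish a"
    "pathin Y u" "pathin Y v" "u 0 \<in> U" "v 1 \<in> V"
  using assms pathin_subtopologyD unfolding arrow_nbhd_def by blast

lemma arrow_nbhdI:
  assumes "pathin (subtopology Y U) u" "u 1 = start a" "pathin (subtopology Y V) v" "v 0 = finish a"
  shows "arrow_comp Y (arrow_comp Y (path_class Y u) a) (path_class Y v) \<in> arrow_nbhd Y a U V"
  unfolding arrow_nbhd_def using assms by blast

lemma arrow_nbhd_endpoints:
  assumes "a \<in> arrow_set Y" "b \<in> arrow_nbhd Y a U V"
  shows "b \<in> arrow_set Y" "start b \<in> U" "finish b \<in> V"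
  using assms(2,1)
  by (auto elim!: arrow_nbhdE simp: arrow_comp_in_arrow_set start_arrow_comp finish_arrow_comp path_class_in_arrow_set)

lemma arrow_in_arrow_nbhd:
  assumes "a \<in> arrow_set Y" "start a \<in> U" "finish a \<in> V"
  shows "a \<in> arrow_nbhd Y a U V"
  using arrow_nbhdI[of Y U "\<lambda>_. start a" a V "\<lambda>_. finish a"] assms
    start_in_topspace[OF assms(1)] finish_in_topspace[OF assms(1)]
  by (simp add: pathin_const arrow_comp_const_left arrow_comp_const_right)

lemma pathin_subtopology_mono: "pathin (subtopology Y U) u \<Longrightarrow> U \<subseteq> U' \<Longrightarrow> pathin (subtopology Y U') u"
  by (auto simp: pathin_def continuous_map_in_subtopology)

lemma arrow_nbhd_mono: "U \<subseteq> U' \<Longrightarrow> V \<subseteq> V' \<Longrightarrow> arrow_nbhd Y a U V \<subseteq> arrow_nbhd Y a U' V'"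
  unfolding arrow_nbhd_def using pathin_subtopology_mono by blast

text \<open>Moving the end points of an arrow twice inside \<open>U\<close> and \<open>V\<close> is the same as moving them once. Hence the
  sets generating the topology form a basis, in which every arrow can be taken as the centre.\<close>

lemma arrow_nbhd_subset:
  assumes a: "a \<in> arrow_set Y" and b: "b \<in> arrow_nbhd Y a U V"
  shows "arrow_nbhd Y b U V \<subseteq> arrow_nbhd Y a U V"
proof
  fix c assume "c \<in> arrow_nbhd Y b U V"
  then obtain u' v' where c: "c = arrow_comp Y (arrow_comp Y (path_class Y u') b) (path_class Y v')"
    "pathin (subtopology Y U) u'" "u' 1 = start b" "pathin (subtopology Y V) v'" "v' 0 = finish b"
    "pathin Y u'" "pathin Y v'" by (rule arrow_nbhdE)
  obtain u v where b: "b = arrow_comp Y (arrow_comp Y (path_class Y u) a) (path_class Y v)"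
    "pathin (subtopology Y U) u" "u 1 = start a" "pathin (subtopology Y V) v" "v 0 = finish a"
    "pathin Y u" "pathin Y v" using b by (rule arrow_nbhdE)
  note arr = path_class_in_arrow_set[OF c(6)] path_class_in_arrow_set[OF c(7)]
     path_class_in_arrow_set[OF b(6)] path_class_in_arrow_set[OF b(7)] a
  have ends: "start b = u 0" "finish b = v 1"
    using arr b by (simp_all add: start_arrow_comp finish_arrow_comp arrow_comp_in_arrow_set)
  have "c = arrow_comp Y (arrow_comp Y (arrow_comp Y (path_class Y u') (path_class Y u)) a)
               (arrow_comp Y (path_class Y v) (path_class Y v'))"
    using arr c(3,5,6,7) b(3,5,6,7) ends unfolding c(1) b(1)
    by (simp add: arrow_comp_assoc arrow_comp_in_arrow_set start_arrow_comp finish_arrow_comp)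
  also have "\<dots> = arrow_comp Y (arrow_comp Y (path_class Y (concat_path u' u)) a) (path_class Y (concat_path v v'))"
    using c b ends by (simp add: arrow_comp_path_class)
  also have "\<dots> \<in> arrow_nbhd Y a U V"
    using c(2-5) b(2-5) ends by (intro arrow_nbhdI pathin_concat) auto
  finally show "c \<in> arrow_nbhd Y a U V" .
qed

lemma topspace_arrow_topology: "topspace (arrow_topology Y) = arrow_set Y"
proof
  show "topspace (arrow_topology Y) \<subseteq> arrow_set Y"
    unfolding arrow_topology_def using arrow_nbhd_endpoints(1) by fastforce
  show "arrow_set Y \<subseteq> topspace (arrow_topology Y)"
    unfolding arrow_topology_def topology_generated_by_topspace
    using arrow_in_arrow_nbhd[where Y=Y and U="topspace Y" and V="topspace Y"]
      start_in_topspace[where Y=Y] finish_in_topspace[where Y=Y] by fastforce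
qed

lemma openin_arrow_nbhd:
  "a \<in> arrow_set Y \<Longrightarrow> openin Y U \<Longrightarrow> openin Y V \<Longrightarrow> start a \<in> U \<Longrightarrow> finish a \<in> V \<Longrightarrow>
    openin (arrow_topology Y) (arrow_nbhd Y a U V)"
  unfolding arrow_topology_def by (rule topology_generated_by_Basis) blast

lemma openin_arrow_topology_iff:
  "openin (arrow_topology Y) T \<longleftrightarrow> T \<subseteq> arrow_set Y \<and>
     (\<forall>b\<in>T. \<exists>U V. openin Y U \<and> openin Y V \<and> start b \<in> U \<and> finish b \<in> V \<and> arrow_nbhd Y b U V \<subseteq> T)"
    (is "_ \<longleftrightarrow> _ \<and> ?R T")
proof (intro iffI conjI)
  assume T: "openin (arrow_topology Y) T"
  then show "T \<subseteq> arrow_set Y" using openin_subset topspace_arrow_topology by blast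
  have "generate_topology_on
       {arrow_nbhd Y a U V | a U V.
          a \<in> arrow_set Y \<and> openin Y U \<and> start a \<in> U \<and> openin Y V \<and> finish a \<in> V} T"
    using T unfolding arrow_topology_def by (rule openin_topology_generated_by)
  then show "?R T"
  proof induction
    case (Int A B)
    show ?case
    proof
      fix b assume "b \<in> A \<inter> B"
      then obtain U V U' V' where "openin Y U" "openin Y V" "start b \<in> U" "finish b \<in> V" "arrow_nbhd Y b U V \<subseteq> A"
        "openin Y U'" "openin Y V'" "start b \<in> U'" "finish b \<in> V'" "arrow_nbhd Y b U' V' \<subseteq> B"
        using Int.IH by (meson IntE)
      then show "\<exists>U V. openin Y U \<and> openin Y V \<and> start b \<in> U \<and> finish b \<in> V \<and> arrow_nbhd Y b U V \<subseteq> A \<inter> B"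
        using arrow_nbhd_mono[of "U \<inter> U'" U "V \<inter> V'" V Y b] arrow_nbhd_mono[of "U \<inter> U'" U' "V \<inter> V'" V' Y b]
        by (intro exI[of _ "U \<inter> U'"] exI[of _ "V \<inter> V'"]) auto
    qed
  next
    case (UN K)
    show ?case
    proof
      fix b assume "b \<in> \<Union>K"
      then obtain A where A: "A \<in> K" "b \<in> A" by blast
      then obtain U V where "openin Y U" "openin Y V" "start b \<in> U" "finish b \<in> V" "arrow_nbhd Y b U V \<subseteq> A"
        using UN.IH[OF A(1)] by meson
      then show "\<exists>U V. openin Y U \<and> openin Y V \<and> start b \<in> U \<and> finish b \<in> V \<and> arrow_nbhd Y b U V \<subseteq> \<Union>K"
        using A(1) by (intro exI[of _ U] exI[of _ V]) auto
    qed
  next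
    case (Basis T)
    then obtain a U V where T: "T = arrow_nbhd Y a U V" "a \<in> arrow_set Y" "openin Y U" "openin Y V" by blast
    show ?case
    proof
      fix b assume "b \<in> T"
      then show "\<exists>U V. openin Y U \<and> openin Y V \<and> start b \<in> U \<and> finish b \<in> V \<and> arrow_nbhd Y b U V \<subseteq> T"
        using T arrow_nbhd_subset[OF T(2), of b U V] arrow_nbhd_endpoints[OF T(2), of b U V]
        by (intro exI[of _ U] exI[of _ V]) simp
    qed
  qed simp
next
  assume T: "T \<subseteq> arrow_set Y \<and> ?R T"
  show "openin (arrow_topology Y) T"
    unfolding openin_subopen[of _ T]
  proof
    fix b assume "b \<in> T"
    with T obtain U V where "openin Y U" "openin Y V" "start b \<in> U" "finish b \<in> V" "arrow_nbhd Y b U V \<subseteq> T" "b \<in> arrow_set Y"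
      by blast
    then show "\<exists>A. openin (arrow_topology Y) A \<and> b \<in> A \<and> A \<subseteq> T"
      using openin_arrow_nbhd arrow_in_arrow_nbhd by metis
  qed
qed

lemma continuous_map_start: "continuous_map (arrow_topology Y) Y start"
  unfolding continuous_map_alt topspace_arrow_topology
proof (intro conjI allI impI)
  fix U assume U: "openin Y U"
  show "openin (arrow_topology Y) (start -` U \<inter> arrow_set Y)"
    unfolding openin_arrow_topology_iff
  proof (intro conjI ballI)
    fix b assume b: "b \<in> start -` U \<inter> arrow_set Y"
    then have "arrow_nbhd Y b (U) (topspace Y) \<subseteq> start -` U \<inter> arrow_set Y"
      using arrow_nbhd_endpoints by blast
    then show "\<exists>V V'. openin Y V \<and> openin Y V' \<and> start b \<in> V \<and> finish b \<in> V' \<and>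
        arrow_nbhd Y b V V' \<subseteq> start -` U \<inter> arrow_set Y"
      using U b finish_in_topspace by (intro exI[of _ "U"] exI[of _ "topspace Y"]) auto
  qed auto
qed (auto simp: start_in_topspace)

lemma continuous_map_finish: "continuous_map (arrow_topology Y) Y finish"
  unfolding continuous_map_alt topspace_arrow_topology
proof (intro conjI allI impI)
  fix U assume U: "openin Y U"
  show "openin (arrow_topology Y) (finish -` U \<inter> arrow_set Y)"
    unfolding openin_arrow_topology_iff
  proof (intro conjI ballI)
    fix b assume b: "b \<in> finish -` U \<inter> arrow_set Y"
    then have "arrow_nbhd Y b (topspace Y) (U) \<subseteq> finish -` U \<inter> arrow_set Y"
      using arrow_nbhd_endpoints by blast
    then show "\<exists>V V'. openin Y V \<and> openin Y V' \<and> start b \<in> V \<and> finish b \<in> V' \<and>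
        arrow_nbhd Y b V V' \<subseteq> finish -` U \<inter> arrow_set Y"
      using U b start_in_topspace by (intro exI[of _ "topspace Y"] exI[of _ "U"]) auto
  qed auto
qed (auto simp: finish_in_topspace)

text \<open>For such spaces the end points of an arrow are local coordinates on the space of arrows.\<close>

definition contractible_base :: "'a topology \<Rightarrow> bool" where
  "contractible_base Y \<longleftrightarrow>
     (\<forall>x T. openin Y T \<and> x \<in> T \<longrightarrow>
        (\<exists>U. openin Y U \<and> x \<in> U \<and> U \<subseteq> T \<and> contractible_space (subtopology Y U)))"

lemma contractible_baseE:
  assumes "contractible_base Y" "openin Y T" "x \<in> T"
  obtains U where "openin Y U" "x \<in> U" "U \<subseteq> T" "contractible_space (subtopology Y U)"
  using assms unfolding contractible_base_def by meson

lemma contractible_connect: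
  assumes "contractible_space (subtopology Y U)" "x \<in> U" "y \<in> U" "U \<subseteq> topspace Y"
  obtains g where "pathin (subtopology Y U) g" "g 0 = x" "g 1 = y"
proof -
  have "path_connected_space (subtopology Y U)" using assms(1) by (rule contractible_imp_path_connected_space)
  then show thesis using assms(2-4) that unfolding path_connected_space_def by (auto simp: inf.absorb2)
qed

lemma arrow_nbhd_image:
  assumes a: "a \<in> arrow_set Y" "start a \<in> U" "finish a \<in> V"
    and U: "openin Y U" "contractible_space (subtopology Y U)"
    and V: "openin Y V" "contractible_space (subtopology Y V)"
  shows "(\<lambda>a. (finish a, start a)) ` arrow_nbhd Y a U V = V \<times> U"
proof
  show "(\<lambda>a. (finish a, start a)) ` arrow_nbhd Y a U V \<subseteq> V \<times> U"
    using arrow_nbhd_endpoints[OF a(1)] by auto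
  show "V \<times> U \<subseteq> (\<lambda>a. (finish a, start a)) ` arrow_nbhd Y a U V"
  proof safe
    fix y x assume yx: "y \<in> V" "x \<in> U"
    obtain u where u: "pathin (subtopology Y U) u" "u 0 = x" "u 1 = start a"
      using contractible_connect[OF U(2) yx(2) a(2) openin_subset[OF U(1)]] .
    obtain v where v: "pathin (subtopology Y V) v" "v 0 = finish a" "v 1 = y"
      using contractible_connect[OF V(2) a(3) yx(1) openin_subset[OF V(1)]] .
    let ?b = "arrow_comp Y (arrow_comp Y (path_class Y u) a) (path_class Y v)"
    have "?b \<in> arrow_nbhd Y a U V" unfolding arrow_nbhd_def using u v by blast
    moreover have "start ?b = x" "finish ?b = y"
      using u v a pathin_subtopologyD[OF u(1)] pathin_subtopologyD[OF v(1)]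
      by (simp_all add: start_arrow_comp finish_arrow_comp arrow_comp_in_arrow_set path_class_in_arrow_set)
    ultimately show "(y, x) \<in> (\<lambda>a. (finish a, start a)) ` arrow_nbhd Y a U V" by force
  qed
qed

lemma contractible_path_class_eq:
  assumes "contractible_space (subtopology Y U)" "pathin (subtopology Y U) u" "pathin (subtopology Y U) u'"
    "u 0 = u' 0" "u 1 = u' 1"
  shows "path_class Y u = path_class Y u'"
proof -
  have "path_homotopic (subtopology Y U) u u'"
    using assms by (rule contractible_imp_path_homotopic)
  then have "path_homotopic Y (id \<circ> u) (id \<circ> u')"
    by (rule path_homotopic_map) (simp add: continuous_map_from_subtopology continuous_map_id)
  then show ?thesis using path_class_eq_iff path_homotopic_imp_pathin(1) by fastforce
qed

lemma inj_on_arrow_nbhd: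
  assumes a: "a \<in> arrow_set Y"
    and U: "contractible_space (subtopology Y U)" and V: "contractible_space (subtopology Y V)"
  shows "inj_on (\<lambda>a. (finish a, start a)) (arrow_nbhd Y a U V)"
proof (rule inj_onI)
  fix b c assume "b \<in> arrow_nbhd Y a U V" "c \<in> arrow_nbhd Y a U V"
    and eq: "(finish b, start b) = (finish c, start c)"
  then obtain u v u' v' where b: "b = arrow_comp Y (arrow_comp Y (path_class Y u) a) (path_class Y v)"
    "pathin (subtopology Y U) u" "u 1 = start a" "pathin (subtopology Y V) v" "v 0 = finish a"
    "pathin Y u" "pathin Y v" 
    and c: "c = arrow_comp Y (arrow_comp Y (path_class Y u') a) (path_class Y v')"
    "pathin (subtopology Y U) u'" "u' 1 = start a" "pathin (subtopology Y V) v'" "v' 0 = finish a"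
    "pathin Y u'" "pathin Y v'"
    by (elim arrow_nbhdE) blast
  have "u 0 = u' 0" "v 1 = v' 1"
    using eq b c a
    by (simp_all add: start_arrow_comp finish_arrow_comp arrow_comp_in_arrow_set path_class_in_arrow_set)
  then have "path_class Y u = path_class Y u'" "path_class Y v = path_class Y v'"
    using b c contractible_path_class_eq[OF U] contractible_path_class_eq[OF V] by metis+
  then show "b = c" using b(1) c(1) by simp
qed

text \<open>Connectedness of \<open>U\<close> and \<open>V\<close> lets both end points move freely, and the class of the connecting path is
  determined by its end points because \<open>U\<close> and \<open>V\<close> are contractible. Openness of the map follows by
  applying the same to smaller neighbourhoods.\<close>

lemma homeomorphic_map_arrow_nbhd:
  assumes Y: "contractible_base Y"
    and a: "a \<in> arrow_set Y" "start a \<in> U" "finish a \<in> V"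
    and U: "openin Y U" "contractible_space (subtopology Y U)"
    and V: "openin Y V" "contractible_space (subtopology Y V)"
  shows "homeomorphic_map (subtopology (arrow_topology Y) (arrow_nbhd Y a U V))
           (subtopology (prod_topology Y Y) (V \<times> U)) (\<lambda>a. (finish a, start a))"
proof (rule bijective_open_imp_homeomorphic_map)
  let ?W = "arrow_nbhd Y a U V" and ?e = "\<lambda>a. (finish a, start a)"
  have W: "openin (arrow_topology Y) ?W" using a U V by (simp add: openin_arrow_nbhd)
  then have topW: "topspace (subtopology (arrow_topology Y) ?W) = ?W"
    using openin_subset by force
  have VU: "V \<times> U \<subseteq> topspace (prod_topology Y Y)" using U V openin_subset by fastforce
  then show "?e ` topspace (subtopology (arrow_topology Y) ?W) = topspace (subtopology (prod_topology Y Y) (V \<times> U))"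
    unfolding topW using arrow_nbhd_image[OF a U V] by auto
  show "inj_on ?e (topspace (subtopology (arrow_topology Y) ?W))"
    unfolding topW using inj_on_arrow_nbhd a U V by blast
  show "continuous_map (subtopology (arrow_topology Y) ?W) (subtopology (prod_topology Y Y) (V \<times> U)) ?e"
    using arrow_nbhd_image[OF a U V] topW
    by (intro continuous_map_into_subtopology continuous_map_from_subtopology continuous_map_pairedI
        continuous_map_start continuous_map_finish) auto
  show "open_map (subtopology (arrow_topology Y) ?W) (subtopology (prod_topology Y Y) (V \<times> U)) ?e"
    unfolding open_map_def
  proof (intro allI impI)
    fix T assume "openin (subtopology (arrow_topology Y) ?W) T"
    then have T: "openin (arrow_topology Y) T" "T \<subseteq> ?W"
      using openin_open_subtopology[OF W] by auto
    have "openin (prod_topology Y Y) (?e ` T)"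
      unfolding openin_subopen[of _ "?e ` T"]
    proof
      fix z assume "z \<in> ?e ` T"
      then obtain b where b: "b \<in> T" "z = (finish b, start b)" by auto
      obtain U' V' where UV': "openin Y U'" "openin Y V'" "start b \<in> U'" "finish b \<in> V'" "arrow_nbhd Y b U' V' \<subseteq> T"
        using bspec[OF conjunct2[OF T(1)[unfolded openin_arrow_topology_iff]] b(1)] by blast
      obtain U2 where U2: "openin Y U2" "start b \<in> U2" "U2 \<subseteq> U'" "contractible_space (subtopology Y U2)"
        using contractible_baseE[OF Y UV'(1,3)] .
      obtain V2 where V2: "openin Y V2" "finish b \<in> V2" "V2 \<subseteq> V'" "contractible_space (subtopology Y V2)"
        using contractible_baseE[OF Y UV'(2,4)] .
      have bY: "b \<in> arrow_set Y" using b openin_subset[OF T(1)] topspace_arrow_topology by blast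
      have "V2 \<times> U2 = ?e ` arrow_nbhd Y b U2 V2"
        using arrow_nbhd_image[OF bY U2(2) V2(2) U2(1,4) V2(1,4)] by simp
      also have "\<dots> \<subseteq> ?e ` T"
        using arrow_nbhd_mono[OF U2(3) V2(3)] UV'(5) by blast
      finally show "\<exists>A. openin (prod_topology Y Y) A \<and> z \<in> A \<and> A \<subseteq> ?e ` T"
        using U2 V2 b by (intro exI[of _ "V2 \<times> U2"]) (auto simp: openin_prod_Times_iff)
    qed
    moreover have "?e ` T \<subseteq> V \<times> U" using T(2) arrow_nbhd_image[OF a U V] by blast
    ultimately show "openin (subtopology (prod_topology Y Y) (V \<times> U)) (?e ` T)"
      using U V by (simp add: openin_open_subtopology openin_prod_Times_iff)
  qed
qed

section \<open>Complex differentiability in several variables\<close>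

text \<open>Neighbourhoods in the space of n-tuples, including the point itself. In contrast to the punctured
  filter of the definition of the gradient, this filter is respected by every continuous map between
  such spaces.\<close>

definition cnbhd :: "nat \<Rightarrow> (nat \<Rightarrow> complex) \<Rightarrow> (nat \<Rightarrow> complex) filter" where
  "cnbhd n z = inf (nhds z) (principal (cspace n))"

lemma eventually_cnbhd:
  "eventually P (cnbhd n z) \<longleftrightarrow> (\<exists>U. open U \<and> z \<in> U \<and> (\<forall>w\<in>U \<inter> cspace n. P w))"
  by (auto simp: cnbhd_def eventually_inf_principal eventually_nhds)

lemma eventually_cnbhd_self: "z \<in> cspace n \<Longrightarrow> eventually P (cnbhd n z) \<Longrightarrow> P z"
  by (auto simp: eventually_cnbhd)

lemma eventually_cnbhd_cspace: "eventually (\<lambda>w. w \<in> cspace n) (cnbhd n z)"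
  by (auto simp: eventually_cnbhd intro: exI[of _ UNIV])

lemma eventually_cnbhd_openin:
  "openin (top_of_set (cspace n)) U \<Longrightarrow> z \<in> U \<Longrightarrow> eventually (\<lambda>w. w \<in> U) (cnbhd n z)"
  by (auto simp: eventually_cnbhd openin_open)

lemma eventually_at_cspace:
  assumes "P z" shows "eventually P (at z within cspace n) \<longleftrightarrow> eventually P (cnbhd n z)"
  unfolding cnbhd_def eventually_inf_principal eventually_at_filter
  using assms by (intro eventually_cong always_eventually) auto

definition l1dist :: "nat \<Rightarrow> (nat \<Rightarrow> complex) \<Rightarrow> (nat \<Rightarrow> complex) \<Rightarrow> real" where
  "l1dist n w z = (\<Sum>i<n. cmod (w i - z i))"

lemma l1dist_nonneg [simp]: "0 \<le> l1dist n w z"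
  by (simp add: l1dist_def sum_nonneg)

lemma l1dist_eq_0:
  assumes "w \<in> cspace n" "z \<in> cspace n" shows "l1dist n w z = 0 \<longleftrightarrow> w = z"
proof
  assume "l1dist n w z = 0"
  then have "w i = z i" if "i < n" for i
    using that by (simp add: l1dist_def sum_nonneg_eq_0_iff)
  moreover have "w i = z i" if "\<not> i < n" for i
    using that assms by (simp add: cspace_def)
  ultimately show "w = z" by blast
qed (simp add: l1dist_def)

lemma tendsto_coordinate: "((\<lambda>w. w i) \<longlongrightarrow> z i) (cnbhd n z)"
proof -
  have "isCont (\<lambda>w. w i) z" for z :: "nat \<Rightarrow> complex"
    using continuous_on_eq_continuous_at[OF open_UNIV, of "\<lambda>w::nat \<Rightarrow> complex. w i"] by simp
  then have "((\<lambda>w. w i) \<longlongrightarrow> z i) (nhds z)"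
    by (simp add: isCont_def tendsto_nhds_iff)
  then show ?thesis unfolding cnbhd_def by (rule filterlim_mono) auto
qed

lemma tendsto_l1dist: "((\<lambda>w. l1dist n w z) \<longlongrightarrow> 0) (cnbhd n z)"
proof -
  have "((\<lambda>w. l1dist n w z) \<longlongrightarrow> (\<Sum>i<n. cmod (z i - z i))) (cnbhd n z)"
    unfolding l1dist_def by (intro tendsto_intros tendsto_coordinate)
  then show ?thesis by simp
qed

text \<open>The defining quotient of the gradient with its denominator cleared.\<close>

definition cdiff :: "nat \<Rightarrow> ((nat \<Rightarrow> complex) \<Rightarrow> complex) \<Rightarrow> (nat \<Rightarrow> complex) \<Rightarrow> (nat \<Rightarrow> complex) \<Rightarrow> bool" where
  "cdiff n f c z \<longleftrightarrow> (\<forall>e>0. eventually (\<lambda>w.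
      cmod (f w - f z - (\<Sum>i<n. c i * (w i - z i))) \<le> e * l1dist n w z) (cnbhd n z))"

lemma has_cgradient_iff_cdiff:
  assumes "z \<in> cspace n"
  shows "has_cgradient n f c z \<longleftrightarrow> cdiff n f c z"
proof -
  let ?r = "\<lambda>w. cmod (f w - f z - (\<Sum>i<n. c i * (w i - z i)))"
  have pos: "eventually (\<lambda>w. 0 < l1dist n w z) (at z within cspace n)"
    unfolding eventually_at_filter
    by (intro always_eventually allI impI) (simp add: l1dist_eq_0 assms order_less_le)
  have "has_cgradient n f c z \<longleftrightarrow> (\<forall>e>0. eventually (\<lambda>w. ?r w / l1dist n w z < e) (at z within cspace n))"
    unfolding has_cgradient_def tendsto_iff l1dist_def[symmetric] by (simp add: dist_real_def)
  also have "\<dots> \<longleftrightarrow> (\<forall>e>0. eventually (\<lambda>w. ?r w \<le> e * l1dist n w z) (at z within cspace n))"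
  proof safe
    fix e :: real assume "0 < e" "\<forall>e>0. eventually (\<lambda>w. ?r w / l1dist n w z < e) (at z within cspace n)"
    then have "eventually (\<lambda>w. ?r w / l1dist n w z < e) (at z within cspace n)" by simp
    with pos show "eventually (\<lambda>w. ?r w \<le> e * l1dist n w z) (at z within cspace n)"
      by eventually_elim (simp add: pos_divide_less_eq)
  next
    fix e :: real assume e: "0 < e" "\<forall>e>0. eventually (\<lambda>w. ?r w \<le> e * l1dist n w z) (at z within cspace n)"
    then have "eventually (\<lambda>w. ?r w \<le> e / 2 * l1dist n w z) (at z within cspace n)"
      by (simp only: half_gt_zero)
    with pos show "eventually (\<lambda>w. ?r w / l1dist n w z < e) (at z within cspace n)"
    proof eventually_elim
      case (elim w)
      have "e / 2 * l1dist n w z < e * l1dist n w z" using e(1) elim(1) by simp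
      with elim show ?case by (simp only: pos_divide_less_eq)
    qed
  qed
  also have "\<dots> \<longleftrightarrow> cdiff n f c z"
    unfolding cdiff_def by (intro all_cong1 imp_cong refl eventually_at_cspace) simp
  finally show ?thesis .
qed

definition cdifferentiable :: "nat \<Rightarrow> ((nat \<Rightarrow> complex) \<Rightarrow> complex) \<Rightarrow> (nat \<Rightarrow> complex) \<Rightarrow> bool" where
  "cdifferentiable n f z \<longleftrightarrow> (\<exists>c. cdiff n f c z)"

lemma sum_mult_le_l1dist:
  "cmod (\<Sum>i<n. c i * (w i - z i)) \<le> (\<Sum>i<n. cmod (c i)) * l1dist n w z"
proof -
  have "cmod (\<Sum>i<n. c i * (w i - z i)) \<le> (\<Sum>i<n. cmod (c i) * cmod (w i - z i))"
    by (rule order_trans[OF norm_sum]) (simp add: norm_mult)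
  also have "\<dots> \<le> (\<Sum>i<n. cmod (c i) * l1dist n w z)"
    unfolding l1dist_def by (intro sum_mono mult_left_mono member_le_sum) auto
  finally show ?thesis by (simp add: sum_distrib_right)
qed

lemma cdiff_lipschitz:
  assumes "cdiff n f c z"
  shows "eventually (\<lambda>w. cmod (f w - f z) \<le> ((\<Sum>i<n. cmod (c i)) + 1) * l1dist n w z) (cnbhd n z)"
proof -
  have "eventually (\<lambda>w. cmod (f w - f z - (\<Sum>i<n. c i * (w i - z i))) \<le> 1 * l1dist n w z) (cnbhd n z)"
    using assms unfolding cdiff_def by (auto dest!: spec[of _ 1])
  then show ?thesis
  proof eventually_elim
    case (elim w)
    have "cmod (f w - f z) \<le> cmod (f w - f z - (\<Sum>i<n. c i * (w i - z i))) + cmod (\<Sum>i<n. c i * (w i - z i))"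
      using norm_triangle_ineq[of "f w - f z - (\<Sum>i<n. c i * (w i - z i))" "\<Sum>i<n. c i * (w i - z i)"] by simp
    with elim sum_mult_le_l1dist[of c w z n] show ?case by (simp add: algebra_simps)
  qed
qed

lemma cdifferentiable_imp_tendsto:
  assumes "cdifferentiable n f z" shows "(f \<longlongrightarrow> f z) (cnbhd n z)"
proof -
  obtain c where "cdiff n f c z" using assms by (auto simp: cdifferentiable_def)
  from cdiff_lipschitz[OF this] tendsto_mult_right_zero[OF tendsto_l1dist]
  have "((\<lambda>w. f w - f z) \<longlongrightarrow> 0) (cnbhd n z)"
    by (rule Lim_null_comparison)
  then show ?thesis by (rule LIM_zero_cancel)
qed

lemma cdifferentiable_cong:
  assumes "cdifferentiable n f z" "eventually (\<lambda>w. f w = g w) (cnbhd n z)" "z \<in> cspace n"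
  shows "cdifferentiable n g z"
proof -
  obtain c where c: "cdiff n f c z" using assms by (auto simp: cdifferentiable_def)
  have "f z = g z" using assms(2,3) eventually_cnbhd_self by blast
  then have "cdiff n g c z"
    unfolding cdiff_def
  proof (intro allI impI)
    fix e :: real assume "0 < e"
    with c have "eventually (\<lambda>w. cmod (f w - f z - (\<Sum>i<n. c i * (w i - z i))) \<le> e * l1dist n w z) (cnbhd n z)"
      by (simp add: cdiff_def)
    then show "eventually (\<lambda>w. cmod (g w - g z - (\<Sum>i<n. c i * (w i - z i))) \<le> e * l1dist n w z) (cnbhd n z)"
      using assms(2) by eventually_elim (simp add: \<open>f z = g z\<close>)
  qed
  then show ?thesis by (auto simp: cdifferentiable_def)
qed

lemma cdifferentiable_const: "cdifferentiable n (\<lambda>w. a) z"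
  unfolding cdifferentiable_def cdiff_def by (intro exI[of _ "\<lambda>_. 0"]) simp

lemma cdifferentiable_coordinate:
  assumes "z \<in> cspace n" shows "cdifferentiable n (\<lambda>w. w i) z"
proof (cases "i < n")
  case True
  then have "(\<Sum>k<n. (if k = i then 1 else 0) * (w k - z k)) = w i - z i" for w :: "nat \<Rightarrow> complex"
    by (simp add: if_distrib[of "\<lambda>a. a * _"] sum.delta cong: if_cong)
  then show ?thesis unfolding cdifferentiable_def cdiff_def
    by (intro exI[of _ "\<lambda>k. if k = i then 1 else 0"]) simp
next
  case False
  then show ?thesis
    by (intro cdifferentiable_cong[OF cdifferentiable_const[of n 0] _ assms]
        eventually_mono[OF eventually_cnbhd_cspace]) (simp add: cspace_def)
qed

lemma cdifferentiable_diff: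
  assumes "cdifferentiable n f z" "cdifferentiable n g z"
  shows "cdifferentiable n (\<lambda>w. f w - g w) z"
proof -
  obtain c d where c: "cdiff n f c z" and d: "cdiff n g d z" using assms by (auto simp: cdifferentiable_def)
  have "cdiff n (\<lambda>w. f w - g w) (\<lambda>i. c i - d i) z"
    unfolding cdiff_def
  proof (intro allI impI)
    fix e :: real assume "0 < e"
    then have "eventually (\<lambda>w. cmod (f w - f z - (\<Sum>i<n. c i * (w i - z i))) \<le> e / 2 * l1dist n w z) (cnbhd n z)"
        "eventually (\<lambda>w. cmod (g w - g z - (\<Sum>i<n. d i * (w i - z i))) \<le> e / 2 * l1dist n w z) (cnbhd n z)"
      using c[unfolded cdiff_def, THEN spec, of "e / 2"] d[unfolded cdiff_def, THEN spec, of "e / 2"]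
      by simp_all
    then show "eventually (\<lambda>w. cmod (f w - g w - (f z - g z) - (\<Sum>i<n. (c i - d i) * (w i - z i))) \<le> e * l1dist n w z) (cnbhd n z)"
    proof eventually_elim
      case (elim w)
      have "f w - g w - (f z - g z) - (\<Sum>i<n. (c i - d i) * (w i - z i)) =
         (f w - f z - (\<Sum>i<n. c i * (w i - z i))) - (g w - g z - (\<Sum>i<n. d i * (w i - z i)))"
        by (simp add: left_diff_distrib sum_subtractf)
      also have "cmod \<dots> \<le> e / 2 * l1dist n w z + e / 2 * l1dist n w z"
        using norm_triangle_ineq4 elim by (rule order_trans[OF _ add_mono])
      finally show ?case by (simp add: field_simps)
    qed
  qed
  then show ?thesis by (auto simp: cdifferentiable_def)
qed

text \<open>Coordinates from index \<open>m\<close> on vanish near \<open>z\<close>, so demanding differentiability of all of them is no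
  restriction.\<close>

definition hol_at :: "nat \<Rightarrow> nat \<Rightarrow> ((nat \<Rightarrow> complex) \<Rightarrow> (nat \<Rightarrow> complex)) \<Rightarrow> (nat \<Rightarrow> complex) \<Rightarrow> bool" where
  "hol_at n m F z \<longleftrightarrow> z \<in> cspace n \<and> eventually (\<lambda>w. F w \<in> cspace m) (cnbhd n z) \<and>
     (\<forall>j. cdifferentiable n (\<lambda>w. F w j) z)"

lemma hol_at_cspace: "hol_at n m F z \<Longrightarrow> F z \<in> cspace m"
  unfolding hol_at_def using eventually_cnbhd_self by blast

lemma hol_at_iff:
  "hol_at n m F z \<longleftrightarrow> z \<in> cspace n \<and> eventually (\<lambda>w. F w \<in> cspace m) (cnbhd n z) \<and>
     (\<forall>j<m. \<exists>c. has_cgradient n (\<lambda>w. F w j) c z)"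
proof (cases "z \<in> cspace n \<and> eventually (\<lambda>w. F w \<in> cspace m) (cnbhd n z)")
  case True
  have "cdifferentiable n (\<lambda>w. F w j) z" if "\<not> j < m" for j
    using True that
    by (intro cdifferentiable_cong[OF cdifferentiable_const[of n 0]])
       (auto elim!: eventually_mono simp: cspace_def)
  then have "(\<forall>j. cdifferentiable n (\<lambda>w. F w j) z) \<longleftrightarrow> (\<forall>j<m. cdifferentiable n (\<lambda>w. F w j) z)"
    by blast
  then show ?thesis
    using True by (simp add: hol_at_def has_cgradient_iff_cdiff cdifferentiable_def)
qed (auto simp: hol_at_def)

lemma cholomorphic_imp_hol_at:
  assumes "cholomorphic n m A F" "openin (top_of_set (cspace n)) A" "z \<in> A"
  shows "hol_at n m F z"
  unfolding hol_at_iff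
proof (intro conjI)
  show "z \<in> cspace n" using assms(2,3) openin_imp_subset by blast
  show "eventually (\<lambda>w. F w \<in> cspace m) (cnbhd n z)"
    using eventually_cnbhd_openin[OF assms(2,3)]
    by eventually_elim (use assms(1) in \<open>auto simp: cholomorphic_def\<close>)
qed (use assms in \<open>auto simp: cholomorphic_def\<close>)

lemma hol_at_imp_cholomorphic:
  "(\<And>z. z \<in> A \<Longrightarrow> hol_at n m F z) \<Longrightarrow> cholomorphic n m A F"
  unfolding cholomorphic_def by (auto intro: hol_at_cspace) (simp add: hol_at_iff)

lemma hol_at_cong:
  assumes "hol_at n m F z" "eventually (\<lambda>w. F w = G w) (cnbhd n z)"
  shows "hol_at n m G z"
  unfolding hol_at_def
proof (intro conjI allI)
  show z: "z \<in> cspace n" using assms by (simp add: hol_at_def)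
  have "eventually (\<lambda>w. F w \<in> cspace m) (cnbhd n z)" using assms by (simp add: hol_at_def)
  with assms(2) show "eventually (\<lambda>w. G w \<in> cspace m) (cnbhd n z)" by eventually_elim simp
  fix j
  have "cdifferentiable n (\<lambda>w. F w j) z" using assms by (simp add: hol_at_def)
  then show "cdifferentiable n (\<lambda>w. G w j) z"
    by (rule cdifferentiable_cong[OF _ _ z]) (use assms(2) in \<open>auto elim: eventually_mono\<close>)
qed

lemma tendsto_fun_iff:
  fixes l :: "'i \<Rightarrow> 'a::topological_space"
  shows "(f \<longlongrightarrow> l) F \<longleftrightarrow> (\<forall>i. ((\<lambda>x. f x i) \<longlongrightarrow> l i) F)"
  using limitin_componentwise[of "\<lambda>_::'i. euclidean :: 'a topology" UNIV f l F]
  by (simp add: euclidean_product_topology)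

lemma hol_at_filterlim:
  assumes "hol_at n m F z" shows "filterlim F (cnbhd m (F z)) (cnbhd n z)"
  unfolding cnbhd_def[of m] filterlim_inf filterlim_principal
proof
  show "filterlim F (nhds (F z)) (cnbhd n z)"
    unfolding tendsto_fun_iff using assms by (auto simp: hol_at_def intro!: cdifferentiable_imp_tendsto)
  show "\<forall>\<^sub>F w in cnbhd n z. F w \<in> cspace m" using assms by (simp add: hol_at_def)
qed

text \<open>The chain rule: the error of the linear approximation of \<open>g\<close> is controlled by the Lipschitz bound of \<open>F\<close>,
  and the error of the approximation of \<open>F\<close> by the size of the gradient of \<open>g\<close>.\<close>

lemma cdifferentiable_compose:
  assumes g: "cdifferentiable m g (F z)" and F: "hol_at n m F z"
  shows "cdifferentiable n (\<lambda>w. g (F w)) z"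
proof -
  obtain d where d: "cdiff m g d (F z)" using g by (auto simp: cdifferentiable_def)
  have "\<forall>j. \<exists>c. cdiff n (\<lambda>w. F w j) c z" using F by (auto simp: hol_at_def cdifferentiable_def)
  then obtain c where c: "\<And>j. cdiff n (\<lambda>w. F w j) (c j) z" by metis
  define M where "M = (\<Sum>j<m. (\<Sum>i<n. cmod (c j i)) + 1)"
  have M: "0 \<le> M" unfolding M_def by (intro sum_nonneg add_nonneg_nonneg) auto
  have lip: "eventually (\<lambda>w. l1dist m (F w) (F z) \<le> M * l1dist n w z) (cnbhd n z)"
  proof -
    have "eventually (\<lambda>w. \<forall>j\<in>{..<m}. cmod (F w j - F z j) \<le> ((\<Sum>i<n. cmod (c j i)) + 1) * l1dist n w z) (cnbhd n z)"
      by (intro eventually_ball_finite ballI cdiff_lipschitz[OF c]) simp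
    then show ?thesis
      by eventually_elim (auto simp: l1dist_def[of m] M_def sum_distrib_right intro!: sum_mono)
  qed
  define R where "R = (\<Sum>j<m. cmod (d j))"
  have R: "0 \<le> R" unfolding R_def by (intro sum_nonneg) auto
  have "cdiff n (\<lambda>w. g (F w)) (\<lambda>i. \<Sum>j<m. d j * c j i) z"
    unfolding cdiff_def
  proof (intro allI impI)
    fix e :: real assume e: "0 < e"
    \<comment> \<open>Each of the two errors may use up half of \<open>e\<close>; the added 1 keeps the denominators positive.\<close>
    define e1 where "e1 = e / (2 * (M + 1))"
    define e2 where "e2 = e / (2 * (R + 1))"
    have pos: "0 < e1" "0 < e2" using e M R by (auto simp: e1_def e2_def)
    have "e1 * M \<le> e / 2" "R * e2 \<le> e / 2" 
      using e M R by (auto simp: e1_def e2_def field_simps)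
    then have bound: "e1 * M + R * e2 \<le> e" by linarith
    have "eventually (\<lambda>y. cmod (g y - g (F z) - (\<Sum>j<m. d j * (y j - F z j))) \<le> e1 * l1dist m y (F z)) (cnbhd m (F z))"
      using d pos unfolding cdiff_def by blast
    then have ev1: "eventually (\<lambda>w. cmod (g (F w) - g (F z) - (\<Sum>j<m. d j * (F w j - F z j))) \<le> e1 * l1dist m (F w) (F z)) (cnbhd n z)"
      using hol_at_filterlim[OF F] by (rule eventually_compose_filterlim)
    have ev2: "eventually (\<lambda>w. \<forall>j\<in>{..<m}. cmod (F w j - F z j - (\<Sum>i<n. c j i * (w i - z i))) \<le> e2 * l1dist n w z) (cnbhd n z)"
      by (intro eventually_ball_finite ballI) (use c pos in \<open>simp_all add: cdiff_def\<close>)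
    show "eventually (\<lambda>w. cmod (g (F w) - g (F z) - (\<Sum>i<n. (\<Sum>j<m. d j * c j i) * (w i - z i))) \<le> e * l1dist n w z) (cnbhd n z)"
      using ev1 ev2 lip
    proof eventually_elim
      case (elim w)
      have tail: "cmod (\<Sum>j<m. d j * (F w j - F z j - (\<Sum>i<n. c j i * (w i - z i)))) \<le>
          (\<Sum>j<m. cmod (d j) * (e2 * l1dist n w z))"
      proof (rule order_trans[OF norm_sum], rule sum_mono)
        fix j assume "j \<in> {..<m}"
        with elim(2) show "cmod (d j * (F w j - F z j - (\<Sum>i<n. c j i * (w i - z i)))) \<le> cmod (d j) * (e2 * l1dist n w z)"
          unfolding norm_mult by (intro mult_left_mono) simp_all
      qed
      have "(\<Sum>i<n. (\<Sum>j<m. d j * c j i) * (w i - z i)) = (\<Sum>j<m. d j * (\<Sum>i<n. c j i * (w i - z i)))"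
        unfolding sum_distrib_right sum_distrib_left by (subst sum.swap) (simp add: mult.assoc)
      then have eq: "g (F w) - g (F z) - (\<Sum>i<n. (\<Sum>j<m. d j * c j i) * (w i - z i)) =
          (g (F w) - g (F z) - (\<Sum>j<m. d j * (F w j - F z j))) +
          (\<Sum>j<m. d j * (F w j - F z j - (\<Sum>i<n. c j i * (w i - z i))))"
        by (simp add: right_diff_distrib sum_subtractf)
      have "cmod (g (F w) - g (F z) - (\<Sum>i<n. (\<Sum>j<m. d j * c j i) * (w i - z i)))
          \<le> e1 * l1dist m (F w) (F z) + (\<Sum>j<m. cmod (d j) * (e2 * l1dist n w z))"
        unfolding eq by (rule norm_triangle_mono[OF elim(1) tail])
      also have "\<dots> \<le> e1 * (M * l1dist n w z) + R * (e2 * l1dist n w z)"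
        unfolding R_def sum_distrib_right using elim(3) pos(1) by (intro add_mono mult_left_mono) simp_all
      also have "\<dots> = (e1 * M + R * e2) * l1dist n w z" by (simp add: algebra_simps)
      also have "\<dots> \<le> e * l1dist n w z" using bound by (intro mult_right_mono) auto
      finally show ?case .
    qed
  qed
  then show ?thesis by (auto simp: cdifferentiable_def)
qed

lemma hol_at_compose:
  assumes "hol_at n m F z" "hol_at m k G (F z)"
  shows "hol_at n k (\<lambda>w. G (F w)) z"
  unfolding hol_at_def
proof (intro conjI allI)
  show "z \<in> cspace n" using assms(1) by (simp add: hol_at_def)
  show "eventually (\<lambda>w. G (F w) \<in> cspace k) (cnbhd n z)"
    by (rule eventually_compose_filterlim[OF _ hol_at_filterlim[OF assms(1)]])
       (use assms(2) in \<open>simp add: hol_at_def\<close>)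
  fix j show "cdifferentiable n (\<lambda>w. G (F w) j) z"
    using assms(2) by (intro cdifferentiable_compose[OF _ assms(1), of "\<lambda>y. G y j"]) (simp add: hol_at_def)
qed

lemma hol_at_id: "z \<in> cspace n \<Longrightarrow> hol_at n n (\<lambda>w. w) z"
  by (auto simp: hol_at_def eventually_cnbhd_cspace cdifferentiable_coordinate)

definition cfirst :: "nat \<Rightarrow> (nat \<Rightarrow> complex) \<Rightarrow> (nat \<Rightarrow> complex)" where
  "cfirst n u = (\<lambda>i. if i < n then u i else 0)"

definition cdrop :: "nat \<Rightarrow> (nat \<Rightarrow> complex) \<Rightarrow> (nat \<Rightarrow> complex)" where
  "cdrop n u = (\<lambda>i. u (i + n))"

lemma cfirst_cappend [simp]: "u \<in> cspace n \<Longrightarrow> cfirst n (cappend n u v) = u"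
  by (auto simp: cfirst_def cappend_def cspace_def fun_eq_iff)

lemma cdrop_cappend [simp]: "cdrop n (cappend n u v) = v"
  by (auto simp: cdrop_def cappend_def)

lemma cappend_cfirst_cdrop [simp]: "cappend n (cfirst n u) (cdrop n u) = u"
  by (auto simp: cfirst_def cdrop_def cappend_def fun_eq_iff)

lemma cfirst_in_cspace [simp]: "cfirst n u \<in> cspace n"
  by (simp add: cfirst_def cspace_def)

lemma cdrop_in_cspace [simp]: "u \<in> cspace (n + m) \<Longrightarrow> cdrop n u \<in> cspace m"
  by (simp add: cdrop_def cspace_def)

lemma cappend_in_cspace [simp]: "v \<in> cspace m \<Longrightarrow> cappend n u v \<in> cspace (n + m)"
  by (auto simp: cappend_def cspace_def)

lemma hol_at_coordinatesI:
  assumes "z \<in> cspace n" "\<And>w. w \<in> cspace n \<Longrightarrow> F w \<in> cspace m" "\<And>j. cdifferentiable n (\<lambda>w. F w j) z"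
  shows "hol_at n m F z"
  using assms eventually_mono[OF eventually_cnbhd_cspace[of n z]] by (simp add: hol_at_def)

lemma hol_at_cfirst: "z \<in> cspace n \<Longrightarrow> hol_at n m (cfirst m) z"
proof (rule hol_at_coordinatesI)
  fix j assume "z \<in> cspace n" then show "cdifferentiable n (\<lambda>w. cfirst m w j) z"
    by (cases "j < m") (auto simp: cfirst_def cdifferentiable_const cdifferentiable_coordinate)
qed auto

lemma hol_at_cdrop: "z \<in> cspace (n + m) \<Longrightarrow> hol_at (n + m) m (cdrop n) z"
  by (rule hol_at_coordinatesI) (simp_all add: cdifferentiable_coordinate, simp add: cdrop_def cdifferentiable_coordinate)

lemma hol_at_cappend:
  assumes "hol_at n k F z" "hol_at n m G z"
  shows "hol_at n (k + m) (\<lambda>w. cappend k (F w) (G w)) z"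
  unfolding hol_at_def
proof (intro conjI allI)
  show "z \<in> cspace n" using assms(1) by (simp add: hol_at_def)
  have "eventually (\<lambda>w. G w \<in> cspace m) (cnbhd n z)" using assms(2) by (simp add: hol_at_def)
  then show "eventually (\<lambda>w. cappend k (F w) (G w) \<in> cspace (k + m)) (cnbhd n z)"
    by eventually_elim simp
  fix j show "cdifferentiable n (\<lambda>w. cappend k (F w) (G w) j) z"
    using assms by (cases "j < k") (auto simp: cappend_def hol_at_def)
qed

lemma hol_at_diff:
  assumes "hol_at n m F z" "hol_at n m G z"
  shows "hol_at n m (\<lambda>w i. F w i - G w i) z"
  unfolding hol_at_def
proof (intro conjI allI)
  show "z \<in> cspace n" using assms(1) by (simp add: hol_at_def)
  have "eventually (\<lambda>w. F w \<in> cspace m) (cnbhd n z)" "eventually (\<lambda>w. G w \<in> cspace m) (cnbhd n z)"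
    using assms by (simp_all add: hol_at_def)
  then show "eventually (\<lambda>w. (\<lambda>i. F w i - G w i) \<in> cspace m) (cnbhd n z)"
    by eventually_elim (simp add: cspace_def)
  fix j show "cdifferentiable n (\<lambda>w. F w j - G w j) z"
    using assms by (intro cdifferentiable_diff) (auto simp: hol_at_def)
qed

lemma cspace_mono: "k \<le> n \<Longrightarrow> cspace k \<subseteq> cspace n"
  by (auto simp: cspace_def)

lemma cdifferentiable_restrict:
  assumes "cdifferentiable n f z" "k \<le> n" "z \<in> cspace k"
  shows "cdifferentiable k f z"
proof -
  obtain c where c: "cdiff n f c z" using assms by (auto simp: cdifferentiable_def)
  have "cdiff k f c z" unfolding cdiff_def
  proof (intro allI impI)
    fix e :: real assume "0 < e"
    then have "eventually (\<lambda>w. cmod (f w - f z - (\<Sum>i<n. c i * (w i - z i))) \<le> e * l1dist n w z) (cnbhd n z)"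
      using c unfolding cdiff_def by blast
    then have "eventually (\<lambda>w. cmod (f w - f z - (\<Sum>i<n. c i * (w i - z i))) \<le> e * l1dist n w z) (cnbhd k z)"
      unfolding eventually_cnbhd using cspace_mono[OF assms(2)] by blast
    then show "eventually (\<lambda>w. cmod (f w - f z - (\<Sum>i<k. c i * (w i - z i))) \<le> e * l1dist k w z) (cnbhd k z)"
      using eventually_cnbhd_cspace[of k z]
    proof eventually_elim
      case (elim w)
      have out: "w i = z i" if "k \<le> i" for i
        using that elim(2) assms(3) by (simp add: cspace_def)
      have "(\<Sum>i<n. c i * (w i - z i)) = (\<Sum>i<k. c i * (w i - z i))"
        by (rule sum.mono_neutral_right) (use assms(2) in \<open>auto simp: out\<close>)
      moreover have "l1dist n w z = l1dist k w z"
        unfolding l1dist_def by (rule sum.mono_neutral_right) (use assms(2) in \<open>auto simp: out\<close>)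
      ultimately show ?case using elim(1) by simp
    qed
  qed
  then show ?thesis by (auto simp: cdifferentiable_def)
qed

text \<open>A map of n-tuples that sends a coordinate subspace into a coordinate subspace restricts to a
  holomorphic map between them. This is the local form of restriction to submanifolds.\<close>

lemma hol_at_restrict:
  assumes "hol_at n m F z" "k \<le> n" "z \<in> cspace k" "eventually (\<lambda>w. F w \<in> cspace l) (cnbhd k z)"
  shows "hol_at k l F z"
  using assms by (auto simp: hol_at_def intro: cdifferentiable_restrict)

section \<open>Charts and holomorphy at a point\<close>

lemma openin_cspace_iff:
  "openin (top_of_set (cspace n)) T \<longleftrightarrow> T \<subseteq> cspace n \<and> (\<forall>z\<in>T. eventually (\<lambda>w. w \<in> T) (cnbhd n z))"
proof (intro iffI conjI ballI)
  assume T: "T \<subseteq> cspace n \<and> (\<forall>z\<in>T. eventually (\<lambda>w. w \<in> T) (cnbhd n z))"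
  show "openin (top_of_set (cspace n)) T"
    unfolding openin_subopen[of _ T]
  proof
    fix z assume z: "z \<in> T"
    with T obtain U where "open U" "z \<in> U" "\<forall>w\<in>U \<inter> cspace n. w \<in> T" unfolding eventually_cnbhd by blast
    then show "\<exists>V. openin (top_of_set (cspace n)) V \<and> z \<in> V \<and> V \<subseteq> T"
      using z T by (intro exI[of _ "cspace n \<inter> U"]) (auto intro: openin_open_Int)
  qed
next
  assume T: "openin (top_of_set (cspace n)) T"
  show "T \<subseteq> cspace n" using openin_imp_subset[OF T] .
  show "eventually (\<lambda>w. w \<in> T) (cnbhd n z)" if "z \<in> T" for z
    using eventually_cnbhd_openin[OF T that] .
qed

lemma eventually_cnbhd_mono: "eventually P (cnbhd n z) \<Longrightarrow> k \<le> n \<Longrightarrow> eventually P (cnbhd k z)"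
  unfolding eventually_cnbhd using cspace_mono by blast

lemma is_chartD:
  assumes "is_chart M (U, \<phi>)"
  shows "openin (mtop M) U" "openin (top_of_set (cspace (cdim M))) (\<phi> ` U)" "inj_on \<phi> U"
    "homeomorphic_map (subtopology (mtop M) U) (top_of_set (\<phi> ` U)) \<phi>" "U \<subseteq> points M"
proof -
  show U: "openin (mtop M) U" and "openin (top_of_set (cspace (cdim M))) (\<phi> ` U)"
    and h: "homeomorphic_map (subtopology (mtop M) U) (top_of_set (\<phi> ` U)) \<phi>"
    using assms by (auto simp: is_chart_def)
  show "U \<subseteq> points M" using openin_subset[OF U] .
  then show "inj_on \<phi> U" using homeomorphic_imp_injective_map[OF h] by (simp add: inf.absorb2)
qed

lemma is_chart_cspace: "is_chart M (U, \<phi>) \<Longrightarrow> x \<in> U \<Longrightarrow> \<phi> x \<in> cspace (cdim M)"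
  using is_chartD(2) openin_imp_subset by fastforce

lemma is_chart_restrict_homeomorphic:
  assumes "is_chart M (U, \<phi>)" "T \<subseteq> U"
  shows "homeomorphic_map (subtopology (mtop M) T) (top_of_set (\<phi> ` T)) \<phi>"
proof -
  have "homeomorphic_map (subtopology (subtopology (mtop M) U) T) (subtopology (top_of_set (\<phi> ` U)) (\<phi> ` T)) \<phi>"
    by (rule homeomorphic_map_subtopologies_alt[OF is_chartD(4)[OF assms(1)]])
       (use is_chartD(3,5)[OF assms(1)] assms(2) in \<open>auto dest: inj_onD\<close>)
  then show ?thesis
    using assms(2) by (simp add: subtopology_subtopology inf.absorb2 image_mono)
qed

lemma is_chart_open_image:
  assumes "is_chart M (U, \<phi>)" "openin (mtop M) T" "T \<subseteq> U"
  shows "openin (top_of_set (cspace (cdim M))) (\<phi> ` T)"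
proof -
  have "openin (subtopology (mtop M) U) T"
    using assms(2,3) is_chartD(1)[OF assms(1)] by (simp add: openin_open_subtopology)
  then have "openin (top_of_set (\<phi> ` U)) (\<phi> ` T)"
    using homeomorphic_imp_open_map[OF is_chartD(4)[OF assms(1)]] unfolding open_map_def by blast
  then show ?thesis using is_chartD(2)[OF assms(1)] openin_trans by blast
qed

text \<open>This and the next lemma translate between neighbourhoods of a point and of its coordinates.\<close>

lemma is_chart_eventually:
  assumes c: "is_chart M (U, \<phi>)" and x: "x \<in> U" and T: "openin (mtop M) T" "x \<in> T"
    and P: "\<And>y. y \<in> U \<Longrightarrow> y \<in> T \<Longrightarrow> P (\<phi> y)"
  shows "eventually P (cnbhd (cdim M) (\<phi> x))"
proof -
  have "openin (top_of_set (cspace (cdim M))) (\<phi> ` (U \<inter> T))"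
    using T is_chartD(1)[OF c] by (intro is_chart_open_image[OF c]) auto
  then have "eventually (\<lambda>w. w \<in> \<phi> ` (U \<inter> T)) (cnbhd (cdim M) (\<phi> x))"
    using x T by (intro eventually_cnbhd_openin) auto
  then show ?thesis by (rule eventually_mono) (use P in auto)
qed

lemma is_chart_pullback:
  assumes c: "is_chart M (U, \<phi>)" and x: "x \<in> U" and P: "eventually P (cnbhd (cdim M) (\<phi> x))"
  obtains T where "openin (mtop M) T" "x \<in> T" "T \<subseteq> U" "\<And>y. y \<in> T \<Longrightarrow> P (\<phi> y)"
proof -
  obtain Z where Z: "open Z" "\<phi> x \<in> Z" "\<forall>w\<in>Z \<inter> cspace (cdim M). P w"
    using P unfolding eventually_cnbhd by blast
  have "continuous_map (subtopology (mtop M) U) (top_of_set (\<phi> ` U)) \<phi>"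
    using is_chartD(4)[OF c] by (rule homeomorphic_imp_continuous_map)
  then have "openin (subtopology (mtop M) U) {y \<in> topspace (subtopology (mtop M) U). \<phi> y \<in> \<phi> ` U \<inter> Z}"
    by (rule openin_continuous_map_preimage) (simp add: openin_open_Int Z)
  then have "openin (mtop M) {y \<in> topspace (subtopology (mtop M) U). \<phi> y \<in> \<phi> ` U \<inter> Z}"
    using is_chartD(1)[OF c] by (simp add: openin_open_subtopology)
  then show thesis
    by (rule that) (use x Z is_chartD(5)[OF c] is_chart_cspace[OF c] in auto)
qed

lemma cholomorphic_iff_hol_at:
  "openin (top_of_set (cspace n)) A \<Longrightarrow> cholomorphic n m A F \<longleftrightarrow> (\<forall>z\<in>A. hol_at n m F z)"
  using cholomorphic_imp_hol_at hol_at_imp_cholomorphic by blast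

lemma compatible_iff_hol_at:
  assumes c: "is_chart M (U, \<phi>)" and d: "is_chart M (V, \<psi>)"
  shows "compatible (cdim M) (U, \<phi>) (V, \<psi>) \<longleftrightarrow>
    (\<forall>x\<in>U \<inter> V. hol_at (cdim M) (cdim M) (\<lambda>w. \<psi> (inv_into U \<phi> w)) (\<phi> x) \<and>
                hol_at (cdim M) (cdim M) (\<lambda>w. \<phi> (inv_into V \<psi> w)) (\<psi> x))"
proof -
  have 1: "openin (top_of_set (cspace (cdim M))) (\<phi> ` (U \<inter> V))"
    using is_chartD(1)[OF c] is_chartD(1)[OF d] by (intro is_chart_open_image[OF c]) auto
  have 2: "openin (top_of_set (cspace (cdim M))) (\<psi> ` (U \<inter> V))"
    using is_chartD(1)[OF c] is_chartD(1)[OF d] by (intro is_chart_open_image[OF d]) auto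
  show ?thesis
    unfolding compatible_def prod.case o_def cholomorphic_iff_hol_at[OF 1] cholomorphic_iff_hol_at[OF 2]
    by auto
qed

text \<open>The conditions on the charts of a complex manifold. Submanifolds, products and spaces of arrows
  inherit them directly from their constituents, and all statements on holomorphy rest on them.\<close>

definition atlas_manifold :: "'a cmfd \<Rightarrow> bool" where
  "atlas_manifold M \<longleftrightarrow>
     (\<forall>c\<in>atlas M. is_chart M c) \<and>
     (\<Union>(U, \<phi>)\<in>atlas M. U) = points M \<and>
     (\<forall>c\<in>atlas M. \<forall>d\<in>atlas M. compatible (cdim M) c d)"

lemma complex_manifold_imp_atlas: "complex_manifold M \<Longrightarrow> atlas_manifold M"
  by (simp add: complex_manifold_def atlas_manifold_def)

lemma atlas_subset_charts: "atlas_manifold M \<Longrightarrow> atlas M \<subseteq> charts M"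
  by (auto simp: atlas_manifold_def charts_def)

lemma atlas_manifold_chartE:
  assumes "atlas_manifold M" "x \<in> points M"
  obtains U \<phi> where "(U, \<phi>) \<in> atlas M" "(U, \<phi>) \<in> charts M" "x \<in> U"
proof -
  have "x \<in> (\<Union>(U, \<phi>)\<in>atlas M. U)" using assms by (simp add: atlas_manifold_def)
  then show thesis using that atlas_subset_charts[OF assms(1)] by blast
qed

lemma charts_is_chart: "c \<in> charts M \<Longrightarrow> is_chart M c"
  by (simp add: charts_def)

lemma charts_atlas_transition:
  assumes M: "atlas_manifold M" and c: "(U, \<phi>) \<in> charts M" and a: "(A, \<alpha>) \<in> atlas M" and x: "x \<in> U" "x \<in> A"
  shows "hol_at (cdim M) (cdim M) (\<lambda>w. \<alpha> (inv_into U \<phi> w)) (\<phi> x)"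
    and "hol_at (cdim M) (cdim M) (\<lambda>w. \<phi> (inv_into A \<alpha> w)) (\<alpha> x)"
proof -
  have "is_chart M (A, \<alpha>)" using M a by (auto simp: atlas_manifold_def)
  moreover have "compatible (cdim M) (U, \<phi>) (A, \<alpha>)" using c a by (auto simp: charts_def)
  ultimately show "hol_at (cdim M) (cdim M) (\<lambda>w. \<alpha> (inv_into U \<phi> w)) (\<phi> x)"
    "hol_at (cdim M) (cdim M) (\<lambda>w. \<phi> (inv_into A \<alpha> w)) (\<alpha> x)"
    using compatible_iff_hol_at[OF charts_is_chart[OF c]] x by blast+
qed

definition continuous_at_point :: "'a topology \<Rightarrow> 'b topology \<Rightarrow> ('a \<Rightarrow> 'b) \<Rightarrow> 'a \<Rightarrow> bool" where
  "continuous_at_point X Y f x \<longleftrightarrow> x \<in> topspace X \<and> f x \<in> topspace Y \<and>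
     (\<forall>T. openin Y T \<and> f x \<in> T \<longrightarrow> (\<exists>N. openin X N \<and> x \<in> N \<and> f ` N \<subseteq> T))"

lemma continuous_map_imp_at_point:
  assumes "continuous_map X Y f" "x \<in> topspace X" shows "continuous_at_point X Y f x"
  unfolding continuous_at_point_def
proof (intro conjI allI impI)
  show "f x \<in> topspace Y" using assms by (auto simp: continuous_map_def)
  fix T assume "openin Y T \<and> f x \<in> T"
  then show "\<exists>N. openin X N \<and> x \<in> N \<and> f ` N \<subseteq> T"
    using openin_continuous_map_preimage[OF assms(1)] assms(2)
    by (intro exI[of _ "{x \<in> topspace X. f x \<in> T}"]) auto
qed (use assms in auto)

lemma continuous_at_pointE:
  assumes "continuous_at_point X Y f x" "openin Y T" "f x \<in> T"
  obtains N where "openin X N" "x \<in> N" "f ` N \<subseteq> T"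
  using assms unfolding continuous_at_point_def by meson

lemma continuous_at_point_compose:
  assumes "continuous_at_point X Y f x" "continuous_at_point Y Z g (f x)"
  shows "continuous_at_point X Z (\<lambda>y. g (f y)) x"
  unfolding continuous_at_point_def
proof (intro conjI allI impI)
  fix T assume "openin Z T \<and> g (f x) \<in> T"
  then obtain N where N: "openin Y N" "f x \<in> N" "g ` N \<subseteq> T"
    using continuous_at_pointE[OF assms(2)] by metis
  obtain N' where "openin X N'" "x \<in> N'" "f ` N' \<subseteq> N"
    using continuous_at_pointE[OF assms(1) N(1,2)] .
  with N(3) show "\<exists>N. openin X N \<and> x \<in> N \<and> (\<lambda>y. g (f y)) ` N \<subseteq> T" by blast
qed (use assms in \<open>auto simp: continuous_at_point_def\<close>)

text \<open>Holomorphy at a single point, expressed in the maximal atlases. Continuity at the point ensures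
  that the coordinate expressions are meaningful near it, so that the chain rule applies to maps which
  are only defined near the point.\<close>

definition holomorphic_at :: "'a cmfd \<Rightarrow> 'b cmfd \<Rightarrow> ('a \<Rightarrow> 'b) \<Rightarrow> 'a \<Rightarrow> bool" where
  "holomorphic_at M N f x \<longleftrightarrow>
     continuous_at_point (mtop M) (mtop N) f x \<and>
     (\<forall>U \<phi> V \<psi>. (U, \<phi>) \<in> charts M \<longrightarrow> (V, \<psi>) \<in> charts N \<longrightarrow> x \<in> U \<longrightarrow> f x \<in> V \<longrightarrow>
        hol_at (cdim M) (cdim N) (\<lambda>w. \<psi> (f (inv_into U \<phi> w))) (\<phi> x))"

lemma hol_at_compose_cong:
  assumes "hol_at n m F z" "hol_at m k G y" "y = F z" "eventually (\<lambda>w. G (F w) = H w) (cnbhd n z)"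
  shows "hol_at n k H z"
  using hol_at_cong[OF hol_at_compose] assms by blast

text \<open>Two charts of the maximal atlas are compared through a chart of the atlas around the given point.\<close>

lemma charts_transition:
  assumes M: "atlas_manifold M" and c: "(U, \<phi>) \<in> charts M" and d: "(V, \<psi>) \<in> charts M" and x: "x \<in> U" "x \<in> V"
  shows "hol_at (cdim M) (cdim M) (\<lambda>w. \<psi> (inv_into U \<phi> w)) (\<phi> x)"
proof -
  note c' = is_chartD[OF charts_is_chart[OF c]]
  obtain A \<alpha> where a: "(A, \<alpha>) \<in> atlas M" "(A, \<alpha>) \<in> charts M" "x \<in> A"
    using atlas_manifold_chartE[OF M] x c'(5) by blast
  note a' = is_chartD[OF charts_is_chart[OF a(2)]]
  show ?thesis
  proof (rule hol_at_compose_cong)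
    show "hol_at (cdim M) (cdim M) (\<lambda>w. \<alpha> (inv_into U \<phi> w)) (\<phi> x)"
      using charts_atlas_transition(1)[OF M c a(1) x(1) a(3)] .
    show "hol_at (cdim M) (cdim M) (\<lambda>w. \<psi> (inv_into A \<alpha> w)) (\<alpha> x)"
      using charts_atlas_transition(2)[OF M d a(1) x(2) a(3)] .
    show "\<alpha> x = \<alpha> (inv_into U \<phi> (\<phi> x))" using c' x by simp
    show "eventually (\<lambda>w. \<psi> (inv_into A \<alpha> (\<alpha> (inv_into U \<phi> w))) = \<psi> (inv_into U \<phi> w)) (cnbhd (cdim M) (\<phi> x))"
      by (rule is_chart_eventually[OF charts_is_chart[OF c] x(1) a'(1) a(3)]) (use c' a' in simp)
  qed
qed

lemma holomorphic_atI:
  assumes M: "atlas_manifold M" and N: "atlas_manifold N"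
    and cont: "continuous_at_point (mtop M) (mtop N) f x"
    and c: "(U, \<phi>) \<in> charts M" "x \<in> U" and d: "(V, \<psi>) \<in> charts N" "f x \<in> V"
    and hol: "hol_at (cdim M) (cdim N) (\<lambda>w. \<psi> (f (inv_into U \<phi> w))) (\<phi> x)"
  shows "holomorphic_at M N f x"
  unfolding holomorphic_at_def
proof (intro conjI allI impI cont)
  fix U' \<phi>' V' \<psi>' assume c2: "(U', \<phi>') \<in> charts M" and d2: "(V', \<psi>') \<in> charts N" and x: "x \<in> U'" "f x \<in> V'"
  note c' = is_chartD[OF charts_is_chart[OF c(1)]]
  note d' = is_chartD[OF charts_is_chart[OF d(1)]]
  note c2' = is_chartD[OF charts_is_chart[OF c2]]
  obtain T where T: "openin (mtop M) T" "x \<in> T" "f ` T \<subseteq> V"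
    using continuous_at_pointE[OF cont d'(1) d(2)] .
  show "hol_at (cdim M) (cdim N) (\<lambda>w. \<psi>' (f (inv_into U' \<phi>' w))) (\<phi>' x)"
  proof (rule hol_at_compose_cong)
    show "hol_at (cdim M) (cdim N) (\<lambda>w. \<psi> (f (inv_into U \<phi> (\<phi> (inv_into U' \<phi>' w))))) (\<phi>' x)"
      using hol_at_compose[OF charts_transition[OF M c2 c(1) x(1) c(2)], of "cdim N" "\<lambda>w. \<psi> (f (inv_into U \<phi> w))"]
        hol c2' x(1) by simp
    show "hol_at (cdim N) (cdim N) (\<lambda>w. \<psi>' (inv_into V \<psi> w)) (\<psi> (f x))"
      using charts_transition[OF N d(1) d2 d(2) x(2)] .
    show "\<psi> (f x) = \<psi> (f (inv_into U \<phi> (\<phi> (inv_into U' \<phi>' (\<phi>' x)))))"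
      using c' c2' c(2) x(1) by simp
    show "eventually (\<lambda>w. \<psi>' (inv_into V \<psi> (\<psi> (f (inv_into U \<phi> (\<phi> (inv_into U' \<phi>' w)))))) = \<psi>' (f (inv_into U' \<phi>' w)))
       (cnbhd (cdim M) (\<phi>' x))"
    proof (rule is_chart_eventually[OF charts_is_chart[OF c2] x(1) openin_Int[OF T(1) c'(1)]])
      fix y assume y: "y \<in> U'" "y \<in> T \<inter> U"
      then have "f y \<in> V" using T(3) by blast
      with y show "\<psi>' (inv_into V \<psi> (\<psi> (f (inv_into U \<phi> (\<phi> (inv_into U' \<phi>' (\<phi>' y))))))) = \<psi>' (f (inv_into U' \<phi>' (\<phi>' y)))"
        using c' c2' d' by simp
    qed (use T c in simp)
  qed
qed

lemma holomorphic_at_compose: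
  assumes N: "atlas_manifold N" and f: "holomorphic_at M N f x" and g: "holomorphic_at N P g (f x)"
  shows "holomorphic_at M P (\<lambda>y. g (f y)) x"
  unfolding holomorphic_at_def
proof (intro conjI allI impI)
  show "continuous_at_point (mtop M) (mtop P) (\<lambda>y. g (f y)) x"
    using f g by (auto simp: holomorphic_at_def intro: continuous_at_point_compose)
  have cont: "continuous_at_point (mtop M) (mtop N) f x" using f by (simp add: holomorphic_at_def)
  fix U \<phi> W \<omega> assume c: "(U, \<phi>) \<in> charts M" and e: "(W, \<omega>) \<in> charts P" and x: "x \<in> U" "g (f x) \<in> W"
  have "f x \<in> points N" using cont by (simp add: continuous_at_point_def)
  then obtain V \<psi> where d: "(V, \<psi>) \<in> charts N" "f x \<in> V" using atlas_manifold_chartE[OF N] by blast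
  note c' = is_chartD[OF charts_is_chart[OF c(1)]]
  note d' = is_chartD[OF charts_is_chart[OF d(1)]]
  obtain T where T: "openin (mtop M) T" "x \<in> T" "f ` T \<subseteq> V"
    using continuous_at_pointE[OF cont d'(1) d(2)] .
  show "hol_at (cdim M) (cdim P) (\<lambda>w. \<omega> (g (f (inv_into U \<phi> w)))) (\<phi> x)"
  proof (rule hol_at_compose_cong)
    show "hol_at (cdim M) (cdim N) (\<lambda>w. \<psi> (f (inv_into U \<phi> w))) (\<phi> x)"
      using f c d x by (simp add: holomorphic_at_def)
    show "hol_at (cdim N) (cdim P) (\<lambda>w. \<omega> (g (inv_into V \<psi> w))) (\<psi> (f x))"
      using g d e x by (simp add: holomorphic_at_def)
    show "\<psi> (f x) = \<psi> (f (inv_into U \<phi> (\<phi> x)))" using c' x by simp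
    show "eventually (\<lambda>w. \<omega> (g (inv_into V \<psi> (\<psi> (f (inv_into U \<phi> w))))) = \<omega> (g (f (inv_into U \<phi> w)))) (cnbhd (cdim M) (\<phi> x))"
    proof (rule is_chart_eventually[OF charts_is_chart[OF c] x(1) T(1,2)])
      fix y assume "y \<in> U" "y \<in> T"
      then show "\<omega> (g (inv_into V \<psi> (\<psi> (f (inv_into U \<phi> (\<phi> y)))))) = \<omega> (g (f (inv_into U \<phi> (\<phi> y))))"
        using c' d' T(3) by (simp add: image_subset_iff)
    qed
  qed
qed

lemma holomorphic_at_id:
  assumes "atlas_manifold M" "x \<in> points M" shows "holomorphic_at M M (\<lambda>y. y) x"
  unfolding holomorphic_at_def
  using continuous_map_imp_at_point[OF continuous_map_id[unfolded id_def] assms(2)] charts_transition[OF assms(1)]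
  by blast

lemma holomorphic_map_imp_at:
  assumes M: "atlas_manifold M" and N: "atlas_manifold N" and f: "holomorphic_map M N f" and x: "x \<in> points M"
  shows "holomorphic_at M N f x"
proof -
  have cf: "continuous_map (mtop M) (mtop N) f" using f by (simp add: holomorphic_map_def)
  then have cont: "continuous_at_point (mtop M) (mtop N) f x" using x by (rule continuous_map_imp_at_point)
  then have "f x \<in> points N" by (simp add: continuous_at_point_def)
  then obtain V \<psi> where d: "(V, \<psi>) \<in> atlas N" "(V, \<psi>) \<in> charts N" "f x \<in> V" by (rule atlas_manifold_chartE[OF N])
  obtain U \<phi> where c: "(U, \<phi>) \<in> atlas M" "(U, \<phi>) \<in> charts M" "x \<in> U" using atlas_manifold_chartE[OF M x] .
  note c' = is_chartD[OF charts_is_chart[OF c(2)]]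
  note d' = is_chartD[OF charts_is_chart[OF d(2)]]
  have eq: "U \<inter> f -` V = U \<inter> {y \<in> points M. f y \<in> V}" using c'(5) by auto
  have "openin (mtop M) (U \<inter> f -` V)"
    unfolding eq using c'(1) openin_continuous_map_preimage[OF cf d'(1)] by blast
  then have op: "openin (top_of_set (cspace (cdim M))) (\<phi> ` (U \<inter> f -` V))"
    by (rule is_chart_open_image[OF charts_is_chart[OF c(2)]]) simp
  have "cholomorphic (cdim M) (cdim N) (\<phi> ` (U \<inter> f -` V)) (\<psi> \<circ> f \<circ> inv_into U \<phi>)"
    using f c(1) d(1) unfolding holomorphic_map_def by blast
  then have "hol_at (cdim M) (cdim N) (\<psi> \<circ> f \<circ> inv_into U \<phi>) (\<phi> x)"
    using op by (rule cholomorphic_imp_hol_at) (use c d in auto)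
  then show ?thesis
    using holomorphic_atI[OF M N cont c(2,3) d(2,3)] by (simp add: o_def)
qed

definition slice_chart :: "'a cmfd \<Rightarrow> nat \<Rightarrow> 'a set \<Rightarrow> 'a chart \<Rightarrow> bool" where
  "slice_chart M k Q = (\<lambda>(U, \<phi>). (U, \<phi>) \<in> charts M \<and> (\<forall>x\<in>U. x \<in> Q \<longleftrightarrow> \<phi> x \<in> cspace k))"

lemma atlas_submanifold: "atlas (submanifold M k Q) = {(U \<inter> Q, \<phi>) | U \<phi>. slice_chart M k Q (U, \<phi>)}"
  by (simp add: submanifold_def slice_chart_def)

text \<open>Slice charts turn submanifolds into coordinate subspaces. A map that is holomorphic in the ambient
  manifolds and respects the submanifolds is therefore holomorphic in slice charts.\<close>

lemma holomorphic_at_slice: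
  assumes c: "slice_chart M k Q (U, \<phi>)" and d: "slice_chart N l R (V, \<psi>)" and k: "k \<le> cdim M"
    and F: "holomorphic_at M N F x" and x: "x \<in> U" "x \<in> Q" "F x \<in> V"
    and T: "openin (mtop M) T" "x \<in> T" and FQ: "\<And>y. y \<in> T \<Longrightarrow> y \<in> Q \<Longrightarrow> F y \<in> R"
  shows "hol_at k l (\<lambda>w. \<psi> (F (inv_into (U \<inter> Q) \<phi> w))) (\<phi> x)"
proof -
  have c': "(U, \<phi>) \<in> charts M" "\<And>x. x \<in> U \<Longrightarrow> x \<in> Q \<longleftrightarrow> \<phi> x \<in> cspace k"
    and d': "(V, \<psi>) \<in> charts N" "\<And>x. x \<in> V \<Longrightarrow> x \<in> R \<longleftrightarrow> \<psi> x \<in> cspace l"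
    using c d by (auto simp: slice_chart_def)
  note cc = is_chartD[OF charts_is_chart[OF c'(1)]] and dd = is_chartD[OF charts_is_chart[OF d'(1)]]
  have cont: "continuous_at_point (mtop M) (mtop N) F x" using F by (simp add: holomorphic_at_def)
  obtain T' where T': "openin (mtop M) T'" "x \<in> T'" "F ` T' \<subseteq> V"
    using continuous_at_pointE[OF cont dd(1) x(3)] .
  have ev: "eventually (\<lambda>w. w \<in> \<phi> ` (U \<inter> T \<inter> T')) (cnbhd k (\<phi> x))"
    by (rule eventually_cnbhd_mono[OF _ k], rule is_chart_eventually[OF charts_is_chart[OF c'(1)] x(1) openin_Int[OF T(1) T'(1)]])
       (use T T' in auto)
  have inv: "inv_into U \<phi> (\<phi> y) = y" "y \<in> Q \<Longrightarrow> inv_into (U \<inter> Q) \<phi> (\<phi> y) = y" if "y \<in> U" for y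
    using cc(3) that by (auto simp: inj_on_Int intro: inv_into_f_f)
  have hol: "hol_at k l (\<lambda>w. \<psi> (F (inv_into U \<phi> w))) (\<phi> x)"
  proof (rule hol_at_restrict)
    show "hol_at (cdim M) (cdim N) (\<lambda>w. \<psi> (F (inv_into U \<phi> w))) (\<phi> x)"
      using F c' d' x by (simp add: holomorphic_at_def)
    show "\<phi> x \<in> cspace k" using c'(2) x by blast
    show "eventually (\<lambda>w. \<psi> (F (inv_into U \<phi> w)) \<in> cspace l) (cnbhd k (\<phi> x))"
      using ev eventually_cnbhd_cspace[of k "\<phi> x"]
    proof eventually_elim
      case (elim w)
      then obtain y where y: "y \<in> U" "y \<in> T" "y \<in> T'" "w = \<phi> y" by blast
      then have "y \<in> Q" using c'(2) elim by blast
      then have "F y \<in> R" "F y \<in> V" using FQ y T'(3) by auto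
      then show ?case using d'(2) inv y by simp
    qed
  qed (rule k)
  show ?thesis
  proof (rule hol_at_cong[OF hol])
    show "eventually (\<lambda>w. \<psi> (F (inv_into U \<phi> w)) = \<psi> (F (inv_into (U \<inter> Q) \<phi> w))) (cnbhd k (\<phi> x))"
      using ev eventually_cnbhd_cspace[of k "\<phi> x"]
      by eventually_elim (use inv c'(2) in auto)
  qed
qed

text \<open>Transition maps between slice charts are restrictions of ambient transition maps.\<close>

lemma atlas_manifold_submanifold:
  assumes M: "atlas_manifold M" and Q: "Q \<subseteq> points M" and k: "k \<le> cdim M"
    and cover: "\<And>x. x \<in> Q \<Longrightarrow> \<exists>U \<phi>. slice_chart M k Q (U, \<phi>) \<and> x \<in> U"
  shows "atlas_manifold (submanifold M k Q)"
proof -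
  have simps: "mtop (submanifold M k Q) = subtopology (mtop M) Q" "cdim (submanifold M k Q) = k"
    by (simp_all add: submanifold_def)
  have chart: "is_chart (submanifold M k Q) (U \<inter> Q, \<phi>)" if c: "slice_chart M k Q (U, \<phi>)" for U \<phi>
  proof -
    have c': "is_chart M (U, \<phi>)" "\<And>x. x \<in> U \<Longrightarrow> x \<in> Q \<longleftrightarrow> \<phi> x \<in> cspace k"
      using c by (auto simp: slice_chart_def charts_is_chart)
    obtain Z where Z: "open Z" "\<phi> ` U = cspace (cdim M) \<inter> Z"
      using is_chartD(2)[OF c'(1)] by (auto simp: openin_open)
    have "\<phi> ` (U \<inter> Q) = cspace k \<inter> \<phi> ` U" using c'(2) by auto
    also have "\<dots> = cspace k \<inter> Z" using Z(2) cspace_mono[OF k] by auto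
    finally have "openin (top_of_set (cspace k)) (\<phi> ` (U \<inter> Q))" using Z(1) by (simp add: openin_open_Int)
    moreover have "openin (subtopology (mtop M) Q) (U \<inter> Q)"
      using is_chartD(1)[OF c'(1)] by (rule openin_subtopology_Int)
    moreover have "homeomorphic_map (subtopology (mtop M) (U \<inter> Q)) (top_of_set (\<phi> ` (U \<inter> Q))) \<phi>"
      by (rule is_chart_restrict_homeomorphic[OF c'(1)]) simp
    ultimately show ?thesis
      by (simp add: is_chart_def simps subtopology_subtopology inf.commute inf.left_commute)
  qed
  have compat: "compatible k (U \<inter> Q, \<phi>) (V \<inter> Q, \<psi>)"
    if c: "slice_chart M k Q (U, \<phi>)" and d: "slice_chart M k Q (V, \<psi>)" for U \<phi> V \<psi>
  proof -
    have "hol_at k k (\<lambda>w. \<psi> (inv_into (U \<inter> Q) \<phi> w)) (\<phi> x) \<and> hol_at k k (\<lambda>w. \<phi> (inv_into (V \<inter> Q) \<psi> w)) (\<psi> x)"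
      if x: "x \<in> U" "x \<in> V" "x \<in> Q" for x
    proof -
      have xM: "x \<in> points M" using x(3) Q by blast
      note id = holomorphic_at_id[OF M xM]
      show ?thesis
        using holomorphic_at_slice[OF c d k id x(1,3,2) openin_topspace xM]
          holomorphic_at_slice[OF d c k id x(2,3,1) openin_topspace xM] by simp
    qed
    then show ?thesis
      using compatible_iff_hol_at[OF chart[OF c] chart[OF d]] by (simp add: simps)
  qed
  have "(\<Union>(U, \<phi>)\<in>atlas (submanifold M k Q). U) = Q"
  proof (intro equalityI subsetI)
    fix x assume "x \<in> Q"
    then obtain U \<phi> where "slice_chart M k Q (U, \<phi>)" "x \<in> U" using cover by blast
    then have "(U \<inter> Q, \<phi>) \<in> atlas (submanifold M k Q)" "x \<in> U \<inter> Q"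
      using \<open>x \<in> Q\<close> by (auto simp: atlas_submanifold)
    then show "x \<in> (\<Union>(U, \<phi>)\<in>atlas (submanifold M k Q). U)" by blast
  qed (auto simp: atlas_submanifold)
  also have "\<dots> = points (submanifold M k Q)" using Q by (simp add: simps inf.absorb2)
  finally have "(\<Union>(U, \<phi>)\<in>atlas (submanifold M k Q). U) = points (submanifold M k Q)" .
  moreover have "is_chart (submanifold M k Q) c" if "c \<in> atlas (submanifold M k Q)" for c
    using that unfolding atlas_submanifold by (elim CollectE exE conjE) (simp add: chart)
  moreover have "compatible (cdim (submanifold M k Q)) c d"
    if "c \<in> atlas (submanifold M k Q)" "d \<in> atlas (submanifold M k Q)" for c d
    using that unfolding atlas_submanifold by (elim CollectE exE conjE) (simp add: compat simps)
  ultimately show ?thesis unfolding atlas_manifold_def by blast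
qed

lemma chartsI:
  assumes M: "atlas_manifold M" and c: "is_chart M (U, \<phi>)"
    and 1: "\<And>A \<alpha> x. (A, \<alpha>) \<in> atlas M \<Longrightarrow> x \<in> U \<Longrightarrow> x \<in> A \<Longrightarrow>
       hol_at (cdim M) (cdim M) (\<lambda>w. \<alpha> (inv_into U \<phi> w)) (\<phi> x)"
    and 2: "\<And>A \<alpha> x. (A, \<alpha>) \<in> atlas M \<Longrightarrow> x \<in> U \<Longrightarrow> x \<in> A \<Longrightarrow>
       hol_at (cdim M) (cdim M) (\<lambda>w. \<phi> (inv_into A \<alpha> w)) (\<alpha> x)"
  shows "(U, \<phi>) \<in> charts M"
proof -
  have "compatible (cdim M) (U, \<phi>) (A, \<alpha>)" if a: "(A, \<alpha>) \<in> atlas M" for A \<alpha>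
  proof -
    have "is_chart M (A, \<alpha>)" using M a by (auto simp: atlas_manifold_def)
    then show ?thesis using compatible_iff_hol_at[OF c] 1 2 a by blast
  qed
  then show ?thesis using c by (auto simp: charts_def)
qed

lemma charts_restrict:
  assumes M: "atlas_manifold M" and c: "(U, \<phi>) \<in> charts M" and T: "openin (mtop M) T" "T \<subseteq> U"
  shows "(T, \<phi>) \<in> charts M"
proof (rule chartsI[OF M])
  note c' = charts_is_chart[OF c]
  show "is_chart M (T, \<phi>)"
    using T is_chart_open_image[OF c' T] is_chart_restrict_homeomorphic[OF c' T(2)] by (simp add: is_chart_def)
  fix A \<alpha> x assume a: "(A, \<alpha>) \<in> atlas M" and x: "x \<in> T" "x \<in> A"
  have xU: "x \<in> U" using x T by blast
  show "hol_at (cdim M) (cdim M) (\<lambda>w. \<phi> (inv_into A \<alpha> w)) (\<alpha> x)"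
    using charts_atlas_transition(2)[OF M c a xU x(2)] .
  show "hol_at (cdim M) (cdim M) (\<lambda>w. \<alpha> (inv_into T \<phi> w)) (\<phi> x)"
  proof (rule hol_at_cong[OF charts_atlas_transition(1)[OF M c a xU x(2)]])
    have "inj_on \<phi> T" using is_chartD(3)[OF c'] T(2) inj_on_subset by blast
    then show "eventually (\<lambda>w. \<alpha> (inv_into U \<phi> w) = \<alpha> (inv_into T \<phi> w)) (cnbhd (cdim M) (\<phi> x))"
      by (intro is_chart_eventually[OF c' xU T(1) x(1)]) (simp add: is_chartD(3)[OF c'])
  qed
qed

lemma hol_at_imp_continuous_on:
  assumes "A \<subseteq> cspace n" "\<And>z. z \<in> A \<Longrightarrow> hol_at n m F z"
  shows "continuous_on A F"
  unfolding continuous_on_def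
proof
  fix z assume z: "z \<in> A"
  have "filterlim F (nhds (F z)) (cnbhd n z)"
    using hol_at_filterlim[OF assms(2)[OF z]] unfolding cnbhd_def[of m] filterlim_inf by blast
  moreover have "at z within A \<le> cnbhd n z"
    unfolding cnbhd_def at_within_def using assms(1) by (intro inf_mono) auto
  ultimately show "(F \<longlongrightarrow> F z) (at z within A)" by (rule filterlim_mono[OF _ order_refl])
qed

text \<open>A chart may be composed with a biholomorphism. The image is open because near \<open>\<theta> z\<close> it is the preimage
  of the old image under the inverse.\<close>

lemma charts_change_coordinates:
  assumes M: "atlas_manifold M" and c: "(U, \<phi>) \<in> charts M"
    and \<theta>: "\<And>z. z \<in> \<phi> ` U \<Longrightarrow> hol_at (cdim M) (cdim M) \<theta> z"
    and \<theta>': "\<And>z. z \<in> \<phi> ` U \<Longrightarrow> hol_at (cdim M) (cdim M) \<theta>' (\<theta> z)"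
    and inv: "\<And>z. z \<in> \<phi> ` U \<Longrightarrow> \<theta>' (\<theta> z) = z"
    and inv': "\<And>z. z \<in> \<phi> ` U \<Longrightarrow> eventually (\<lambda>y. \<theta> (\<theta>' y) = y) (cnbhd (cdim M) (\<theta> z))"
  shows "(U, \<lambda>x. \<theta> (\<phi> x)) \<in> charts M"
proof (rule chartsI[OF M])
  let ?n = "cdim M"
  note c' = is_chartD[OF charts_is_chart[OF c]]
  have im: "(\<lambda>x. \<theta> (\<phi> x)) ` U = \<theta> ` (\<phi> ` U)" by auto
  have \<theta>n: "\<theta> z \<in> cspace ?n" if "z \<in> \<phi> ` U" for z using hol_at_cspace[OF \<theta>[OF that]] .
  have op: "openin (top_of_set (cspace ?n)) (\<theta> ` (\<phi> ` U))"
    unfolding openin_cspace_iff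
  proof (intro conjI ballI)
    fix y assume "y \<in> \<theta> ` (\<phi> ` U)"
    then obtain z where z: "z \<in> \<phi> ` U" "y = \<theta> z" by blast
    have "eventually (\<lambda>w. w \<in> \<phi> ` U) (cnbhd ?n (\<theta>' (\<theta> z)))"
      using c'(2) z inv by (intro eventually_cnbhd_openin) simp_all
    then have "eventually (\<lambda>y. \<theta>' y \<in> \<phi> ` U) (cnbhd ?n (\<theta> z))"
      using hol_at_filterlim[OF \<theta>'[OF z(1)]] by (rule eventually_compose_filterlim)
    with inv'[OF z(1)] show "eventually (\<lambda>w. w \<in> \<theta> ` (\<phi> ` U)) (cnbhd ?n y)"
      unfolding z(2) by eventually_elim (metis imageI)
  qed (use \<theta>n in blast)
  have hom: "homeomorphic_map (top_of_set (\<phi> ` U)) (top_of_set (\<theta> ` (\<phi> ` U))) \<theta>"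
    unfolding homeomorphic_map_maps
  proof (rule exI[of _ \<theta>'], unfold homeomorphic_maps_def, intro conjI)
    have "continuous_on (\<phi> ` U) \<theta>"
      using openin_imp_subset[OF c'(2)] \<theta> by (rule hol_at_imp_continuous_on)
    then show "continuous_map (top_of_set (\<phi> ` U)) (top_of_set (\<theta> ` (\<phi> ` U))) \<theta>" by auto
    have "continuous_on (\<theta> ` (\<phi> ` U)) \<theta>'"
      by (rule hol_at_imp_continuous_on[of _ ?n ?n]) (use \<theta>n \<theta>' in auto)
    then show "continuous_map (top_of_set (\<theta> ` (\<phi> ` U))) (top_of_set (\<phi> ` U)) \<theta>'"
      using inv by auto
  qed (use inv in auto)
  have "homeomorphic_map (subtopology (mtop M) U) (top_of_set (\<theta> ` (\<phi> ` U))) (\<theta> \<circ> \<phi>)"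
    using c'(4) hom by (rule homeomorphic_map_compose)
  then show "is_chart M (U, \<lambda>x. \<theta> (\<phi> x))"
    using c'(1) op unfolding is_chart_def prod.case im o_def by blast
  have inj: "inj_on (\<lambda>x. \<theta> (\<phi> x)) U"
  proof (rule inj_onI)
    fix x y assume xy: "x \<in> U" "y \<in> U" "\<theta> (\<phi> x) = \<theta> (\<phi> y)"
    have "\<phi> x = \<theta>' (\<theta> (\<phi> x))" using inv[OF imageI[OF xy(1)]] by (rule sym)
    also have "\<dots> = \<phi> y" unfolding xy(3) using inv[OF imageI[OF xy(2)]] .
    finally have "\<phi> x = \<phi> y" .
    then show "x = y" using c'(3) xy by (simp add: inj_on_eq_iff)
  qed
  fix A \<alpha> x assume a: "(A, \<alpha>) \<in> atlas M" and x: "x \<in> U" "x \<in> A"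
  have zU: "\<phi> x \<in> \<phi> ` U" using x by blast
  note a' = is_chartD[OF charts_is_chart[OF subsetD[OF atlas_subset_charts[OF M] a]]]
  show "hol_at ?n ?n (\<lambda>w. \<theta> (\<phi> (inv_into A \<alpha> w))) (\<alpha> x)"
    using hol_at_compose[OF charts_atlas_transition(2)[OF M c a x], of ?n \<theta>] \<theta>[OF zU] a'(3) x by simp
  show "hol_at ?n ?n (\<lambda>w. \<alpha> (inv_into U (\<lambda>x. \<theta> (\<phi> x)) w)) (\<theta> (\<phi> x))"
  proof (rule hol_at_compose_cong[OF \<theta>'[OF zU] charts_atlas_transition(1)[OF M c a x] inv[OF zU, symmetric]])
    have "eventually (\<lambda>w. w \<in> \<theta> ` (\<phi> ` U)) (cnbhd ?n (\<theta> (\<phi> x)))"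
      using op zU by (intro eventually_cnbhd_openin) auto
    then show "eventually (\<lambda>w. \<alpha> (inv_into U \<phi> (\<theta>' w)) = \<alpha> (inv_into U (\<lambda>x. \<theta> (\<phi> x)) w)) (cnbhd ?n (\<theta> (\<phi> x)))"
    proof eventually_elim
      case (elim w)
      then obtain y where y: "y \<in> U" "w = \<theta> (\<phi> y)" by blast
      then have "inv_into U (\<lambda>x. \<theta> (\<phi> x)) w = y" using inv_into_f_f[OF inj y(1)] by simp
      then show ?case using y inv c'(3) by simp
    qed
  qed
qed

section \<open>Products of manifolds\<close>

definition prod_chart :: "nat \<Rightarrow> ('a \<Rightarrow> nat \<Rightarrow> complex) \<Rightarrow> ('b \<Rightarrow> nat \<Rightarrow> complex) \<Rightarrow> 'a \<times> 'b \<Rightarrow> nat \<Rightarrow> complex" where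
  "prod_chart n \<phi> \<psi> = (\<lambda>(x, y). cappend n (\<phi> x) (\<psi> y))"

lemma prod_chart_apply [simp]: "prod_chart n \<phi> \<psi> (x, y) = cappend n (\<phi> x) (\<psi> y)"
  by (simp add: prod_chart_def)

lemma prod_mfd_simps [simp]:
  "mtop (prod_mfd M N) = prod_topology (mtop M) (mtop N)" "cdim (prod_mfd M N) = cdim M + cdim N"
  by (simp_all add: prod_mfd_def)

lemma atlas_prod_mfd:
  "atlas (prod_mfd M N) = {(U \<times> V, prod_chart (cdim M) \<phi> \<psi>) | U \<phi> V \<psi>. (U, \<phi>) \<in> atlas M \<and> (V, \<psi>) \<in> atlas N}"
  by (simp add: prod_mfd_def prod_chart_def)

lemma continuous_map_cappend:
  assumes "continuous_map X euclidean f" "continuous_map X euclidean g"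
  shows "continuous_map X euclidean (\<lambda>x. cappend n (f x) (g x))"
proof -
  have coord: "continuous_map X euclidean (\<lambda>x. h x i)"
    if "continuous_map X euclidean h" for h :: "'a \<Rightarrow> nat \<Rightarrow> complex" and i
    using continuous_map_compose[OF that, of euclidean "\<lambda>v. v i"] by (simp add: o_def)
  have "continuous_map X (product_topology (\<lambda>_. euclidean) UNIV) (\<lambda>x. cappend n (f x) (g x))"
    unfolding continuous_map_componentwise_UNIV
  proof
    fix i show "continuous_map X euclidean (\<lambda>x. cappend n (f x) (g x) i)"
      using coord[OF assms(1)] coord[OF assms(2)] by (cases "i < n") (simp_all add: cappend_def)
  qed
  then show ?thesis by (simp add: euclidean_product_topology)
qed

lemma is_chart_inv_continuous:
  assumes c: "is_chart M (U, \<phi>)"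
  shows "continuous_map (top_of_set (\<phi> ` U)) (mtop M) (inv_into U \<phi>)"
proof -
  obtain g where g: "homeomorphic_maps (subtopology (mtop M) U) (top_of_set (\<phi> ` U)) \<phi> g"
    using is_chartD(4)[OF c] unfolding homeomorphic_map_maps by blast
  then have "continuous_map (top_of_set (\<phi> ` U)) (subtopology (mtop M) U) g"
    by (simp add: homeomorphic_maps_def)
  then have "continuous_map (top_of_set (\<phi> ` U)) (mtop M) g" by (rule continuous_map_into_fulltopology)
  then show ?thesis
  proof (rule continuous_map_eq)
    fix w assume "w \<in> topspace (top_of_set (\<phi> ` U))"
    then obtain x where x: "x \<in> U" "w = \<phi> x" by auto
    then have "g w = x" using g is_chartD(5)[OF c] by (auto simp: homeomorphic_maps_def)
    then show "g w = inv_into U \<phi> w" using x is_chartD(3)[OF c] by simp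
  qed
qed

lemma prod_chart_image:
  assumes c: "is_chart M (U, \<phi>)" and d: "is_chart N (V, \<psi>)"
  shows "prod_chart (cdim M) \<phi> \<psi> ` (U \<times> V) =
    {u \<in> cspace (cdim M + cdim N). cfirst (cdim M) u \<in> \<phi> ` U \<and> cdrop (cdim M) u \<in> \<psi> ` V}"
proof (intro equalityI subsetI)
  fix u assume "u \<in> prod_chart (cdim M) \<phi> \<psi> ` (U \<times> V)"
  then obtain x y where "x \<in> U" "y \<in> V" "u = cappend (cdim M) (\<phi> x) (\<psi> y)" by auto
  then show "u \<in> {u \<in> cspace (cdim M + cdim N). cfirst (cdim M) u \<in> \<phi> ` U \<and> cdrop (cdim M) u \<in> \<psi> ` V}"
    using is_chart_cspace[OF c] is_chart_cspace[OF d] by auto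
next
  fix u assume "u \<in> {u \<in> cspace (cdim M + cdim N). cfirst (cdim M) u \<in> \<phi> ` U \<and> cdrop (cdim M) u \<in> \<psi> ` V}"
  then obtain x y where xy: "x \<in> U" "y \<in> V" "cfirst (cdim M) u = \<phi> x" "cdrop (cdim M) u = \<psi> y" by auto
  then have "u = prod_chart (cdim M) \<phi> \<psi> (x, y)" using cappend_cfirst_cdrop[of "cdim M" u] by simp
  then show "u \<in> prod_chart (cdim M) \<phi> \<psi> ` (U \<times> V)" using xy by blast
qed

lemma inv_into_prod_chart:
  assumes c: "is_chart M (U, \<phi>)" and d: "is_chart N (V, \<psi>)" and xy: "x \<in> U" "y \<in> V"
  shows "inv_into (U \<times> V) (prod_chart (cdim M) \<phi> \<psi>) (cappend (cdim M) (\<phi> x) (\<psi> y)) = (x, y)"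
proof -
  have "inj_on (prod_chart (cdim M) \<phi> \<psi>) (U \<times> V)"
  proof (rule inj_onI, clarify)
    fix x y x' y' assume "x \<in> U" "y \<in> V" "x' \<in> U" "y' \<in> V"
      and eq: "prod_chart (cdim M) \<phi> \<psi> (x, y) = prod_chart (cdim M) \<phi> \<psi> (x', y')"
    then have e: "cappend (cdim M) (\<phi> x) (\<psi> y) = cappend (cdim M) (\<phi> x') (\<psi> y')"
      and cs: "\<phi> x \<in> cspace (cdim M)" "\<phi> x' \<in> cspace (cdim M)"
      using is_chart_cspace[OF c] by simp_all
    have "\<phi> x = \<phi> x'" using cfirst_cappend[OF cs(1), of "\<psi> y"] unfolding e cfirst_cappend[OF cs(2)] by (rule sym)
    moreover have "\<psi> y = \<psi> y'" using cdrop_cappend[of "cdim M" "\<phi> x" "\<psi> y"] unfolding e cdrop_cappend by (rule sym)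
    ultimately show "x = x' \<and> y = y'"
      using \<open>x \<in> U\<close> \<open>y \<in> V\<close> \<open>x' \<in> U\<close> \<open>y' \<in> V\<close> is_chartD(3)[OF c] is_chartD(3)[OF d] by (simp add: inj_on_eq_iff)
  qed
  then show ?thesis using inv_into_f_f[of _ "U \<times> V" "(x, y)"] xy by fastforce
qed

lemma is_chart_prod:
  assumes c: "is_chart M (U, \<phi>)" and d: "is_chart N (V, \<psi>)"
  shows "is_chart (prod_mfd M N) (U \<times> V, prod_chart (cdim M) \<phi> \<psi>)"
proof -
  let ?n = "cdim M" and ?m = "cdim N" and ?\<Phi> = "prod_chart (cdim M) \<phi> \<psi>"
  let ?\<Psi> = "\<lambda>u. (inv_into U \<phi> (cfirst (cdim M) u), inv_into V \<psi> (cdrop (cdim M) u))"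
  note c' = is_chartD[OF c] and d' = is_chartD[OF d]
  note im = prod_chart_image[OF c d]
  have imsub: "?\<Phi> ` (U \<times> V) \<subseteq> cspace (?n + ?m)" unfolding im by blast
  have op: "openin (top_of_set (cspace (?n + ?m))) (?\<Phi> ` (U \<times> V))"
    unfolding openin_cspace_iff
  proof (intro conjI ballI imsub)
    fix u assume "u \<in> ?\<Phi> ` (U \<times> V)"
    then have u: "u \<in> cspace (?n + ?m)" "cfirst ?n u \<in> \<phi> ` U" "cdrop ?n u \<in> \<psi> ` V" unfolding im by auto
    have "eventually (\<lambda>w. cfirst ?n w \<in> \<phi> ` U) (cnbhd (?n + ?m) u)"
      using eventually_compose_filterlim[OF eventually_cnbhd_openin[OF c'(2) u(2)] hol_at_filterlim[OF hol_at_cfirst[OF u(1)]]] .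
    moreover have "eventually (\<lambda>w. cdrop ?n w \<in> \<psi> ` V) (cnbhd (?n + ?m) u)"
      using eventually_compose_filterlim[OF eventually_cnbhd_openin[OF d'(2) u(3)] hol_at_filterlim[OF hol_at_cdrop[OF u(1)]]] .
    ultimately show "eventually (\<lambda>w. w \<in> ?\<Phi> ` (U \<times> V)) (cnbhd (?n + ?m) u)"
      using eventually_cnbhd_cspace[of "?n + ?m" u] unfolding im by eventually_elim simp
  qed
  have UV: "U \<times> V \<subseteq> topspace (prod_topology (mtop M) (mtop N))" using c'(5) d'(5) by auto
  have "homeomorphic_maps (subtopology (prod_topology (mtop M) (mtop N)) (U \<times> V)) (top_of_set (?\<Phi> ` (U \<times> V))) ?\<Phi> ?\<Psi>"
    unfolding homeomorphic_maps_def
  proof (intro conjI)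
    have UV2: "subtopology (prod_topology (mtop M) (mtop N)) (U \<times> V) = prod_topology (subtopology (mtop M) U) (subtopology (mtop N) V)"
      by (simp add: subtopology_Times)
    have "continuous_map (prod_topology (subtopology (mtop M) U) (subtopology (mtop N) V)) euclidean
        (\<lambda>z. cappend ?n (\<phi> (fst z)) (\<psi> (snd z)))"
      using homeomorphic_imp_continuous_map[OF c'(4)] homeomorphic_imp_continuous_map[OF d'(4)]
      by (intro continuous_map_cappend continuous_map_compose_apply[OF continuous_map_fst]
          continuous_map_compose_apply[OF continuous_map_snd]) (rule continuous_map_into_fulltopology, assumption)+
    then have "continuous_map (prod_topology (subtopology (mtop M) U) (subtopology (mtop N) V)) euclidean ?\<Phi>"
      by (simp add: prod_chart_def case_prod_unfold)
    then show "continuous_map (subtopology (prod_topology (mtop M) (mtop N)) (U \<times> V)) (top_of_set (?\<Phi> ` (U \<times> V))) ?\<Phi>"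
      unfolding UV2 by (rule continuous_map_into_subtopology) auto
    have contf: "continuous_on (?\<Phi> ` (U \<times> V)) (cfirst ?n)"
      by (rule hol_at_imp_continuous_on[OF imsub hol_at_cfirst[of _ _ ?n]]) (rule subsetD[OF imsub])
    have contd: "continuous_on (?\<Phi> ` (U \<times> V)) (cdrop ?n)"
      by (rule hol_at_imp_continuous_on[OF imsub hol_at_cdrop]) (rule subsetD[OF imsub])
    have "continuous_map (top_of_set (?\<Phi> ` (U \<times> V))) (prod_topology (mtop M) (mtop N)) ?\<Psi>"
    proof (intro continuous_map_pairedI)
      show "continuous_map (top_of_set (?\<Phi> ` (U \<times> V))) (mtop M) (\<lambda>u. inv_into U \<phi> (cfirst ?n u))"
        by (rule continuous_map_compose_apply[OF _ is_chart_inv_continuous[OF c]]) (use contf im in auto)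
      show "continuous_map (top_of_set (?\<Phi> ` (U \<times> V))) (mtop N) (\<lambda>u. inv_into V \<psi> (cdrop ?n u))"
        by (rule continuous_map_compose_apply[OF _ is_chart_inv_continuous[OF d]]) (use contd im in auto)
    qed
    then show "continuous_map (top_of_set (?\<Phi> ` (U \<times> V))) (subtopology (prod_topology (mtop M) (mtop N)) (U \<times> V)) ?\<Psi>"
      by (rule continuous_map_into_subtopology) (use im in \<open>auto intro: inv_into_into\<close>)
    show "\<forall>x\<in>topspace (subtopology (prod_topology (mtop M) (mtop N)) (U \<times> V)). ?\<Psi> (?\<Phi> x) = x"
      using c'(3) d'(3) is_chart_cspace[OF c] by auto
    show "\<forall>y\<in>topspace (top_of_set (?\<Phi> ` (U \<times> V))). ?\<Phi> (?\<Psi> y) = y"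
      using im by (auto simp: f_inv_into_f)
  qed
  then show ?thesis
    using op c'(1) d'(1) unfolding is_chart_def homeomorphic_map_maps by (auto simp: openin_prod_Times_iff)
qed

text \<open>In product charts a product map acts separately on the two groups of coordinates. With identity maps
  this gives the compatibility of the charts of a product, and applied to a manifold and itself it
  describes maps between spaces of arrows.\<close>

lemma hol_at_prod_charts:
  assumes c1: "(U1, \<phi>1) \<in> charts M1" and d1: "(V1, \<psi>1) \<in> charts N1" and c2: "(U2, \<phi>2) \<in> charts M2" and d2: "(V2, \<psi>2) \<in> charts N2"
    and f: "holomorphic_at M1 N1 f x" and g: "holomorphic_at M2 N2 g y"
    and mem: "x \<in> U1" "f x \<in> V1" "y \<in> U2" "g y \<in> V2"
  shows "hol_at (cdim M1 + cdim M2) (cdim N1 + cdim N2)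
     (\<lambda>w. (case inv_into (U1 \<times> U2) (prod_chart (cdim M1) \<phi>1 \<phi>2) w of (x, y) \<Rightarrow> prod_chart (cdim N1) \<psi>1 \<psi>2 (f x, g y)))
     (cappend (cdim M1) (\<phi>1 x) (\<phi>2 y))"
proof -
  let ?n = "cdim M1 + cdim M2" and ?z = "cappend (cdim M1) (\<phi>1 x) (\<phi>2 y)"
  note c1' = charts_is_chart[OF c1] and c2' = charts_is_chart[OF c2]
  have cs: "\<phi>1 x \<in> cspace (cdim M1)" "\<phi>2 y \<in> cspace (cdim M2)"
    using is_chart_cspace[OF c1' mem(1)] is_chart_cspace[OF c2' mem(3)] .
  then have z: "?z \<in> cspace ?n" by simp
  have fz: "cfirst (cdim M1) ?z = \<phi>1 x" "cdrop (cdim M1) ?z = \<phi>2 y" using cs by simp_all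
  have 1: "hol_at ?n (cdim N1) (\<lambda>w. \<psi>1 (f (inv_into U1 \<phi>1 (cfirst (cdim M1) w)))) ?z"
    by (rule hol_at_compose[OF hol_at_cfirst[OF z]]) (use f c1 d1 mem fz in \<open>simp add: holomorphic_at_def\<close>)
  have 2: "hol_at ?n (cdim N2) (\<lambda>w. \<psi>2 (g (inv_into U2 \<phi>2 (cdrop (cdim M1) w)))) ?z"
    by (rule hol_at_compose[OF hol_at_cdrop[OF z]]) (use g c2 d2 mem fz in \<open>simp add: holomorphic_at_def\<close>)
  show ?thesis
  proof (rule hol_at_cong[OF hol_at_cappend[OF 1 2]])
    have "is_chart (prod_mfd M1 M2) (U1 \<times> U2, prod_chart (cdim M1) \<phi>1 \<phi>2)" using c1' c2' by (rule is_chart_prod)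
    from is_chartD(2)[OF this]
    have "eventually (\<lambda>w. w \<in> prod_chart (cdim M1) \<phi>1 \<phi>2 ` (U1 \<times> U2)) (cnbhd ?n ?z)"
      by (intro eventually_cnbhd_openin) (use mem in \<open>auto intro!: image_eqI[of _ _ "(x, y)"]\<close>)
    then show "eventually (\<lambda>w. cappend (cdim N1) (\<psi>1 (f (inv_into U1 \<phi>1 (cfirst (cdim M1) w))))
         (\<psi>2 (g (inv_into U2 \<phi>2 (cdrop (cdim M1) w)))) =
       (case inv_into (U1 \<times> U2) (prod_chart (cdim M1) \<phi>1 \<phi>2) w of (x, y) \<Rightarrow> prod_chart (cdim N1) \<psi>1 \<psi>2 (f x, g y)))
       (cnbhd ?n ?z)"
    proof eventually_elim
      case (elim w)
      then obtain a b where ab: "a \<in> U1" "b \<in> U2" "w = cappend (cdim M1) (\<phi>1 a) (\<phi>2 b)" by auto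
      then show ?case
        using inv_into_prod_chart[OF c1' c2' ab(1,2)] is_chartD(3)[OF c1'] is_chartD(3)[OF c2'] is_chart_cspace[OF c1' ab(1)]
        by simp
    qed
  qed
qed

lemma atlas_manifold_prod:
  assumes M: "atlas_manifold M" and N: "atlas_manifold N"
  shows "atlas_manifold (prod_mfd M N)"
proof -
  have chart: "is_chart (prod_mfd M N) (U \<times> V, prod_chart (cdim M) \<phi> \<psi>)"
    if "(U, \<phi>) \<in> atlas M" "(V, \<psi>) \<in> atlas N" for U \<phi> V \<psi>
    using that M N by (intro is_chart_prod) (auto simp: atlas_manifold_def)
  have trans: "hol_at (cdim M + cdim N) (cdim M + cdim N)
      (\<lambda>w. prod_chart (cdim M) \<phi>' \<psi>' (inv_into (U \<times> V) (prod_chart (cdim M) \<phi> \<psi>) w)) (prod_chart (cdim M) \<phi> \<psi> (x, y))"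
    if c: "(U, \<phi>) \<in> atlas M" "(V, \<psi>) \<in> atlas N" and d: "(U', \<phi>') \<in> atlas M" "(V', \<psi>') \<in> atlas N"
      and xy: "x \<in> U" "x \<in> U'" "y \<in> V" "y \<in> V'" for U \<phi> V \<psi> U' \<phi>' V' \<psi>' x y
  proof -
    have ch: "(U, \<phi>) \<in> charts M" "(V, \<psi>) \<in> charts N" "(U', \<phi>') \<in> charts M" "(V', \<psi>') \<in> charts N"
      using c d atlas_subset_charts M N by blast+
    have "x \<in> points M" "y \<in> points N"
      using is_chartD(5)[OF charts_is_chart[OF ch(1)]] is_chartD(5)[OF charts_is_chart[OF ch(2)]] xy by auto
    then show ?thesis
      using hol_at_prod_charts[OF ch(1,3,2,4) holomorphic_at_id[OF M] holomorphic_at_id[OF N]] xy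
      by (simp add: case_prod_unfold prod_chart_def)
  qed
  have compat: "compatible (cdim M + cdim N) (U \<times> V, prod_chart (cdim M) \<phi> \<psi>) (U' \<times> V', prod_chart (cdim M) \<phi>' \<psi>')"
    if c: "(U, \<phi>) \<in> atlas M" "(V, \<psi>) \<in> atlas N" and d: "(U', \<phi>') \<in> atlas M" "(V', \<psi>') \<in> atlas N"
    for U \<phi> V \<psi> U' \<phi>' V' \<psi>'
    using compatible_iff_hol_at[OF chart[OF c] chart[OF d]] trans[OF c d] trans[OF d c] by auto
  have "x \<in> (\<Union>(U, \<phi>)\<in>atlas (prod_mfd M N). U) \<longleftrightarrow> x \<in> points (prod_mfd M N)" for x
  proof
    assume "x \<in> (\<Union>(U, \<phi>)\<in>atlas (prod_mfd M N). U)"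
    then show "x \<in> points (prod_mfd M N)"
      unfolding atlas_prod_mfd using is_chartD(5)[OF chart] by blast
  next
    assume "x \<in> points (prod_mfd M N)"
    then obtain a b where ab: "x = (a, b)" "a \<in> points M" "b \<in> points N" by auto
    obtain U \<phi> where "(U, \<phi>) \<in> atlas M" "a \<in> U" using atlas_manifold_chartE[OF M ab(2)] .
    moreover obtain V \<psi> where "(V, \<psi>) \<in> atlas N" "b \<in> V" using atlas_manifold_chartE[OF N ab(3)] .
    ultimately have "(U \<times> V, prod_chart (cdim M) \<phi> \<psi>) \<in> atlas (prod_mfd M N)" "x \<in> U \<times> V"
      unfolding atlas_prod_mfd ab(1) by blast+
    then show "x \<in> (\<Union>(U, \<phi>)\<in>atlas (prod_mfd M N). U)" by blast
  qed
  then have "(\<Union>(U, \<phi>)\<in>atlas (prod_mfd M N). U) = points (prod_mfd M N)" by blast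
  moreover have "is_chart (prod_mfd M N) c" if "c \<in> atlas (prod_mfd M N)" for c
    using that unfolding atlas_prod_mfd by (elim CollectE exE conjE) (simp add: chart)
  moreover have "compatible (cdim (prod_mfd M N)) c d"
    if "c \<in> atlas (prod_mfd M N)" "d \<in> atlas (prod_mfd M N)" for c d
    using that unfolding atlas_prod_mfd by (elim CollectE exE conjE) (simp add: compat)
  ultimately show ?thesis unfolding atlas_manifold_def by blast
qed

lemma charts_prod:
  assumes "atlas_manifold M" "atlas_manifold N" "(U, \<phi>) \<in> atlas M" "(V, \<psi>) \<in> atlas N"
  shows "(U \<times> V, prod_chart (cdim M) \<phi> \<psi>) \<in> charts (prod_mfd M N)"
  using atlas_subset_charts[OF atlas_manifold_prod[OF assms(1,2)]] assms(3,4) unfolding atlas_prod_mfd by blast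

lemma continuous_at_point_prod:
  assumes "continuous_at_point X X' f x" "continuous_at_point Y Y' g y"
  shows "continuous_at_point (prod_topology X Y) (prod_topology X' Y') (\<lambda>(x, y). (f x, g y)) (x, y)"
  unfolding continuous_at_point_def
proof (intro conjI allI impI)
  fix T assume T: "openin (prod_topology X' Y') T \<and> (case (x, y) of (x, y) \<Rightarrow> (f x, g y)) \<in> T"
  then obtain A B where AB: "openin X' A" "openin Y' B" "f x \<in> A" "g y \<in> B" "A \<times> B \<subseteq> T"
    unfolding openin_prod_topology_alt by (simp only: prod.case) meson
  obtain A' where A': "openin X A'" "x \<in> A'" "f ` A' \<subseteq> A" using continuous_at_pointE[OF assms(1) AB(1,3)] .
  obtain B' where B': "openin Y B'" "y \<in> B'" "g ` B' \<subseteq> B" using continuous_at_pointE[OF assms(2) AB(2,4)] .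
  show "\<exists>N. openin (prod_topology X Y) N \<and> (x, y) \<in> N \<and> (\<lambda>(x, y). (f x, g y)) ` N \<subseteq> T"
    using A' B' AB(5) by (intro exI[of _ "A' \<times> B'"]) (auto simp: openin_prod_Times_iff)
qed (use assms in \<open>auto simp: continuous_at_point_def\<close>)

lemma holomorphic_at_prod:
  assumes M: "atlas_manifold M1" "atlas_manifold M2" and N: "atlas_manifold N1" "atlas_manifold N2"
    and f: "holomorphic_at M1 N1 f x" and g: "holomorphic_at M2 N2 g y"
  shows "holomorphic_at (prod_mfd M1 M2) (prod_mfd N1 N2) (\<lambda>(x, y). (f x, g y)) (x, y)"
proof -
  have pts: "x \<in> points M1" "f x \<in> points N1" "y \<in> points M2" "g y \<in> points N2"
    using f g by (auto simp: holomorphic_at_def continuous_at_point_def)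
  obtain U1 \<phi>1 where 1: "(U1, \<phi>1) \<in> atlas M1" "(U1, \<phi>1) \<in> charts M1" "x \<in> U1" using atlas_manifold_chartE[OF M(1) pts(1)] .
  obtain V1 \<psi>1 where 2: "(V1, \<psi>1) \<in> atlas N1" "(V1, \<psi>1) \<in> charts N1" "f x \<in> V1" using atlas_manifold_chartE[OF N(1) pts(2)] .
  obtain U2 \<phi>2 where 3: "(U2, \<phi>2) \<in> atlas M2" "(U2, \<phi>2) \<in> charts M2" "y \<in> U2" using atlas_manifold_chartE[OF M(2) pts(3)] .
  obtain V2 \<psi>2 where 4: "(V2, \<psi>2) \<in> atlas N2" "(V2, \<psi>2) \<in> charts N2" "g y \<in> V2" using atlas_manifold_chartE[OF N(2) pts(4)] .
  show ?thesis
  proof (rule holomorphic_atI[OF atlas_manifold_prod[OF M] atlas_manifold_prod[OF N] _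
        charts_prod[OF M 1(1) 3(1)] _ charts_prod[OF N 2(1) 4(1)]])
    show "continuous_at_point (mtop (prod_mfd M1 M2)) (mtop (prod_mfd N1 N2)) (\<lambda>(x, y). (f x, g y)) (x, y)"
      using f g continuous_at_point_prod by (auto simp: holomorphic_at_def)
    show "hol_at (cdim (prod_mfd M1 M2)) (cdim (prod_mfd N1 N2))
      (\<lambda>w. prod_chart (cdim N1) \<psi>1 \<psi>2 (case inv_into (U1 \<times> U2) (prod_chart (cdim M1) \<phi>1 \<phi>2) w of (x, y) \<Rightarrow> (f x, g y)))
      (prod_chart (cdim M1) \<phi>1 \<phi>2 (x, y))"
      using hol_at_prod_charts[OF 1(2) 2(2) 3(2) 4(2) f g 1(3) 2(3) 3(3) 4(3)] by (simp add: case_prod_unfold)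
  qed (use 1 2 3 4 in auto)
qed

lemma atlas_manifold_complex_line: "atlas_manifold complex_line"
proof -
  let ?\<phi> = "\<lambda>(z::complex) i::nat. if i = 0 then z else 0"
  have im: "range ?\<phi> = cspace 1"
  proof (intro equalityI subsetI)
    fix w :: "nat \<Rightarrow> complex" assume "w \<in> cspace 1"
    then have "w = ?\<phi> (w 0)" by (auto simp: cspace_def fun_eq_iff)
    then show "w \<in> range ?\<phi>" by blast
  qed (auto simp: cspace_def)
  have "homeomorphic_maps euclidean (top_of_set (cspace 1)) ?\<phi> (\<lambda>w. w 0)"
    unfolding homeomorphic_maps_def
  proof (intro conjI)
    have "continuous_on UNIV ?\<phi>" 
    proof (rule continuous_on_coordinatewise_then_product)
      fix i :: nat show "continuous_on UNIV (\<lambda>z. ?\<phi> z i)" by (cases "i = 0") simp_all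
    qed
    then show "continuous_map euclidean (top_of_set (cspace 1)) ?\<phi>"
      using im by (intro continuous_map_into_subtopology) auto
    show "continuous_map (top_of_set (cspace 1)) euclidean (\<lambda>w. w 0)"
      using continuous_on_subset[OF continuous_on_product_coordinates[of 0]] by auto
  qed (auto simp: cspace_def fun_eq_iff)
  then have "homeomorphic_map euclidean (top_of_set (cspace 1)) ?\<phi>"
    unfolding homeomorphic_map_maps by blast
  then have chart: "is_chart complex_line (UNIV, ?\<phi>)"
    by (simp add: is_chart_def complex_line_def im[unfolded One_nat_def])
  have inv: "?\<phi> (inv_into UNIV ?\<phi> w) = w" if "w \<in> cspace 1" for w
    using f_inv_into_f[of w ?\<phi> UNIV] im that by simp
  have "hol_at 1 1 (\<lambda>w. ?\<phi> (inv_into UNIV ?\<phi> w)) (?\<phi> z)" for z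
  proof (rule hol_at_cong[OF hol_at_id])
    show "?\<phi> z \<in> cspace 1" by (simp add: cspace_def)
    show "eventually (\<lambda>w. w = ?\<phi> (inv_into UNIV ?\<phi> w)) (cnbhd 1 (?\<phi> z))"
      using eventually_cnbhd_cspace[of 1 "?\<phi> z"] by eventually_elim (use inv in simp)
  qed
  then have "compatible 1 (UNIV, ?\<phi>) (UNIV, ?\<phi>)"
    using compatible_iff_hol_at[OF chart chart] by (simp add: complex_line_def)
  with chart show ?thesis
    unfolding atlas_manifold_def by (simp add: complex_line_def)
qed

section \<open>Charts of spaces of arrows\<close>

lemma contractible_polydisc:
  fixes r :: "nat \<Rightarrow> real"
  assumes z: "z \<in> cspace n"
  shows "contractible {w \<in> cspace n. \<forall>i<n. w i \<in> ball (z i) (r i)}" (is "contractible ?B")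
proof -
  let ?h = "\<lambda>x i. (1 - of_real (fst x)) * snd x i + of_real (fst x) * z i"
  have "continuous_on ({0..1} \<times> ?B) ?h"
  proof (rule continuous_on_coordinatewise_then_product)
    fix i
    have "continuous_on ({0..1::real} \<times> ?B) (\<lambda>x. snd x i)"
      by (rule continuous_on_compose2[OF continuous_on_product_coordinates continuous_on_snd[OF continuous_on_id]]) auto
    then show "continuous_on ({0..1} \<times> ?B) (\<lambda>x. ?h x i)"
      by (intro continuous_intros)
  qed
  moreover have "?h (t, w) \<in> ?B" if "t \<in> {0..1}" "w \<in> ?B" for t w
  proof -
    have "?h (t, w) i \<in> ball (z i) (r i)" if i: "i < n" for i
    proof -
      have w: "w i \<in> ball (z i) (r i)" using \<open>w \<in> ?B\<close> i by blast
      then have "z i \<in> ball (z i) (r i)" by (metis centre_in_ball empty_iff ball_empty not_le)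
      then show ?thesis
        using convexD_alt[OF convex_ball w, of "z i" t] \<open>t \<in> {0..1}\<close> by (simp add: scaleR_conv_of_real)
    qed
    moreover have "?h (t, w) \<in> cspace n" using that(2) z by (simp add: cspace_def)
    ultimately show ?thesis by blast
  qed
  ultimately have "homotopic_with_canon (\<lambda>x. True) ?B ?B id (\<lambda>x. z)"
    unfolding homotopic_with_def
    by (intro exI[of _ ?h]) (auto simp flip: subtopology_Times simp: Pi_iff id_def)
  then show ?thesis unfolding contractible_def by blast
qed

lemma polydisc_nbhd:
  assumes "open Z" "z \<in> Z" "z \<in> cspace n"
  obtains r where "\<forall>i. 0 < r i" "{w \<in> cspace n. \<forall>i<n. w i \<in> ball (z i) (r i)} \<subseteq> Z"
proof -
  have "openin (product_topology (\<lambda>_. euclidean) UNIV) Z" using assms(1) by (simp add: euclidean_product_topology)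
  from product_topology_open_contains_basis[OF this assms(2)]
  obtain X where X: "z \<in> (\<Pi>\<^sub>E i\<in>UNIV. X i)" "\<And>i. openin euclidean (X i)" "(\<Pi>\<^sub>E i\<in>UNIV. X i) \<subseteq> Z"
    by blast
  have "\<exists>r. 0 < r \<and> ball (z i) r \<subseteq> X i" for i
    using X(1) X(2)[of i] open_contains_ball[of "X i"] by (auto simp: PiE_iff)
  then obtain r where r: "\<And>i. 0 < r i" "\<And>i. ball (z i) (r i) \<subseteq> X i" by metis
  have "w \<in> Z" if w: "w \<in> cspace n" "\<forall>i<n. w i \<in> ball (z i) (r i)" for w
  proof -
    have "w i \<in> X i" for i
    proof (cases "i < n")
      case False
      then have "w i = z i" using w(1) assms(3) by (simp add: cspace_def)
      then show ?thesis using X(1) by (simp add: PiE_iff)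
    qed (use w(2) r(2) in blast)
    then show ?thesis using X(3) by (auto simp: PiE_iff)
  qed
  then show thesis using that r(1) by blast
qed

lemma openin_polydisc:
  "openin (top_of_set (cspace n)) {w \<in> cspace n. \<forall>i<n. w i \<in> ball (z i) (r i)}"
  unfolding openin_cspace_iff
proof (intro conjI ballI)
  fix w assume w: "w \<in> {w \<in> cspace n. \<forall>i<n. w i \<in> ball (z i) (r i)}"
  have "eventually (\<lambda>v. \<forall>i\<in>{..<n}. v i \<in> ball (z i) (r i)) (cnbhd n w)"
  proof (rule eventually_ball_finite)
    show "\<forall>i\<in>{..<n}. eventually (\<lambda>v. v i \<in> ball (z i) (r i)) (cnbhd n w)"
      by (intro ballI topological_tendstoD[OF tendsto_coordinate open_ball]) (use w in blast)
  qed simp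
  with eventually_cnbhd_cspace[of n w]
  show "eventually (\<lambda>v. v \<in> {w \<in> cspace n. \<forall>i<n. w i \<in> ball (z i) (r i)}) (cnbhd n w)"
    by eventually_elim simp
qed blast

text \<open>In a chart every neighbourhood contains a polydisc, which contracts along straight lines.\<close>

lemma atlas_manifold_contractible_base:
  assumes M: "atlas_manifold M" shows "contractible_base (mtop M)"
  unfolding contractible_base_def
proof (intro allI impI, elim conjE)
  fix x T assume T: "openin (mtop M) T" "x \<in> T"
  then have "x \<in> points M" using openin_subset by blast
  then obtain U \<phi> where c: "(U, \<phi>) \<in> charts M" "x \<in> U" using atlas_manifold_chartE[OF M] by metis
  let ?n = "cdim M"
  note c0 = charts_is_chart[OF c(1)]
  note c' = is_chartD[OF c0]
  have "openin (top_of_set (cspace ?n)) (\<phi> ` (U \<inter> T))"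
    using T c' by (intro is_chart_open_image[OF c0]) auto
  then obtain Z where Z: "open Z" "\<phi> ` (U \<inter> T) = cspace ?n \<inter> Z" by (auto simp: openin_open)
  have z: "\<phi> x \<in> cspace ?n" "\<phi> x \<in> Z" using Z T c by blast+
  obtain r where r: "\<forall>i. 0 < r i" "{w \<in> cspace ?n. \<forall>i<?n. w i \<in> ball (\<phi> x i) (r i)} \<subseteq> Z"
    using polydisc_nbhd[OF Z(1) z(2,1)] .
  let ?B = "{w \<in> cspace ?n. \<forall>i<?n. w i \<in> ball (\<phi> x i) (r i)}"
  let ?V = "{y \<in> U. \<phi> y \<in> ?B}"
  have BU: "?B \<subseteq> \<phi> ` (U \<inter> T)" using r(2) Z(2) by blast
  have "?B = \<phi> ` ?V"
  proof
    show "?B \<subseteq> \<phi> ` ?V"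
    proof
      fix w assume w: "w \<in> ?B"
      then obtain y where "y \<in> U" "w = \<phi> y" using BU by blast
      with w show "w \<in> \<phi> ` ?V" by blast
    qed
  qed blast
  have VT: "?V \<subseteq> T"
  proof
    fix y assume y: "y \<in> ?V"
    then obtain y' where "y' \<in> U" "y' \<in> T" "\<phi> y = \<phi> y'" using BU by blast
    then show "y \<in> T" using c'(3) y by (auto dest: inj_onD)
  qed
  have "openin (mtop M) ?V"
  proof (subst openin_subopen, intro ballI)
    fix y assume y: "y \<in> ?V"
    then have "eventually (\<lambda>w. w \<in> ?B) (cnbhd ?n (\<phi> y))"
      by (intro eventually_cnbhd_openin[OF openin_polydisc]) simp
    then obtain T' where "openin (mtop M) T'" "y \<in> T'" "T' \<subseteq> U" "\<And>y. y \<in> T' \<Longrightarrow> \<phi> y \<in> ?B"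
      using is_chart_pullback[OF c0, of y "\<lambda>w. w \<in> ?B"] y by blast
    then show "\<exists>T'. openin (mtop M) T' \<and> y \<in> T' \<and> T' \<subseteq> ?V" by blast
  qed
  moreover have "contractible_space (subtopology (mtop M) ?V)"
  proof -
    have "homeomorphic_map (subtopology (mtop M) ?V) (top_of_set ?B) \<phi>"
      by (subst \<open>?B = \<phi> ` ?V\<close>, rule is_chart_restrict_homeomorphic[OF c0]) blast
    then have "subtopology (mtop M) ?V homeomorphic_space top_of_set ?B"
      by (rule homeomorphic_map_imp_homeomorphic_space)
    then show ?thesis
      using contractible_polydisc[OF z(1), of r]
      unfolding contractible_space_top_of_set[symmetric] by (simp only: homeomorphic_space_contractibility)
  qed
  moreover have "x \<in> ?V" using c(2) z(1) r(1) by simp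
  ultimately show "\<exists>U. openin (mtop M) U \<and> x \<in> U \<and> U \<subseteq> T \<and> contractible_space (subtopology (mtop M) U)"
    using VT by blast
qed

abbreviation arrow_ends :: "(real \<Rightarrow> 'a) set \<Rightarrow> 'a \<times> 'a" where
  "arrow_ends a \<equiv> (finish a, start a)"

text \<open>The condition under which \<open>W\<close> carries a chart of the space of arrows, given by the charts \<open>\<phi>\<close> and \<open>\<psi>\<close>
  at the finish and at the start.\<close>

definition arrow_chart_data ::
  "'a cmfd \<Rightarrow> (real \<Rightarrow> 'a) set set \<Rightarrow> 'a set \<Rightarrow> ('a \<Rightarrow> nat \<Rightarrow> complex) \<Rightarrow> 'a set \<Rightarrow> ('a \<Rightarrow> nat \<Rightarrow> complex) \<Rightarrow> bool" where
  "arrow_chart_data Y W U \<phi> V \<psi> \<longleftrightarrow>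
     (U, \<phi>) \<in> atlas Y \<and> (V, \<psi>) \<in> atlas Y \<and>
     openin (arrow_topology (mtop Y)) W \<and> finish ` W \<subseteq> U \<and> start ` W \<subseteq> V \<and>
     openin (prod_topology (mtop Y) (mtop Y)) (arrow_ends ` W) \<and>
     homeomorphic_map (subtopology (arrow_topology (mtop Y)) W)
       (subtopology (prod_topology (mtop Y) (mtop Y)) (arrow_ends ` W)) arrow_ends"

abbreviation arrow_coords :: "'a cmfd \<Rightarrow> ('a \<Rightarrow> nat \<Rightarrow> complex) \<Rightarrow> ('a \<Rightarrow> nat \<Rightarrow> complex) \<Rightarrow> (real \<Rightarrow> 'a) set \<Rightarrow> nat \<Rightarrow> complex" where
  "arrow_coords Y \<phi> \<psi> a \<equiv> cappend (cdim Y) (\<phi> (finish a)) (\<psi> (start a))"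

lemma arrow_mfd_simps [simp]:
  "mtop (arrow_mfd Y) = arrow_topology (mtop Y)" "cdim (arrow_mfd Y) = 2 * cdim Y"
  by (simp_all add: arrow_mfd_def)

lemma atlas_arrow_mfd:
  "atlas (arrow_mfd Y) = {(W, arrow_coords Y \<phi> \<psi>) | W U \<phi> V \<psi>. arrow_chart_data Y W U \<phi> V \<psi>}"
  by (simp add: arrow_mfd_def arrow_chart_data_def)

lemma is_chart_arrow:
  assumes Y: "atlas_manifold Y" and W: "arrow_chart_data Y W U \<phi> V \<psi>"
  shows "is_chart (arrow_mfd Y) (W, arrow_coords Y \<phi> \<psi>)"
proof -
  let ?\<Phi> = "prod_chart (cdim Y) \<phi> \<psi>"
  have W': "(U, \<phi>) \<in> atlas Y" "(V, \<psi>) \<in> atlas Y"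
     "openin (arrow_topology (mtop Y)) W" "finish ` W \<subseteq> U" "start ` W \<subseteq> V"
     "openin (prod_topology (mtop Y) (mtop Y)) (arrow_ends ` W)"
     "homeomorphic_map (subtopology (arrow_topology (mtop Y)) W)
       (subtopology (prod_topology (mtop Y) (mtop Y)) (arrow_ends ` W)) arrow_ends"
    using W by (simp_all add: arrow_chart_data_def)
  have c: "is_chart (prod_mfd Y Y) (U \<times> V, ?\<Phi>)"
    using W'(1,2) Y by (intro is_chart_prod) (auto simp: atlas_manifold_def)
  have sub: "arrow_ends ` W \<subseteq> U \<times> V" using W'(4,5) by auto
  have "homeomorphic_map (subtopology (prod_topology (mtop Y) (mtop Y)) (arrow_ends ` W)) (top_of_set (?\<Phi> ` arrow_ends ` W)) ?\<Phi>"
    using is_chart_restrict_homeomorphic[OF c sub] by simp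
  with W'(7) have "homeomorphic_map (subtopology (arrow_topology (mtop Y)) W) (top_of_set (?\<Phi> ` arrow_ends ` W)) (?\<Phi> \<circ> arrow_ends)"
    by (rule homeomorphic_map_compose)
  moreover have "openin (top_of_set (cspace (cdim Y + cdim Y))) (?\<Phi> ` arrow_ends ` W)"
    using is_chart_open_image[OF c _ sub] W'(6) by simp
  moreover have "?\<Phi> ` arrow_ends ` W = arrow_coords Y \<phi> \<psi> ` W" by (simp add: image_image)
  ultimately show ?thesis
    using W'(3) by (simp add: is_chart_def o_def mult_2)
qed

text \<open>If \<open>F\<close> covers a map \<open>g\<close> of end points, then its expression in charts of arrows is the expression of
  \<open>g \<times> g\<close> in product charts. The identity map yields the compatibility of charts of arrows.\<close>

lemma hol_at_arrow_charts:
  assumes Y: "atlas_manifold Y" and Y': "atlas_manifold Y'"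
    and W: "arrow_chart_data Y W U \<phi> V \<psi>" and W': "arrow_chart_data Y' W' U' \<phi>' V' \<psi>'"
    and g: "holomorphic_at Y Y' g (finish a)" "holomorphic_at Y Y' g (start a)"
    and a: "a \<in> W" "F a \<in> W'"
    and T: "openin (arrow_topology (mtop Y)) T" "a \<in> T" and F: "\<And>b. b \<in> T \<Longrightarrow> finish (F b) = g (finish b) \<and> start (F b) = g (start b)"
  shows "hol_at (2 * cdim Y) (2 * cdim Y') (\<lambda>w. arrow_coords Y' \<phi>' \<psi>' (F (inv_into W (arrow_coords Y \<phi> \<psi>) w))) (arrow_coords Y \<phi> \<psi> a)"
proof -
  have at: "(U, \<phi>) \<in> atlas Y" "(V, \<psi>) \<in> atlas Y" "(U', \<phi>') \<in> atlas Y'" "(V', \<psi>') \<in> atlas Y'"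
    using W W' by (simp_all add: arrow_chart_data_def)
  then have ch: "(U, \<phi>) \<in> charts Y" "(V, \<psi>) \<in> charts Y" "(U', \<phi>') \<in> charts Y'" "(V', \<psi>') \<in> charts Y'"
    using atlas_subset_charts Y Y' by blast+
  have ends: "finish b \<in> U" "start b \<in> V" if "b \<in> W" for b using W that by (auto simp: arrow_chart_data_def)
  have ends': "g (finish a) \<in> U'" "g (start a) \<in> V'" using W' a F[OF T(2)] by (auto simp: arrow_chart_data_def)
  note hol = hol_at_prod_charts[OF ch(1,3,2,4) g ends(1)[OF a(1)] ends'(1) ends(2)[OF a(1)] ends'(2)]
  note c = is_chart_arrow[OF Y W]
  show ?thesis
    unfolding mult_2
  proof (rule hol_at_cong[OF hol])
    have "eventually (\<lambda>w. (case inv_into (U \<times> V) (prod_chart (cdim Y) \<phi> \<psi>) w of (x, y) \<Rightarrow> prod_chart (cdim Y') \<phi>' \<psi>' (g x, g y)) =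
       arrow_coords Y' \<phi>' \<psi>' (F (inv_into W (arrow_coords Y \<phi> \<psi>) w))) (cnbhd (cdim (arrow_mfd Y)) (arrow_coords Y \<phi> \<psi> a))"
    proof (rule is_chart_eventually[OF c a(1)])
      fix b assume b: "b \<in> W" "b \<in> T"
      have "inv_into W (arrow_coords Y \<phi> \<psi>) (arrow_coords Y \<phi> \<psi> b) = b"
        using is_chartD(3)[OF c] b(1) by (rule inv_into_f_f)
      then show "(case inv_into (U \<times> V) (prod_chart (cdim Y) \<phi> \<psi>) (arrow_coords Y \<phi> \<psi> b) of (x, y) \<Rightarrow> prod_chart (cdim Y') \<phi>' \<psi>' (g x, g y)) =
       arrow_coords Y' \<phi>' \<psi>' (F (inv_into W (arrow_coords Y \<phi> \<psi>) (arrow_coords Y \<phi> \<psi> b)))"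
        using inv_into_prod_chart[OF charts_is_chart[OF ch(1)] charts_is_chart[OF ch(2)] ends[OF b(1)]] F[OF b(2)] by simp
    qed (use T in simp_all)
    then show "eventually (\<lambda>w. (case inv_into (U \<times> V) (prod_chart (cdim Y) \<phi> \<psi>) w of (x, y) \<Rightarrow> prod_chart (cdim Y') \<phi>' \<psi>' (g x, g y)) =
       arrow_coords Y' \<phi>' \<psi>' (F (inv_into W (arrow_coords Y \<phi> \<psi>) w))) (cnbhd (cdim Y + cdim Y) (arrow_coords Y \<phi> \<psi> a))"
      by (simp add: mult_2)
  qed
qed

lemma arrow_chart_exists:
  assumes Y: "atlas_manifold Y" and a: "a \<in> arrow_set (mtop Y)"
  obtains W U \<phi> V \<psi> where "arrow_chart_data Y W U \<phi> V \<psi>" "a \<in> W"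
proof -
  obtain U \<phi> where U: "(U, \<phi>) \<in> atlas Y" "(U, \<phi>) \<in> charts Y" "finish a \<in> U"
    using atlas_manifold_chartE[OF Y finish_in_topspace[OF a]] .
  obtain V \<psi> where V: "(V, \<psi>) \<in> atlas Y" "(V, \<psi>) \<in> charts Y" "start a \<in> V"
    using atlas_manifold_chartE[OF Y start_in_topspace[OF a]] .
  note base = atlas_manifold_contractible_base[OF Y]
  obtain U0 where U0: "openin (mtop Y) U0" "finish a \<in> U0" "U0 \<subseteq> U" "contractible_space (subtopology (mtop Y) U0)"
    using contractible_baseE[OF base is_chartD(1)[OF charts_is_chart[OF U(2)]] U(3)] .
  obtain V0 where V0: "openin (mtop Y) V0" "start a \<in> V0" "V0 \<subseteq> V" "contractible_space (subtopology (mtop Y) V0)"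
    using contractible_baseE[OF base is_chartD(1)[OF charts_is_chart[OF V(2)]] V(3)] .
  let ?W = "arrow_nbhd (mtop Y) a V0 U0"
  have im: "arrow_ends ` ?W = U0 \<times> V0" using arrow_nbhd_image[OF a V0(2) U0(2) V0(1,4) U0(1,4)] .
  have "finish ` ?W \<subseteq> U" "start ` ?W \<subseteq> V"
    using arrow_nbhd_endpoints[OF a] U0(3) V0(3) by blast+
  then have "arrow_chart_data Y ?W U \<phi> V \<psi>"
    unfolding arrow_chart_data_def im
    using U(1) V(1) openin_arrow_nbhd[OF a V0(1) U0(1) V0(2) U0(2)] U0(1) V0(1)
      homeomorphic_map_arrow_nbhd[OF base a V0(2) U0(2) V0(1,4) U0(1,4)]
    by (simp add: openin_prod_Times_iff)
  then show thesis using that arrow_in_arrow_nbhd[OF a V0(2) U0(2)] by blast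
qed

lemma atlas_manifold_arrow_mfd:
  assumes Y: "atlas_manifold Y" shows "atlas_manifold (arrow_mfd Y)"
proof -
  have compat: "compatible (2 * cdim Y) (W, arrow_coords Y \<phi> \<psi>) (W', arrow_coords Y \<phi>' \<psi>')"
    if W: "arrow_chart_data Y W U \<phi> V \<psi>" and W': "arrow_chart_data Y W' U' \<phi>' V' \<psi>'" for W U \<phi> V \<psi> W' U' \<phi>' V' \<psi>'
  proof -
    have "hol_at (2 * cdim Y) (2 * cdim Y) (\<lambda>w. arrow_coords Y \<phi>' \<psi>' (inv_into W (arrow_coords Y \<phi> \<psi>) w)) (arrow_coords Y \<phi> \<psi> a)"
      if W: "arrow_chart_data Y W U \<phi> V \<psi>" and W': "arrow_chart_data Y W' U' \<phi>' V' \<psi>'" and a: "a \<in> W" "a \<in> W'"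
      for W U \<phi> V \<psi> W' U' \<phi>' V' \<psi>' a
    proof -
      have "openin (arrow_topology (mtop Y)) W" using W by (simp add: arrow_chart_data_def)
      then have "a \<in> arrow_set (mtop Y)" using a openin_subset topspace_arrow_topology by blast
      then show ?thesis
        using hol_at_arrow_charts[OF Y Y W W' holomorphic_at_id[OF Y] holomorphic_at_id[OF Y], of a "\<lambda>b. b" "arrow_set (mtop Y)"]
          a finish_in_topspace[of a "mtop Y"] start_in_topspace[of a "mtop Y"] openin_topspace[of "arrow_topology (mtop Y)"] by (simp add: topspace_arrow_topology)
    qed
    from this[OF W W'] this[OF W' W] show ?thesis
      using compatible_iff_hol_at[OF is_chart_arrow[OF Y W] is_chart_arrow[OF Y W']] by simp
  qed
  have "x \<in> (\<Union>(U, \<phi>)\<in>atlas (arrow_mfd Y). U) \<longleftrightarrow> x \<in> points (arrow_mfd Y)" for x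
  proof
    assume "x \<in> (\<Union>(U, \<phi>)\<in>atlas (arrow_mfd Y). U)"
    then show "x \<in> points (arrow_mfd Y)"
      unfolding atlas_arrow_mfd using is_chartD(5)[OF is_chart_arrow[OF Y]] by blast
  next
    assume "x \<in> points (arrow_mfd Y)"
    then have "x \<in> arrow_set (mtop Y)" by (simp add: topspace_arrow_topology)
    then obtain W U \<phi> V \<psi> where "arrow_chart_data Y W U \<phi> V \<psi>" "x \<in> W"
      using arrow_chart_exists[OF Y] by blast
    then have "(W, arrow_coords Y \<phi> \<psi>) \<in> atlas (arrow_mfd Y)" "x \<in> W" unfolding atlas_arrow_mfd by blast+
    then show "x \<in> (\<Union>(U, \<phi>)\<in>atlas (arrow_mfd Y). U)" by blast
  qed
  then have "(\<Union>(U, \<phi>)\<in>atlas (arrow_mfd Y). U) = points (arrow_mfd Y)" by blast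
  moreover have "is_chart (arrow_mfd Y) c" if "c \<in> atlas (arrow_mfd Y)" for c
    using that unfolding atlas_arrow_mfd by (elim CollectE exE conjE) (simp add: is_chart_arrow[OF Y])
  moreover have "compatible (cdim (arrow_mfd Y)) c d"
    if "c \<in> atlas (arrow_mfd Y)" "d \<in> atlas (arrow_mfd Y)" for c d
    using that unfolding atlas_arrow_mfd by (elim CollectE exE conjE) (simp add: compat)
  ultimately show ?thesis unfolding atlas_manifold_def by blast
qed

lemma holomorphic_at_arrow_mfd:
  assumes Y: "atlas_manifold Y" and Y': "atlas_manifold Y'"
    and F: "continuous_at_point (arrow_topology (mtop Y)) (arrow_topology (mtop Y')) F a"
    and g: "holomorphic_at Y Y' g (finish a)" "holomorphic_at Y Y' g (start a)"
    and T: "openin (arrow_topology (mtop Y)) T" "a \<in> T" and Fg: "\<And>b. b \<in> T \<Longrightarrow> finish (F b) = g (finish b) \<and> start (F b) = g (start b)"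
  shows "holomorphic_at (arrow_mfd Y) (arrow_mfd Y') F a"
proof -
  have aY: "a \<in> arrow_set (mtop Y)" "F a \<in> arrow_set (mtop Y')"
    using F by (auto simp: continuous_at_point_def topspace_arrow_topology)
  obtain W U \<phi> V \<psi> where W: "arrow_chart_data Y W U \<phi> V \<psi>" "a \<in> W"
    using arrow_chart_exists[OF Y aY(1)] .
  obtain W' U' \<phi>' V' \<psi>' where W': "arrow_chart_data Y' W' U' \<phi>' V' \<psi>'" "F a \<in> W'"
    using arrow_chart_exists[OF Y' aY(2)] .
  have "(W, arrow_coords Y \<phi> \<psi>) \<in> atlas (arrow_mfd Y)" "(W', arrow_coords Y' \<phi>' \<psi>') \<in> atlas (arrow_mfd Y')"
    unfolding atlas_arrow_mfd using W W' by blast+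
  then have c: "(W, arrow_coords Y \<phi> \<psi>) \<in> charts (arrow_mfd Y)" "(W', arrow_coords Y' \<phi>' \<psi>') \<in> charts (arrow_mfd Y')"
    using atlas_subset_charts atlas_manifold_arrow_mfd Y Y' by blast+
  show ?thesis
  proof (rule holomorphic_atI[where f=F, OF atlas_manifold_arrow_mfd[OF Y] atlas_manifold_arrow_mfd[OF Y'] _ c(1) W(2) c(2) W'(2)])
    show "continuous_at_point (mtop (arrow_mfd Y)) (mtop (arrow_mfd Y')) F a" using F by simp
    show "hol_at (cdim (arrow_mfd Y)) (cdim (arrow_mfd Y'))
       (\<lambda>w. arrow_coords Y' \<phi>' \<psi>' (F (inv_into W (arrow_coords Y \<phi> \<psi>) w))) (arrow_coords Y \<phi> \<psi> a)"
      using hol_at_arrow_charts[OF Y Y' W(1) W'(1) g W(2) W'(2) T Fg] by simp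
  qed
qed

section \<open>Slice charts of fibre products over a thickening\<close>

lemma hol_at_add:
  assumes "hol_at n m F z" "hol_at n m G z"
  shows "hol_at n m (\<lambda>w i. F w i + G w i) z"
proof -
  have "z \<in> cspace n" using assms(1) by (simp add: hol_at_def)
  then have 0: "hol_at n m (\<lambda>w i. 0) z"
    by (rule hol_at_coordinatesI) (auto simp: cspace_def cdifferentiable_const)
  show ?thesis using hol_at_diff[OF assms(1) hol_at_diff[OF 0 assms(2)]] by simp
qed

lemma cappend_in_cspace_iff: "cappend n u (cappend m v w) \<in> cspace (n + m) \<longleftrightarrow> w = (\<lambda>_. 0)"
proof
  assume L: "cappend n u (cappend m v w) \<in> cspace (n + m)"
  show "w = (\<lambda>_. 0)"
  proof
    fix i
    have "cappend n u (cappend m v w) (n + m + i) = 0" using L by (simp add: cspace_def)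
    then show "w i = 0" by (simp add: cappend_def)
  qed
qed (auto simp: cappend_def cspace_def)

text \<open>The coordinates are split into three groups \<open>(z, w, c)\<close>, of lengths \<open>n\<close>, \<open>m\<close> and \<open>l\<close>. The biholomorphism
  \<open>(z, w, c) \<mapsto> (z, c, w - P z)\<close>, with inverse \<open>(z, c, v) \<mapsto> (z, v + P z, c)\<close>, flattens the graph of \<open>P\<close>
  and moves the flattened coordinates to the end, where slice charts expect them.\<close>

lemma shear_charts:
  fixes n m l :: nat
  assumes M: "atlas_manifold M" and dim: "cdim M = n + (m + l)" and c: "(U, \<phi>) \<in> charts M"
    and \<Omega>: "openin (top_of_set (cspace n)) \<Omega>" "\<And>z. z \<in> \<phi> ` U \<Longrightarrow> cfirst n z \<in> \<Omega>"
    and P: "\<And>z. z \<in> \<Omega> \<Longrightarrow> hol_at n m P z"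
  shows "(U, \<lambda>x. cappend n (cfirst n (\<phi> x)) (cappend l (cdrop m (cdrop n (\<phi> x)))
            (\<lambda>i. cfirst m (cdrop n (\<phi> x)) i - P (cfirst n (\<phi> x)) i))) \<in> charts M"
proof -
  let ?\<theta> = "\<lambda>z. cappend n (cfirst n z) (cappend l (cdrop m (cdrop n z)) (\<lambda>i. cfirst m (cdrop n z) i - P (cfirst n z) i))"
  let ?\<theta>' = "\<lambda>y. cappend n (cfirst n y) (cappend m (\<lambda>i. cdrop l (cdrop n y) i + P (cfirst n y) i) (cfirst l (cdrop n y)))"
  have N: "n + (m + l) = n + (l + m)" by simp
  have zc: "z \<in> cspace (n + (m + l))" if "z \<in> \<phi> ` U" for z
    using that is_chart_cspace[OF charts_is_chart[OF c]] dim by auto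
  have Pc: "P z \<in> cspace m" if "z \<in> \<Omega>" for z using hol_at_cspace[OF P[OF that]] .
  have hol: "hol_at (n + (m + l)) (n + (l + m)) ?\<theta> z" if z: "z \<in> \<phi> ` U" for z
  proof -
    note d1 = hol_at_cdrop[OF zc[OF z]] and f1 = hol_at_cfirst[OF zc[OF z], of n]
    have dz: "cdrop n z \<in> cspace (m + l)" using hol_at_cspace[OF d1] .
    show ?thesis
      by (rule hol_at_cappend[OF f1 hol_at_cappend[OF hol_at_compose[OF d1 hol_at_cdrop[OF dz]]
          hol_at_diff[OF hol_at_compose[OF d1 hol_at_cfirst[OF dz, of m]] hol_at_compose[OF f1 P[OF \<Omega>(2)[OF z]]]]]])
  qed
  have hol': "hol_at (n + (l + m)) (n + (m + l)) ?\<theta>' y" if y: "y \<in> cspace (n + (l + m))" "cfirst n y \<in> \<Omega>" for y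
  proof -
    note d1 = hol_at_cdrop[OF y(1)] and f1 = hol_at_cfirst[OF y(1), of n]
    have dy: "cdrop n y \<in> cspace (l + m)" using hol_at_cspace[OF d1] .
    show ?thesis
      by (rule hol_at_cappend[OF f1 hol_at_cappend[OF hol_at_add[OF hol_at_compose[OF d1 hol_at_cdrop[OF dy]]
           hol_at_compose[OF f1 P[OF y(2)]]] hol_at_compose[OF d1 hol_at_cfirst[OF dy, of l]]]])
  qed
  have \<theta>mem: "?\<theta> z \<in> cspace (n + (l + m))" "cfirst n (?\<theta> z) \<in> \<Omega>" if "z \<in> \<phi> ` U" for z
    using hol_at_cspace[OF hol[OF that]] \<Omega>(2)[OF that] by simp_all
  have inv: "?\<theta>' (?\<theta> z) = z" if z: "z \<in> \<phi> ` U" for z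
  proof -
    have "cdrop m (cdrop n z) \<in> cspace l" using zc[OF z] by simp
    then show ?thesis by simp
  qed
  have inv': "eventually (\<lambda>y. ?\<theta> (?\<theta>' y) = y) (cnbhd (n + (l + m)) (?\<theta> z))" if z: "z \<in> \<phi> ` U" for z
  proof -
    have "eventually (\<lambda>y. cfirst n y \<in> \<Omega>) (cnbhd (n + (l + m)) (?\<theta> z))"
      by (rule eventually_compose_filterlim[OF eventually_cnbhd_openin[OF \<Omega>(1) \<theta>mem(2)[OF z]]
            hol_at_filterlim[OF hol_at_cfirst[OF \<theta>mem(1)[OF z], of n]]])
    then show ?thesis using eventually_cnbhd_cspace[of "n + (l + m)" "?\<theta> z"]
    proof eventually_elim
      case (elim y)
      have "(\<lambda>i. cdrop l (cdrop n y) i + P (cfirst n y) i) \<in> cspace m"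
        using Pc[OF elim(1)] cdrop_in_cspace[OF cdrop_in_cspace[OF elim(2)]] by (simp add: cspace_def)
      then show ?case by simp
    qed
  qed
  show ?thesis
    by (rule charts_change_coordinates[OF M c, where \<theta>="?\<theta>" and \<theta>'="?\<theta>'"])
       (use hol hol'[OF \<theta>mem] inv inv' in \<open>simp_all only: dim N\<close>)
qed

lemma atlas_manifold_open_submanifold:
  assumes M: "atlas_manifold M" and D: "openin (mtop M) D"
  shows "atlas_manifold (open_submanifold M D)"
    and "(T, \<phi>) \<in> charts M \<Longrightarrow> T \<subseteq> D \<Longrightarrow> (T, \<phi>) \<in> atlas (open_submanifold M D)"
proof -
  have slice: "slice_chart M (cdim M) D (T, \<phi>)" if "(T, \<phi>) \<in> charts M" "T \<subseteq> D" for T \<phi>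
    using that is_chart_cspace[OF charts_is_chart[OF that(1)]] by (auto simp: slice_chart_def)
  show "atlas_manifold (open_submanifold M D)"
  proof (rule atlas_manifold_submanifold[OF M openin_subset[OF D] order_refl])
    fix x assume x: "x \<in> D"
    then have "x \<in> points M" using openin_subset[OF D] by blast
    then obtain U \<phi> where c: "(U, \<phi>) \<in> charts M" "x \<in> U" using atlas_manifold_chartE[OF M] by blast
    have "(U \<inter> D, \<phi>) \<in> charts M"
      using is_chartD(1)[OF charts_is_chart[OF c(1)]] D by (intro charts_restrict[OF M c(1)]) auto
    then show "\<exists>U \<phi>. slice_chart M (cdim M) D (U, \<phi>) \<and> x \<in> U" using slice[of "U \<inter> D" \<phi>] c(2) x by blast
  qed
  show "(T, \<phi>) \<in> atlas (open_submanifold M D)" if "(T, \<phi>) \<in> charts M" "T \<subseteq> D"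
    unfolding atlas_submanifold using slice[OF that] that(2) by (auto intro!: exI[of _ T])
qed

lemma submanifold_simps [simp]:
  "mtop (submanifold M k Q) = subtopology (mtop M) Q" "cdim (submanifold M k Q) = k"
  by (simp_all add: submanifold_def)

lemma complex_line_simps [simp]: "mtop complex_line = euclidean" "cdim complex_line = 1"
  by (simp_all add: complex_line_def)

lemma atlas_manifold_thick:
  assumes "atlas_manifold S" "openin (mtop (prod_mfd S complex_line)) D"
  shows "atlas_manifold (thick_mfd S D)"
  using assms by (intro atlas_manifold_open_submanifold atlas_manifold_prod atlas_manifold_complex_line)

abbreviation fibre_product :: "'x cmfd \<Rightarrow> ('x \<Rightarrow> 's) \<Rightarrow> 's cmfd \<Rightarrow> ('s \<times> complex) set \<Rightarrow> ('x \<times> 's \<times> complex) set" where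
  "fibre_product X p S D \<equiv> {(x, d). x \<in> points X \<and> d \<in> points (thick_mfd S D) \<and> p x = fst d}"

text \<open>Points of the fibre product are \<open>(x, s, z)\<close> with \<open>s = p x\<close>. In coordinates this is the graph of \<open>p\<close>,
  which a shear turns into a coordinate subspace.\<close>

lemma thick_pullback_slice:
  assumes X: "atlas_manifold X" and S: "atlas_manifold S" and p: "holomorphic_map X S p"
    and D: "openin (mtop (prod_mfd S complex_line)) D"
    and E: "x \<in> points X" "d \<in> D" "p x = fst d"
  shows "\<exists>U \<phi>. slice_chart (prod_mfd X (thick_mfd S D)) (cdim X + 1)
      (fibre_product X p S D) (U, \<phi>) \<and> (x, d) \<in> U"
proof -
  let ?n = "cdim X" and ?m = "cdim S"
  have pc: "continuous_map (mtop X) (mtop S) p" using p by (simp add: holomorphic_map_def)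
  have DS: "D \<subseteq> topspace (mtop (prod_mfd S complex_line))" using D by (rule openin_subset)
  then have ptsD: "points (thick_mfd S D) = D" by auto
  have thick: "atlas_manifold (thick_mfd S D)" using S D by (rule atlas_manifold_thick)
  have SC: "atlas_manifold (prod_mfd S complex_line)" by (rule atlas_manifold_prod[OF S atlas_manifold_complex_line])
  obtain A \<phi> where A: "(A, \<phi>) \<in> atlas X" "(A, \<phi>) \<in> charts X" "x \<in> A" using atlas_manifold_chartE[OF X E(1)] .
  have "fst d \<in> points S" using DS E(2) by auto
  then obtain B \<psi> where B: "(B, \<psi>) \<in> atlas S" "(B, \<psi>) \<in> charts S" "fst d \<in> B" using atlas_manifold_chartE[OF S] by blast
  note A' = is_chartD[OF charts_is_chart[OF A(2)]] and B' = is_chartD[OF charts_is_chart[OF B(2)]]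
  define line where "line = (\<lambda>(z::complex) (i::nat). if i = 0 then z else 0)"
  have lineA: "(UNIV, line) \<in> atlas complex_line" by (simp add: complex_line_def line_def)
  have line1: "line z \<in> cspace 1" for z by (simp add: line_def cspace_def)
  let ?\<kappa> = "prod_chart ?m \<psi> line" and ?B = "(B \<times> UNIV) \<inter> D"
  have "(B \<times> UNIV, ?\<kappa>) \<in> charts (prod_mfd S complex_line)"
    by (rule charts_prod[OF S atlas_manifold_complex_line B(1) lineA])
  moreover have opB: "openin (mtop (prod_mfd S complex_line)) ?B"
    using D B'(1) by (intro openin_Int) (simp_all add: openin_prod_Times_iff)
  ultimately have "(?B, ?\<kappa>) \<in> charts (prod_mfd S complex_line)"
    by (rule charts_restrict[OF SC]) blast
  then have B2: "(?B, ?\<kappa>) \<in> atlas (thick_mfd S D)"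
    by (rule atlas_manifold_open_submanifold(2)[OF SC D]) blast
  let ?A = "{y \<in> A. p y \<in> B}" and ?M = "prod_mfd X (thick_mfd S D)"
  have M: "atlas_manifold ?M" by (rule atlas_manifold_prod[OF X thick])
  have opA: "openin (mtop X) ?A"
  proof -
    have "?A = A \<inter> {y \<in> points X. p y \<in> B}" using A'(5) by auto
    then show ?thesis using A'(1) openin_continuous_map_preimage[OF pc B'(1)] by (simp add: openin_Int)
  qed
  let ?\<Phi> = "prod_chart ?n \<phi> ?\<kappa>"
  have "(A \<times> ?B, ?\<Phi>) \<in> charts ?M" by (rule charts_prod[OF X thick A(1) B2])
  moreover have "openin (mtop ?M) (?A \<times> ?B)"
    using opA opB D by (simp add: openin_prod_Times_iff openin_open_subtopology)
  ultimately have c: "(?A \<times> ?B, ?\<Phi>) \<in> charts ?M"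
    by (rule charts_restrict[OF M]) auto
  let ?P = "\<lambda>z. \<psi> (p (inv_into A \<phi> z))"
  have cs: "\<phi> y \<in> cspace ?n" if "y \<in> A" for y using is_chart_cspace[OF charts_is_chart[OF A(2)] that] .
  have cs2: "\<psi> y \<in> cspace ?m" if "y \<in> B" for y using is_chart_cspace[OF charts_is_chart[OF B(2)] that] .
  have dim: "cdim ?M = ?n + (?m + 1)" by simp
  have op\<Omega>: "openin (top_of_set (cspace ?n)) (\<phi> ` ?A)"
    by (rule is_chart_open_image[OF charts_is_chart[OF A(2)] opA]) blast
  have fst\<Omega>: "cfirst ?n z \<in> \<phi> ` ?A" if "z \<in> ?\<Phi> ` (?A \<times> ?B)" for z
    using that cs by auto
  have holP: "hol_at ?n ?m ?P z" if "z \<in> \<phi> ` ?A" for z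
  proof -
    obtain y where y: "y \<in> A" "p y \<in> B" "z = \<phi> y" using \<open>z \<in> \<phi> ` ?A\<close> by blast
    have "holomorphic_at X S p y"
      using holomorphic_map_imp_at[OF X S p] y(1) A'(5) by blast
    then show ?thesis using A(2) B(2) y by (simp add: holomorphic_at_def)
  qed
  let ?\<Theta> = "\<lambda>x. cappend ?n (cfirst ?n (?\<Phi> x)) (cappend 1 (cdrop ?m (cdrop ?n (?\<Phi> x)))
            (\<lambda>i. cfirst ?m (cdrop ?n (?\<Phi> x)) i - ?P (cfirst ?n (?\<Phi> x)) i))"
  \<comment> \<open>\<open>?P\<close> is \<open>p\<close> in the charts \<open>\<phi>\<close> and \<open>\<psi>\<close>; the last group of coordinates is the complex line.\<close>
  have \<Theta>: "(?A \<times> ?B, ?\<Theta>) \<in> charts ?M"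
    by (rule shear_charts[OF M dim c op\<Omega> fst\<Omega> holP])
  have "slice_chart ?M (?n + 1) (fibre_product X p S D) (?A \<times> ?B, ?\<Theta>)"
    unfolding slice_chart_def prod.case
  proof (intro conjI \<Theta> ballI)
    fix w assume "w \<in> ?A \<times> ?B"
    then obtain y s z where w: "w = (y, (s, z))" "y \<in> A" "p y \<in> B" "s \<in> B" "(s, z) \<in> D" by auto
    have \<Theta>w: "?\<Theta> w = cappend ?n (\<phi> y) (cappend 1 (line z) (\<lambda>i. \<psi> s i - \<psi> (p y) i))"
      using w(2,4) cs cs2 A'(3) unfolding w(1) by simp
    have "w \<in> (fibre_product X p S D) \<longleftrightarrow> p y = s"
      unfolding ptsD using w A'(5) by auto
    also have "\<dots> \<longleftrightarrow> \<psi> s = \<psi> (p y)" using B'(3) w by (auto simp: inj_on_eq_iff)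
    also have "\<dots> \<longleftrightarrow> ?\<Theta> w \<in> cspace (?n + 1)"
      unfolding \<Theta>w cappend_in_cspace_iff by (auto simp: fun_eq_iff)
    finally show "w \<in> (fibre_product X p S D) \<longleftrightarrow> ?\<Theta> w \<in> cspace (?n + 1)" .
  qed
  moreover have "(x, d) \<in> ?A \<times> ?B" using A(3) B(3) E by (cases d) auto
  ultimately show ?thesis by blast
qed

lemma thick_pullback_eq:
  "thick_pullback X p S D = submanifold (prod_mfd X (thick_mfd S D)) (cdim X + 1)
     (fibre_product X p S D)"
  by (simp add: pullback_def)

lemma atlas_manifold_thick_pullback:
  assumes X: "atlas_manifold X" and S: "atlas_manifold S" and p: "holomorphic_map X S p"
    and D: "openin (mtop (prod_mfd S complex_line)) D"
  shows "atlas_manifold (thick_pullback X p S D)"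
  unfolding thick_pullback_eq
proof (rule atlas_manifold_submanifold[OF atlas_manifold_prod[OF X atlas_manifold_thick[OF S D]]])
  fix z assume "z \<in> (fibre_product X p S D)"
  then obtain x d where "z = (x, d)" "x \<in> points X" "d \<in> D" "p x = fst d" by auto
  then show "\<exists>U \<phi>. slice_chart (prod_mfd X (thick_mfd S D)) (cdim X + 1)
      (fibre_product X p S D) (U, \<phi>) \<and> z \<in> U"
    using thick_pullback_slice[OF X S p D] by blast
qed auto

section \<open>Pullbacks along open embeddings of thickenings\<close>

text \<open>An open submanifold has the same germs of holomorphic maps, since a chart of the ambient manifold
  that is shrunk to the open set is a chart of both.\<close>

lemma holomorphic_at_open_submanifold:
  assumes N: "atlas_manifold N" and V: "openin (mtop N) V" "y \<in> V"
    and f: "holomorphic_at (open_submanifold N V) P f y"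
  shows "holomorphic_at N P f y"
proof -
  note sub = atlas_manifold_open_submanifold[OF N V(1)]
  have yN: "y \<in> points N" using V openin_subset by blast
  then obtain U \<phi> where c: "(U, \<phi>) \<in> charts N" "y \<in> U" using atlas_manifold_chartE[OF N] by blast
  have c1: "(U \<inter> V, \<phi>) \<in> charts N"
    by (rule charts_restrict[OF N c(1)]) (use is_chartD(1)[OF charts_is_chart[OF c(1)]] V in auto)
  have c2: "(U \<inter> V, \<phi>) \<in> charts (open_submanifold N V)"
    using sub(2)[OF c1] atlas_subset_charts[OF sub(1)] by blast
  have yUV: "y \<in> U \<inter> V" using c V by blast
  have "holomorphic_at N (open_submanifold N V) (\<lambda>y. y) y"
  proof (rule holomorphic_atI[where f="\<lambda>y. y", OF N sub(1) _ c1 yUV c2 yUV])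
    show "continuous_at_point (mtop N) (mtop (open_submanifold N V)) (\<lambda>y. y) y"
      unfolding continuous_at_point_def
    proof (intro conjI allI impI)
      fix T assume "openin (mtop (open_submanifold N V)) T \<and> y \<in> T"
      then have "openin (mtop N) T" "y \<in> T" using V(1) by (auto simp: openin_open_subtopology)
      then show "\<exists>T'. openin (mtop N) T' \<and> y \<in> T' \<and> (\<lambda>y. y) ` T' \<subseteq> T" by auto
    qed (use yN V in auto)
    show "hol_at (cdim N) (cdim (open_submanifold N V)) (\<lambda>w. \<phi> (inv_into (U \<inter> V) \<phi> w)) (\<phi> y)"
      using charts_transition[OF N c1 c1 yUV yUV] by simp
  qed
  then show ?thesis
    using f by (rule holomorphic_at_compose[OF sub(1)])
qed

lemma continuous_at_point_subtopology:
  assumes f: "continuous_at_point X Y f x" and x: "x \<in> Q" and R: "\<And>y. y \<in> T \<Longrightarrow> y \<in> Q \<Longrightarrow> f y \<in> R"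
    and T: "openin X T" "x \<in> T"
  shows "continuous_at_point (subtopology X Q) (subtopology Y R) f x"
  unfolding continuous_at_point_def
proof (intro conjI allI impI)
  fix V assume V: "openin (subtopology Y R) V \<and> f x \<in> V"
  then obtain V' where V': "openin Y V'" "V = V' \<inter> R" by (auto simp: openin_subtopology)
  have "f x \<in> V'" using V V' by blast
  then obtain N where N: "openin X N" "x \<in> N" "f ` N \<subseteq> V'"
    using continuous_at_pointE[OF f V'(1)] by blast
  have "openin (subtopology X Q) ((N \<inter> T) \<inter> Q)" using N(1) T(1) by (intro openin_subtopology_Int openin_Int)
  then show "\<exists>N. openin (subtopology X Q) N \<and> x \<in> N \<and> f ` N \<subseteq> V"
    using N T x R V'(2) by (intro exI[of _ "(N \<inter> T) \<inter> Q"]) (auto simp: image_subset_iff)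
qed (use assms in \<open>auto simp: continuous_at_point_def\<close>)

lemma holomorphic_at_submanifold:
  assumes MQ: "atlas_manifold (submanifold M k Q)" and NR: "atlas_manifold (submanifold N l R)"
    and k: "k \<le> cdim M" and F: "holomorphic_at M N F x" and x: "x \<in> Q"
    and T: "openin (mtop M) T" "x \<in> T" and FQ: "\<And>y. y \<in> T \<Longrightarrow> y \<in> Q \<Longrightarrow> F y \<in> R"
  shows "holomorphic_at (submanifold M k Q) (submanifold N l R) F x"
proof -
  have cont: "continuous_at_point (mtop (submanifold M k Q)) (mtop (submanifold N l R)) F x"
    using continuous_at_point_subtopology[OF _ x FQ T] F by (simp add: holomorphic_at_def)
  then have pts: "x \<in> points (submanifold M k Q)" "F x \<in> points (submanifold N l R)"
    by (simp_all add: continuous_at_point_def)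
  obtain U0 \<phi> where U0: "(U0, \<phi>) \<in> atlas (submanifold M k Q)" "(U0, \<phi>) \<in> charts (submanifold M k Q)" "x \<in> U0"
    using atlas_manifold_chartE[OF MQ pts(1)] .
  obtain V0 \<psi> where V0: "(V0, \<psi>) \<in> atlas (submanifold N l R)" "(V0, \<psi>) \<in> charts (submanifold N l R)" "F x \<in> V0"
    using atlas_manifold_chartE[OF NR pts(2)] .
  obtain U where U: "U0 = U \<inter> Q" "slice_chart M k Q (U, \<phi>)" using U0(1) unfolding atlas_submanifold by blast
  obtain V where V: "V0 = V \<inter> R" "slice_chart N l R (V, \<psi>)" using V0(1) unfolding atlas_submanifold by blast
  show ?thesis
  proof (rule holomorphic_atI[where f=F, OF MQ NR cont U0(2,3) V0(2,3)])
    show "hol_at (cdim (submanifold M k Q)) (cdim (submanifold N l R)) (\<lambda>w. \<psi> (F (inv_into U0 \<phi> w))) (\<phi> x)"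
      using holomorphic_at_slice[OF U(2) V(2) k F _ x _ T FQ] U0(3) V0(3) unfolding U(1) V(1) by simp
  qed
qed

lemma continuous_map_if_at_points:
  assumes "\<And>x. x \<in> topspace X \<Longrightarrow> continuous_at_point X Y f x"
  shows "continuous_map X Y f"
  unfolding continuous_map_alt
proof (intro conjI allI impI)
  fix T assume T: "openin Y T"
  show "openin X (f -` T \<inter> topspace X)"
  proof (subst openin_subopen, intro ballI)
    fix x assume x: "x \<in> f -` T \<inter> topspace X"
    then have "x \<in> topspace X" "f x \<in> T" by auto
    then obtain N where "openin X N" "x \<in> N" "f ` N \<subseteq> T" using continuous_at_pointE[OF assms T] by blast
    then show "\<exists>N. openin X N \<and> x \<in> N \<and> N \<subseteq> f -` T \<inter> topspace X" using openin_subset by blast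
  qed
qed (use assms in \<open>auto simp: continuous_at_point_def\<close>)

lemma holomorphic_map_submanifold:
  assumes k: "k \<le> cdim M" and F: "\<And>x. x \<in> Q \<Longrightarrow> holomorphic_at M N F x" and FQ: "F ` Q \<subseteq> R"
  shows "holomorphic_map (submanifold M k Q) (submanifold N l R) F"
  unfolding holomorphic_map_def
proof (intro conjI)
  have QM: "x \<in> points M" if "x \<in> Q" for x using F[OF that] by (simp add: holomorphic_at_def continuous_at_point_def)
  show "continuous_map (mtop (submanifold M k Q)) (mtop (submanifold N l R)) F"
  proof (rule continuous_map_if_at_points)
    fix x assume "x \<in> points (submanifold M k Q)"
    then have x: "x \<in> Q" by simp
    show "continuous_at_point (mtop (submanifold M k Q)) (mtop (submanifold N l R)) F x"
      unfolding submanifold_simps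
      by (rule continuous_at_point_subtopology[OF _ x _ openin_topspace QM[OF x]])
         (use F[OF x] FQ in \<open>auto simp: holomorphic_at_def\<close>)
  qed
  have hol: "cholomorphic k l (\<phi> ` ((U \<inter> Q) \<inter> F -` (V \<inter> R))) (\<psi> \<circ> F \<circ> inv_into (U \<inter> Q) \<phi>)"
    if U: "slice_chart M k Q (U, \<phi>)" and V: "slice_chart N l R (V, \<psi>)" for U \<phi> V \<psi>
  proof (rule hol_at_imp_cholomorphic)
    fix z assume "z \<in> \<phi> ` ((U \<inter> Q) \<inter> F -` (V \<inter> R))"
    then obtain x where x: "x \<in> U" "x \<in> Q" "F x \<in> V" "z = \<phi> x" by blast
    show "hol_at k l (\<psi> \<circ> F \<circ> inv_into (U \<inter> Q) \<phi>) z"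
      unfolding x(4) o_def
      by (rule holomorphic_at_slice[OF U V k F[OF x(2)] x(1-3) openin_topspace QM[OF x(2)]]) (use FQ in blast)
  qed
  show "\<forall>(U, \<phi>)\<in>atlas (submanifold M k Q). \<forall>(V, \<psi>)\<in>atlas (submanifold N l R).
     cholomorphic (cdim (submanifold M k Q)) (cdim (submanifold N l R)) (\<phi> ` (U \<inter> F -` V)) (\<psi> \<circ> F \<circ> inv_into U \<phi>)"
    unfolding submanifold_simps
  proof
    fix c assume "c \<in> atlas (submanifold M k Q)"
    then obtain U \<phi> where c: "c = (U \<inter> Q, \<phi>)" "slice_chart M k Q (U, \<phi>)" unfolding atlas_submanifold by blast
    have "case d of (V, \<psi>) \<Rightarrow> cholomorphic k l (\<phi> ` ((U \<inter> Q) \<inter> F -` V)) (\<psi> \<circ> F \<circ> inv_into (U \<inter> Q) \<phi>)"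
      if d: "d \<in> atlas (submanifold N l R)" for d
    proof -
      obtain V \<psi> where "d = (V \<inter> R, \<psi>)" "slice_chart N l R (V, \<psi>)" using d unfolding atlas_submanifold by blast
      then show ?thesis using hol[OF c(2)] by simp
    qed
    then show "case c of (U, \<phi>) \<Rightarrow> \<forall>(V, \<psi>)\<in>atlas (submanifold N l R).
        cholomorphic k l (\<phi> ` (U \<inter> F -` V)) (\<psi> \<circ> F \<circ> inv_into U \<phi>)"
      unfolding c(1) prod.case by (rule ballI)
  qed
qed

lemma mtop_thick_pullback:
  "mtop (thick_pullback X p S D) = subtopology (prod_topology (mtop X) (mtop (thick_mfd S D)))
     (fibre_product X p S D)"
  unfolding thick_pullback_eq by (simp only: submanifold_simps prod_mfd_simps)

lemma points_thick: "openin (mtop (prod_mfd S complex_line)) D \<Longrightarrow> points (thick_mfd S D) = D"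
  by (simp only: submanifold_simps topspace_subtopology inf.absorb2 openin_subset)

lemma points_thick_pullback:
  "points (thick_pullback X p S D) = (fibre_product X p S D)"
  unfolding mtop_thick_pullback topspace_subtopology topspace_prod_topology by blast

lemma continuous_map_into_thick_pullback:
  assumes "continuous_map Z (mtop X) a" "continuous_map Z (mtop (thick_mfd S D)) b"
    "\<And>z. z \<in> topspace Z \<Longrightarrow> p (a z) = fst (b z)"
  shows "continuous_map Z (mtop (thick_pullback X p S D)) (\<lambda>z. (a z, b z))"
  unfolding mtop_thick_pullback
  using assms continuous_map_image_subset_topspace[OF assms(1)] continuous_map_image_subset_topspace[OF assms(2)]
  by (intro continuous_map_into_subtopology continuous_map_pairedI) (auto simp: image_subset_iff)

lemma continuous_map_fst_thick_pullback: "continuous_map (mtop (thick_pullback X p S D)) (mtop X) fst"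
  unfolding mtop_thick_pullback by (intro continuous_map_from_subtopology continuous_map_fst)

lemma continuous_map_snd_thick_pullback:
  "continuous_map (mtop (thick_pullback X p S D)) (mtop (thick_mfd S D)) snd"
  unfolding mtop_thick_pullback by (intro continuous_map_from_subtopology continuous_map_snd)

lemma continuous_map_fst_thick: "continuous_map (mtop (thick_mfd S D)) (mtop S) fst"
  unfolding submanifold_simps prod_mfd_simps by (intro continuous_map_from_subtopology continuous_map_fst)

text \<open>From here on thickenings and their pullbacks are manifolds in their own right. Unfolding their topology
  or dimension would only hide them.\<close>

declare submanifold_simps [simp del] prod_mfd_simps [simp del] complex_line_simps [simp del]

text \<open>An open embedding \<open>j\<close> over \<open>S\<close> between contractible thickenings, together with the induced embedding
  \<open>J\<close> of the pullbacks of \<open>X\<close>. Its image consists of all points lying over the image of \<open>j\<close>.\<close>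

locale thick_embedding =
  fixes X :: "'x cmfd" and S :: "'s cmfd" and p :: "'x \<Rightarrow> 's"
    and D D2 :: "('s \<times> complex) set" and j :: "'s \<times> complex \<Rightarrow> 's \<times> complex"
  assumes X: "atlas_manifold X" and S: "atlas_manifold S" and p: "holomorphic_map X S p"
    and fib: "serre_fibration (mtop X) (mtop S) p"
    and D: "openin (mtop (prod_mfd S complex_line)) D" "contractible_space (mtop (thick_mfd S D))"
    and D2: "openin (mtop (prod_mfd S complex_line)) D2" "contractible_space (mtop (thick_mfd S D2))"
    and emb: "holomorphic_open_embedding (thick_mfd S D) (thick_mfd S D2) j"
    and over: "\<And>d. d \<in> D \<Longrightarrow> fst (j d) = fst d"
begin

abbreviation "E \<equiv> thick_pullback X p S D"
abbreviation "E2 \<equiv> thick_pullback X p S D2"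
abbreviation "J \<equiv> (\<lambda>(x, d). (x, j d)) :: 'x \<times> 's \<times> complex \<Rightarrow> 'x \<times> 's \<times> complex"
abbreviation "Jinv \<equiv> (\<lambda>(x, d). (x, inv_into D j d)) :: 'x \<times> 's \<times> complex \<Rightarrow> 'x \<times> 's \<times> complex"

lemma inj_j: "inj_on j D" and open_j: "openin (mtop (thick_mfd S D2)) (j ` D)"
  and hol_j: "holomorphic_map (thick_mfd S D) (thick_mfd S D2) j"
  and hol_inv_j: "holomorphic_map (open_submanifold (thick_mfd S D2) (j ` D)) (thick_mfd S D) (inv_into D j)"
  using emb unfolding holomorphic_open_embedding_def points_thick[OF D(1)] by simp_all

lemma cont_j: "continuous_map (mtop (thick_mfd S D)) (mtop (thick_mfd S D2)) j"
  using hol_j by (simp only: holomorphic_map_def)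

lemma cont_inv_j: "continuous_map (subtopology (mtop (thick_mfd S D2)) (j ` D)) (mtop (thick_mfd S D)) (inv_into D j)"
  using hol_inv_j unfolding holomorphic_map_def submanifold_simps by blast

lemma points_E: "points E = {(x, d). x \<in> points X \<and> d \<in> D \<and> p x = fst d}"
  unfolding points_thick_pullback points_thick[OF D(1)] ..

lemma cont_J: "continuous_map (mtop E) (mtop E2) J"
proof -
  have "continuous_map (mtop E) (mtop E2) (\<lambda>e. (fst e, j (snd e)))"
  proof (rule continuous_map_into_thick_pullback)
    show "continuous_map (mtop E) (mtop (thick_mfd S D2)) (\<lambda>e. j (snd e))"
      by (rule continuous_map_compose_apply[OF continuous_map_snd_thick_pullback cont_j])
    show "p (fst e) = fst (j (snd e))" if "e \<in> points E" for e using that points_E over by auto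
  qed (rule continuous_map_fst_thick_pullback)
  then show ?thesis by (simp add: case_prod_unfold)
qed

lemma cont_Jinv: "continuous_map (subtopology (mtop E2) (UNIV \<times> j ` D)) (mtop E) Jinv"
proof -
  let ?Z = "subtopology (mtop E2) (UNIV \<times> j ` D)"
  have "continuous_map ?Z (mtop E) (\<lambda>e. (fst e, inv_into D j (snd e)))"
  proof (rule continuous_map_into_thick_pullback)
    show "continuous_map ?Z (mtop X) fst"
      by (intro continuous_map_from_subtopology continuous_map_fst_thick_pullback)
    have "continuous_map ?Z (subtopology (mtop (thick_mfd S D2)) (j ` D)) snd"
      by (intro continuous_map_into_subtopology continuous_map_from_subtopology continuous_map_snd_thick_pullback) auto
    then show "continuous_map ?Z (mtop (thick_mfd S D)) (\<lambda>e. inv_into D j (snd e))"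
      using cont_inv_j by (rule continuous_map_compose_apply)
    fix e assume "e \<in> topspace ?Z"
    then have e: "e \<in> points E2" "snd e \<in> j ` D" by auto
    then obtain d where d: "d \<in> D" "snd e = j d" by blast
    then have "p (fst e) = fst (j d)" using e(1) unfolding points_thick_pullback by auto
    then show "p (fst e) = fst (inv_into D j (snd e))" using d over inj_j by simp
  qed
  then show ?thesis by (simp add: case_prod_unfold)
qed

lemma Jinv_J: "e \<in> points E \<Longrightarrow> Jinv (J e) = e"
  using inj_j by (auto simp: points_E)

lemma J_Jinv: "snd e \<in> j ` D \<Longrightarrow> J (Jinv e) = e"
  by (cases e) (auto simp: f_inv_into_f)

lemma pathin_Jinv: "pathin (mtop E2) l \<Longrightarrow> (\<And>t. t \<in> {0..1} \<Longrightarrow> snd (l t) \<in> j ` D) \<Longrightarrow> pathin (mtop E) (Jinv \<circ> l)"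
  unfolding pathin_def
  by (rule continuous_map_compose[OF _ cont_Jinv], rule continuous_map_into_subtopology) (auto simp: mem_Times_iff)

lemma lifts: "lifts_homotopies B (mtop X) (mtop S) p \<Longrightarrow> lifts_homotopies B (mtop E2) (mtop (thick_mfd S D2)) snd"
  unfolding mtop_thick_pullback by (rule lifts_homotopies_pullback[OF _ continuous_map_fst_thick])

text \<open>Join the end points by a path \<open>k\<close> of \<open>D\<close> and move the given path over \<open>j \<circ> k\<close>.\<close>

lemma Pi1_map_full:
  assumes c: "pathin (mtop E2) c" and ends: "snd (c 0) \<in> j ` D" "snd (c 1) \<in> j ` D"
  shows "\<exists>b. pathin (mtop E) b \<and> path_homotopic (mtop E2) c (J \<circ> b)"
proof -
  obtain d0 d1 where d: "d0 \<in> D" "snd (c 0) = j d0" "d1 \<in> D" "snd (c 1) = j d1" using ends by blast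
  have "path_connected_space (mtop (thick_mfd S D))" by (rule contractible_imp_path_connected_space[OF D(2)])
  then obtain k where k: "pathin (mtop (thick_mfd S D)) k" "k 0 = d0" "k 1 = d1"
    using d(1,3) points_thick[OF D(1)] unfolding path_connected_space_def by metis
  have "pathin (mtop (thick_mfd S D2)) (j \<circ> k)" using k(1) cont_j by (rule pathin_map)
  moreover have "(j \<circ> k) 0 = snd (c 0)" "(j \<circ> k) 1 = snd (c 1)" using k d by simp_all
  ultimately obtain c' where c': "path_homotopic (mtop E2) c c'" "\<And>t. t \<in> {0..1} \<Longrightarrow> snd (c' t) = (j \<circ> k) (squeeze t)"
    using lift_path[OF lifts[OF serre_fibration_lifts_interval[OF fib]] D2(2) continuous_map_snd_thick_pullback c] by metis
  have kD: "k t \<in> D" if "t \<in> {0..1}" for t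
    using k(1) that points_thick[OF D(1)] continuous_map_image_subset_topspace unfolding pathin_def by fastforce
  have c'D: "snd (c' t) \<in> j ` D" if "t \<in> {0..1}" for t
    using c'(2)[OF that] kD[of "squeeze t"] by simp
  have "pathin (mtop E) (Jinv \<circ> c')"
    using path_homotopic_imp_pathin(2)[OF c'(1)] c'D by (rule pathin_Jinv)
  moreover have "path_homotopic (mtop E2) c (J \<circ> (Jinv \<circ> c'))"
    using c'(1) by (rule path_homotopic_cong) (use J_Jinv c'D in auto)
  ultimately show ?thesis by blast
qed

text \<open>The homotopy \<open>K\<close> in \<open>E2\<close> is replaced by one over \<open>j \<circ> v\<close>, where \<open>v\<close> is a homotopy in \<open>D\<close> between the
  projections of the two paths. It has the same boundary up to reparametrisation, and it lies in the
  image of \<open>J\<close>.\<close>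

lemma Pi1_map_faithful:
  assumes b: "pathin (mtop E) b" "pathin (mtop E) b'" and hom: "path_homotopic (mtop E2) (J \<circ> b) (J \<circ> b')"
  shows "path_homotopic (mtop E) b b'"
proof -
  have bE: "b t \<in> points E" "b' t \<in> points E" if "t \<in> {0..1}" for t
    using b that continuous_map_image_subset_topspace unfolding pathin_def by fastforce+
  obtain K where K: "continuous_map unit_square (mtop E2) K"
     "\<And>t. t \<in> {0..1} \<Longrightarrow> K (0, t) = J (b t) \<and> K (1, t) = J (b' t)"
     "\<And>s. s \<in> {0..1} \<Longrightarrow> K (s, 0) = J (b 0) \<and> K (s, 1) = J (b 1)"
    using hom unfolding path_homotopic_iff_square by auto
  have "J (b 0) = J (b' 0)" "J (b 1) = J (b' 1)"
    using path_homotopic_imp_pathin(3,4)[OF hom] by simp_all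
  then have ends: "b 0 = b' 0" "b 1 = b' 1"
    using Jinv_J[of "b _"] Jinv_J[of "b' _"] bE by (metis atLeastAtMost_iff order_refl zero_le_one)+
  have "path_homotopic (mtop (thick_mfd S D)) (snd \<circ> b) (snd \<circ> b')"
    using contractible_imp_path_homotopic[OF D(2) pathin_map[OF b(1) continuous_map_snd_thick_pullback]
        pathin_map[OF b(2) continuous_map_snd_thick_pullback]] ends by simp
  then obtain v where v: "continuous_map unit_square (mtop (thick_mfd S D)) v"
     "\<And>t. t \<in> {0..1} \<Longrightarrow> v (0, t) = snd (b t) \<and> v (1, t) = snd (b' t)"
     "\<And>s. s \<in> {0..1} \<Longrightarrow> v (s, 0) = snd (b 0) \<and> v (s, 1) = snd (b 1)"
    unfolding path_homotopic_iff_square by auto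
  have vD: "v x \<in> D" if "x \<in> {0..1} \<times> {0..1}" for x
    using continuous_map_image_subset_topspace[OF v(1)] that points_thick[OF D(1)] by (auto simp: unit_square_topology)
  have bd: "j (v (s, t)) = snd (K (s, t))" if "s \<in> {0..1}" "t \<in> {0..1}" "s \<in> {0, 1} \<or> t \<in> {0, 1}" for s t
    using that K(2)[of t] K(3)[of s] v(2)[of t] v(3)[of s] by (auto simp: case_prod_unfold)
  obtain l where l: "continuous_map unit_square (mtop E2) l"
    "\<And>s t. s \<in> {0..1} \<Longrightarrow> t \<in> {0..1} \<Longrightarrow> s \<in> {0, 1} \<or> t \<in> {0, 1} \<Longrightarrow> l (s, t) = K (squeeze s, squeeze t)"
    "\<And>s t. s \<in> {0..1} \<Longrightarrow> t \<in> {0..1} \<Longrightarrow> snd (l (s, t)) = j (v (squeeze s, squeeze t))"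
    using lift_square[OF lifts[OF serre_fibration_lifts_square[OF fib]] D2(2) continuous_map_snd_thick_pullback K(1)
        continuous_map_compose_apply[OF v(1) cont_j] bd] by blast
  have "continuous_map unit_square (subtopology (mtop E2) (UNIV \<times> j ` D)) l"
    using l(1)
  proof (rule continuous_map_into_subtopology)
    have "snd (l (s, t)) \<in> j ` D" if "s \<in> {0..1}" "t \<in> {0..1}" for s t
      using l(3)[OF that] vD[of "(squeeze s, squeeze t)"] by simp
    then show "l \<in> topspace unit_square \<rightarrow> UNIV \<times> j ` D"
      by (auto simp: unit_square_topology mem_Times_iff)
  qed
  then have h: "continuous_map unit_square (mtop E) (Jinv \<circ> l)"
    using cont_Jinv by (rule continuous_map_compose)
  have "path_homotopic (mtop E) (b \<circ> squeeze) (b' \<circ> squeeze)"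
    unfolding path_homotopic_iff_square
  proof (intro exI[of _ "Jinv \<circ> l"] conjI ballI h)
    fix t :: real assume t: "t \<in> {0..1}"
    have "l (0, t) = J (b (squeeze t))" "l (1, t) = J (b' (squeeze t))" using l(2) K(2) t by simp_all
    then show "(Jinv \<circ> l) (0, t) = (b \<circ> squeeze) t" "(Jinv \<circ> l) (1, t) = (b' \<circ> squeeze) t"
      using Jinv_J bE by simp_all
    have "l (t, 0) = J (b 0)" "l (t, 1) = J (b 1)" using l(2) K(3) t by simp_all
    then show "(Jinv \<circ> l) (t, 0) = (b \<circ> squeeze) 0" "(Jinv \<circ> l) (t, 1) = (b \<circ> squeeze) 1"
      using Jinv_J bE by simp_all
  qed
  then show ?thesis
    using path_homotopic_squeeze[OF b(1)] path_homotopic_squeeze[OF b(2)] path_homotopic_sym path_homotopic_trans by blast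
qed

lemma Pi1_map_J_inj:
  assumes "\<beta> \<in> arrow_set (mtop E)" "\<beta>' \<in> arrow_set (mtop E)" "Pi1_map E2 J \<beta> = Pi1_map E2 J \<beta>'"
  shows "\<beta> = \<beta>'"
proof -
  obtain b b' where b: "pathin (mtop E) b" "\<beta> = path_class (mtop E) b" "pathin (mtop E) b'" "\<beta>' = path_class (mtop E) b'"
    using assms(1,2) by (meson arrow_setE)
  have "path_homotopic (mtop E2) (J \<circ> b) (J \<circ> b')"
    using assms(3) b path_class_eq_iff[OF pathin_map[OF b(1) cont_J]] by (simp add: Pi1_map_path_class cont_J)
  then show ?thesis
    using Pi1_map_faithful[OF b(1,3)] path_class_eq_iff[OF b(1)] b by simp
qed

lemma Pi1_map_J_surj:
  assumes a: "a \<in> arrow_set (mtop E2)" and ends: "snd (start a) \<in> j ` D" "snd (finish a) \<in> j ` D"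
  obtains \<beta> where "\<beta> \<in> arrow_set (mtop E)" "Pi1_map E2 J \<beta> = a"
proof -
  obtain c where c: "pathin (mtop E2) c" "a = path_class (mtop E2) c" using a by (rule arrow_setE)
  then obtain b where b: "pathin (mtop E) b" "path_homotopic (mtop E2) c (J \<circ> b)"
    using Pi1_map_full[OF c(1)] ends by auto
  have "Pi1_map E2 J (path_class (mtop E) b) = a"
    unfolding Pi1_map_path_class[OF b(1) cont_J] c(2) by (rule sym) (use b(2) path_class_eq_iff[OF c(1)] in simp)
  then show thesis using that path_class_in_arrow_set[OF b(1)] by blast
qed

end

section \<open>Transport of arrows between two thickenings\<close>

lemma Pi1_simps [simp]:
  "arrows (Pi1 Y) = arrow_mfd Y" "src (Pi1 Y) = start" "tgt (Pi1 Y) = finish" "comp (Pi1 Y) = arrow_comp (mtop Y)"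
  by (simp_all add: Pi1_def)

lemma points_arrow_mfd: "points (arrow_mfd Y) = arrow_set (mtop Y)"
  by (simp add: topspace_arrow_topology)

text \<open>Two thickenings embedded in a common one. Everything is expressed by arrows of the pullback to the
  latter, in which the images of both embeddings can be compared.\<close>

locale thick_cospan =
  L: thick_embedding X S p D D2 j + R: thick_embedding X S p D' D2 j'
  for X :: "'x cmfd" and S :: "'s cmfd" and p D D' D2 j j'
begin

definition overlap :: "('x \<times> 's \<times> complex) set" where
  "overlap = {e \<in> points L.E. j (snd e) \<in> j' ` D'}"

text \<open>The identity of \<open>E2\<close>, read in the pullback to \<open>D\<close> on the source and in the pullback to \<open>D'\<close> on the
  target.\<close>

definition change :: "'x \<times> 's \<times> complex \<Rightarrow> 'x \<times> 's \<times> complex" where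
  "change = (\<lambda>(x, d). (x, inv_into D' j' (j d)))"

lemma fst_change: "fst (change e) = fst e" and snd_change: "snd (change e) = inv_into D' j' (j (snd e))"
  by (simp_all add: change_def case_prod_unfold)

lemma openin_overlap: "openin (mtop L.E) overlap"
  unfolding overlap_def
  by (rule openin_continuous_map_preimage[OF continuous_map_compose_apply[OF continuous_map_snd_thick_pullback L.cont_j] R.open_j])

lemma overlap_subset: "overlap \<subseteq> points L.E"
  by (auto simp: overlap_def)

lemma change_eq: "change e = R.Jinv (L.J e)"
  by (simp add: change_def case_prod_unfold)

lemma snd_J: "snd (L.J e) = j (snd e)"
  by (simp add: case_prod_unfold)

lemma J_change: "e \<in> overlap \<Longrightarrow> R.J (change e) = L.J e"
  unfolding change_eq by (rule R.J_Jinv) (simp add: snd_J overlap_def)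

lemma continuous_map_change: "continuous_map (subtopology (mtop L.E) overlap) (mtop R.E) change"
proof -
  have "continuous_map (subtopology (mtop L.E) overlap) (subtopology (mtop L.E2) (UNIV \<times> j' ` D')) L.J"
    by (intro continuous_map_into_subtopology continuous_map_from_subtopology L.cont_J)
       (auto simp: overlap_def mem_Times_iff case_prod_unfold)
  from continuous_map_compose_apply[OF this R.cont_Jinv] show ?thesis
    unfolding change_eq[abs_def] .
qed

text \<open>The map extends to \<open>(x, d) \<mapsto> (x, j'\<^sup>-\<^sup>1 (j d))\<close> on the ambient products, where its factors are
  holomorphic, and it respects the fibre products.\<close>

lemma holomorphic_at_change:
  assumes e: "e \<in> overlap" shows "holomorphic_at L.E R.E change e"
proof -
  obtain x d where xd: "e = (x, d)" by (cases e)
  have mem: "x \<in> points X" "d \<in> D" "p x = fst d" "j d \<in> j' ` D'"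
    using e overlap_subset unfolding overlap_def L.points_E xd by auto
  note thick = atlas_manifold_thick[OF L.S L.D(1)] and thick' = atlas_manifold_thick[OF L.S R.D(1)]
    and thick2 = atlas_manifold_thick[OF L.S L.D2(1)]
  let ?G = "\<lambda>d. inv_into D' j' (j d)"
  have "holomorphic_at (thick_mfd S D) (thick_mfd S D2) j d"
    using holomorphic_map_imp_at[OF thick thick2 L.hol_j] mem(2) points_thick[OF L.D(1)] by blast
  moreover have "holomorphic_at (thick_mfd S D2) (thick_mfd S D') (inv_into D' j') (j d)"
  proof (rule holomorphic_at_open_submanifold[OF thick2 R.open_j mem(4)])
    have "points (open_submanifold (thick_mfd S D2) (j' ` D')) = j' ` D'"
      using openin_subset[OF R.open_j] by (simp only: submanifold_simps topspace_subtopology inf.absorb2)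
    then show "holomorphic_at (open_submanifold (thick_mfd S D2) (j' ` D')) (thick_mfd S D') (inv_into D' j') (j d)"
      using holomorphic_map_imp_at[OF atlas_manifold_open_submanifold(1)[OF thick2 R.open_j] thick' R.hol_inv_j] mem(4) by blast
  qed
  ultimately have G: "holomorphic_at (thick_mfd S D) (thick_mfd S D') ?G d"
    by (rule holomorphic_at_compose[OF thick2])
  have "holomorphic_at (prod_mfd X (thick_mfd S D)) (prod_mfd X (thick_mfd S D')) (\<lambda>(x, d). (x, ?G d)) (x, d)"
    by (rule holomorphic_at_prod[OF L.X thick L.X thick' holomorphic_at_id[OF L.X mem(1)] G])
  then have hol: "holomorphic_at (prod_mfd X (thick_mfd S D)) (prod_mfd X (thick_mfd S D')) change e"
    unfolding change_def xd .
  have E: "points L.E = (fibre_product X p S D)"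
    and E': "points R.E = (fibre_product X p S D')"
    by (rule points_thick_pullback)+
  obtain T where T0: "openin (prod_topology (mtop X) (mtop (thick_mfd S D))) T"
      "overlap = T \<inter> (fibre_product X p S D)"
    using openin_overlap[unfolded mtop_thick_pullback openin_subtopology] by blast
  then have T: "openin (mtop (prod_mfd X (thick_mfd S D))) T" "overlap = T \<inter> points L.E"
    unfolding E by (simp_all only: prod_mfd_simps(1))
  show ?thesis
    unfolding thick_pullback_eq
  proof (rule holomorphic_at_submanifold[OF _ _ _ hol _ T(1)])
    show "atlas_manifold (submanifold (prod_mfd X (thick_mfd S D)) (cdim X + 1)
        (fibre_product X p S D))"
      using atlas_manifold_thick_pullback[OF L.X L.S L.p L.D(1)] unfolding thick_pullback_eq .
    show "atlas_manifold (submanifold (prod_mfd X (thick_mfd S D')) (cdim X + 1)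
        (fibre_product X p S D'))"
      using atlas_manifold_thick_pullback[OF L.X L.S L.p R.D(1)] unfolding thick_pullback_eq .
    show "cdim X + 1 \<le> cdim (prod_mfd X (thick_mfd S D))"
      by (simp add: prod_mfd_simps submanifold_simps complex_line_simps)
    show "e \<in> (fibre_product X p S D)" "e \<in> T"
      using e overlap_subset E T(2) by blast+
    fix y assume "y \<in> T" "y \<in> (fibre_product X p S D)"
    then have "y \<in> overlap" using T(2) E by blast
    then have "y \<in> topspace (subtopology (mtop L.E) overlap)" using overlap_subset by auto
    then show "change y \<in> (fibre_product X p S D')"
      unfolding E'[symmetric] by (rule subsetD[OF continuous_map_image_subset_topspace[OF continuous_map_change] imageI])
  qed
qed

text \<open>The open set of arrows to which the transport extends. Working on it makes the transport a map
  between open sets of ambient manifolds, while the bibundles are only submanifolds.\<close>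

definition arrow_overlap :: "(real \<Rightarrow> 'x \<times> 's \<times> complex) set set" where
  "arrow_overlap = {a \<in> arrow_set (mtop L.E). start a \<in> overlap \<and> finish a \<in> overlap}"

lemma openin_arrow_overlap: "openin (arrow_topology (mtop L.E)) arrow_overlap"
proof -
  have "arrow_overlap = {a \<in> topspace (arrow_topology (mtop L.E)). start a \<in> overlap} \<inter>
      {a \<in> topspace (arrow_topology (mtop L.E)). finish a \<in> overlap}"
    by (auto simp: arrow_overlap_def topspace_arrow_topology)
  then show ?thesis
    using openin_continuous_map_preimage[OF continuous_map_start openin_overlap]
      openin_continuous_map_preimage[OF continuous_map_finish openin_overlap] by (simp add: openin_Int)
qed

lemma transported_arrow_unique:
  assumes a: "a \<in> arrow_overlap"
  shows "\<exists>!\<beta>. \<beta> \<in> arrow_set (mtop R.E) \<and> Pi1_map R.E2 R.J \<beta> = Pi1_map L.E2 L.J a"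
proof -
  have a': "a \<in> arrow_set (mtop L.E)" "start a \<in> overlap" "finish a \<in> overlap"
    using a by (auto simp: arrow_overlap_def)
  have "snd (start (Pi1_map L.E2 L.J a)) \<in> j' ` D'" "snd (finish (Pi1_map L.E2 L.J a)) \<in> j' ` D'"
    unfolding start_Pi1_map[OF a'(1) L.cont_J] finish_Pi1_map[OF a'(1) L.cont_J] snd_J
    using a'(2,3) unfolding overlap_def by blast+
  from R.Pi1_map_J_surj[OF Pi1_map_in_arrow_set[OF a'(1) L.cont_J] this]
  obtain \<beta> where "\<beta> \<in> arrow_set (mtop R.E)" "Pi1_map R.E2 R.J \<beta> = Pi1_map L.E2 L.J a" .
  then show ?thesis using R.Pi1_map_J_inj by (intro ex1I[of _ \<beta>]) auto
qed

abbreviation "\<eta> \<equiv> eta X p S D' D2 j j'"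

lemma eta_eqI:
  assumes "\<beta> \<in> arrow_set (mtop R.E)" "Pi1_map R.E2 R.J \<beta> = Pi1_map L.E2 L.J a"
  shows "\<eta> a = \<beta>"
  unfolding eta_def pullback_incl_def Pi1_simps points_arrow_mfd
  by (rule the_equality) (use assms R.Pi1_map_J_inj in auto)

lemma
  assumes a: "a \<in> arrow_overlap"
  shows eta_in_arrow_set: "\<eta> a \<in> arrow_set (mtop R.E)"
    and Pi1_map_eta: "Pi1_map R.E2 R.J (\<eta> a) = Pi1_map L.E2 L.J a"
    and start_eta: "start (\<eta> a) = change (start a)"
    and finish_eta: "finish (\<eta> a) = change (finish a)"
proof -
  have a': "a \<in> arrow_set (mtop L.E)" "start a \<in> overlap" "finish a \<in> overlap"
    using a by (auto simp: arrow_overlap_def)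
  obtain \<beta> where \<beta>: "\<beta> \<in> arrow_set (mtop R.E)" "Pi1_map R.E2 R.J \<beta> = Pi1_map L.E2 L.J a"
    using ex1_implies_ex[OF transported_arrow_unique[OF a]] by blast
  have eta: "\<eta> a = \<beta>" using \<beta> by (rule eta_eqI)
  show "\<eta> a \<in> arrow_set (mtop R.E)" "Pi1_map R.E2 R.J (\<eta> a) = Pi1_map L.E2 L.J a" using \<beta> eta by simp_all
  have "R.J (start \<beta>) = L.J (start a)" "R.J (finish \<beta>) = L.J (finish a)"
    using arg_cong[OF \<beta>(2), of start] arg_cong[OF \<beta>(2), of finish]
    unfolding start_Pi1_map[OF a'(1) L.cont_J] finish_Pi1_map[OF a'(1) L.cont_J]
      start_Pi1_map[OF \<beta>(1) R.cont_J] finish_Pi1_map[OF \<beta>(1) R.cont_J] by blast+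
  then show "start (\<eta> a) = change (start a)" "finish (\<eta> a) = change (finish a)"
    unfolding change_eq eta
    using R.Jinv_J[OF start_in_topspace[OF \<beta>(1)]] R.Jinv_J[OF finish_in_topspace[OF \<beta>(1)]] by simp_all
qed

lemma change_path:
  assumes u: "pathin (subtopology (mtop L.E) U) u" and U: "U \<subseteq> overlap" and U': "\<And>e. e \<in> U \<Longrightarrow> change e \<in> U'"
  shows "pathin (subtopology (mtop R.E) U') (change \<circ> u)"
    and "Pi1_map R.E2 R.J (path_class (mtop R.E) (change \<circ> u)) = Pi1_map L.E2 L.J (path_class (mtop L.E) u)"
proof -
  have uU: "u t \<in> U" if "t \<in> {0..1}" for t
    using u that unfolding pathin_def by (auto simp: continuous_map_in_subtopology)
  have "pathin (subtopology (mtop L.E) overlap) u" using u U by (rule pathin_subtopology_mono)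
  then have cu: "pathin (mtop R.E) (change \<circ> u)" using continuous_map_change by (rule pathin_map)
  then show "pathin (subtopology (mtop R.E) U') (change \<circ> u)"
    using uU U' by (auto simp: pathin_def continuous_map_in_subtopology)
  have uE: "pathin (mtop L.E) u" using pathin_subtopologyD[OF u] by blast
  have Ju: "R.J (change (u t)) = L.J (u t)" if "t \<in> {0..1}" for t
    by (rule J_change) (use uU[OF that] U in blast)
  have "path_homotopic (mtop R.E2) (R.J \<circ> (change \<circ> u)) (L.J \<circ> u)"
    using path_homotopic_refl[OF pathin_map[OF cu R.cont_J]]
    by (rule path_homotopic_cong) (simp_all only: o_apply Ju)
  then show "Pi1_map R.E2 R.J (path_class (mtop R.E) (change \<circ> u)) = Pi1_map L.E2 L.J (path_class (mtop L.E) u)"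
    unfolding Pi1_map_path_class[OF cu R.cont_J] Pi1_map_path_class[OF uE L.cont_J]
    using path_class_eq_iff[OF pathin_map[OF cu R.cont_J]] by simp
qed

text \<open>If \<open>b\<close> arises from \<open>a\<close> by attaching paths \<open>u\<close> and \<open>v\<close> at its ends, then its transport arises from
  the transport of \<open>a\<close> by attaching \<open>change \<circ> u\<close> and \<open>change \<circ> v\<close>; this is checked in \<open>E2\<close>. Continuity of
  the transport is an immediate consequence.\<close>

lemma eta_arrow_nbhd:
  assumes a: "a \<in> arrow_overlap" and U: "U \<subseteq> overlap" "\<And>e. e \<in> U \<Longrightarrow> change e \<in> U'"
    and V: "V \<subseteq> overlap" "\<And>e. e \<in> V \<Longrightarrow> change e \<in> V'"
  shows "\<eta> ` arrow_nbhd (mtop L.E) a U V \<subseteq> arrow_nbhd (mtop R.E) (\<eta> a) U' V'"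
proof
  fix b' assume "b' \<in> \<eta> ` arrow_nbhd (mtop L.E) a U V"
  then obtain b where b': "b' = \<eta> b" "b \<in> arrow_nbhd (mtop L.E) a U V" by blast
  obtain u v where b: "b = arrow_comp (mtop L.E) (arrow_comp (mtop L.E) (path_class (mtop L.E) u) a) (path_class (mtop L.E) v)"
    "pathin (subtopology (mtop L.E) U) u" "u 1 = start a" "pathin (subtopology (mtop L.E) V) v" "v 0 = finish a"
    "pathin (mtop L.E) u" "pathin (mtop L.E) v" using b'(2) by (rule arrow_nbhdE)
  have aE: "a \<in> arrow_set (mtop L.E)" using a by (simp add: arrow_overlap_def)
  note cu = change_path[OF b(2) U] and cv = change_path[OF b(4) V]
  have cu': "pathin (mtop R.E) (change \<circ> u)" and cv': "pathin (mtop R.E) (change \<circ> v)"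
    using pathin_subtopologyD[OF cu(1)] pathin_subtopologyD[OF cv(1)] by blast+
  have ends: "(change \<circ> u) 1 = start (\<eta> a)" "(change \<circ> v) 0 = finish (\<eta> a)"
    using b(3,5) start_eta[OF a] finish_eta[OF a] by simp_all
  let ?b = "arrow_comp (mtop R.E) (arrow_comp (mtop R.E) (path_class (mtop R.E) (change \<circ> u)) (\<eta> a)) (path_class (mtop R.E) (change \<circ> v))"
  note arr = path_class_in_arrow_set[OF b(6)] path_class_in_arrow_set[OF b(7)] aE
  note arr' = path_class_in_arrow_set[OF cu'] path_class_in_arrow_set[OF cv'] eta_in_arrow_set[OF a]
  have fin: "finish (path_class (mtop L.E) u) = start a" "start (path_class (mtop L.E) v) = finish a"
    "finish (path_class (mtop R.E) (change \<circ> u)) = start (\<eta> a)" "start (path_class (mtop R.E) (change \<circ> v)) = finish (\<eta> a)"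
    using b(3,5,6,7) ends cu' cv' by simp_all
  have "?b \<in> arrow_set (mtop R.E)"
    using arr' fin by (simp add: arrow_comp_in_arrow_set finish_arrow_comp)
  moreover have "Pi1_map R.E2 R.J ?b = Pi1_map L.E2 L.J b"
  proof -
    have "Pi1_map R.E2 R.J ?b = arrow_comp (mtop R.E2) (arrow_comp (mtop R.E2) (Pi1_map R.E2 R.J (path_class (mtop R.E) (change \<circ> u)))
        (Pi1_map R.E2 R.J (\<eta> a))) (Pi1_map R.E2 R.J (path_class (mtop R.E) (change \<circ> v)))"
      using arr' fin by (simp only: Pi1_map_arrow_comp[OF _ _ _ R.cont_J] arrow_comp_in_arrow_set finish_arrow_comp)
    also have "\<dots> = arrow_comp (mtop L.E2) (arrow_comp (mtop L.E2) (Pi1_map L.E2 L.J (path_class (mtop L.E) u))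
        (Pi1_map L.E2 L.J a)) (Pi1_map L.E2 L.J (path_class (mtop L.E) v))"
      by (simp only: cu(2) cv(2) Pi1_map_eta[OF a])
    also have "\<dots> = Pi1_map L.E2 L.J b"
      unfolding b(1) using arr fin by (simp only: Pi1_map_arrow_comp[OF _ _ _ L.cont_J] arrow_comp_in_arrow_set finish_arrow_comp)
    finally show ?thesis .
  qed
  ultimately have "\<eta> b = ?b" by (rule eta_eqI)
  also have "?b \<in> arrow_nbhd (mtop R.E) (\<eta> a) U' V'"
    by (rule arrow_nbhdI[OF cu(1) ends(1) cv(1) ends(2)])
  finally show "b' \<in> arrow_nbhd (mtop R.E) (\<eta> a) U' V'" unfolding b'(1) .
qed

lemma continuous_at_point_eta:
  assumes a: "a \<in> arrow_overlap"
  shows "continuous_at_point (arrow_topology (mtop L.E)) (arrow_topology (mtop R.E)) \<eta> a"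
  unfolding continuous_at_point_def topspace_arrow_topology
proof (intro conjI allI impI)
  have a': "a \<in> arrow_set (mtop L.E)" "start a \<in> overlap" "finish a \<in> overlap"
    using a by (auto simp: arrow_overlap_def)
  show "a \<in> arrow_set (mtop L.E)" "\<eta> a \<in> arrow_set (mtop R.E)" using a' eta_in_arrow_set[OF a] by simp_all
  fix T assume T: "openin (arrow_topology (mtop R.E)) T \<and> \<eta> a \<in> T"
  obtain U' V' where UV': "openin (mtop R.E) U'" "openin (mtop R.E) V'" "start (\<eta> a) \<in> U'" "finish (\<eta> a) \<in> V'"
      "arrow_nbhd (mtop R.E) (\<eta> a) U' V' \<subseteq> T"
    using bspec[OF conjunct2[OF conjunct1[OF T, unfolded openin_arrow_topology_iff]] conjunct2[OF T]] by blast
  have pre: "openin (mtop L.E) {e \<in> overlap. change e \<in> W}" if "openin (mtop R.E) W" for W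
  proof -
    have "openin (subtopology (mtop L.E) overlap) {e \<in> topspace (subtopology (mtop L.E) overlap). change e \<in> W}"
      using continuous_map_change that by (rule openin_continuous_map_preimage)
    moreover have "{e \<in> topspace (subtopology (mtop L.E) overlap). change e \<in> W} = {e \<in> overlap. change e \<in> W}"
      using overlap_subset by auto
    ultimately show ?thesis unfolding openin_open_subtopology[OF openin_overlap] by simp
  qed
  let ?U = "{e \<in> overlap. change e \<in> U'}" and ?V = "{e \<in> overlap. change e \<in> V'}"
  have mem: "start a \<in> ?U" "finish a \<in> ?V" using a' UV' start_eta[OF a] finish_eta[OF a] by simp_all
  have "\<eta> ` arrow_nbhd (mtop L.E) a ?U ?V \<subseteq> T"
    using eta_arrow_nbhd[OF a, of ?U U' ?V V'] UV'(5) by blast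
  then show "\<exists>N. openin (arrow_topology (mtop L.E)) N \<and> a \<in> N \<and> \<eta> ` N \<subseteq> T"
    using openin_arrow_nbhd[OF a'(1) pre[OF UV'(1)] pre[OF UV'(2)] mem] arrow_in_arrow_nbhd[OF a'(1) mem] by blast
qed

lemma holomorphic_at_eta:
  assumes a: "a \<in> arrow_overlap"
  shows "holomorphic_at (arrow_mfd L.E) (arrow_mfd R.E) \<eta> a"
proof (rule holomorphic_at_arrow_mfd[OF _ _ continuous_at_point_eta[OF a] _ _ openin_arrow_overlap a])
  show "atlas_manifold L.E" "atlas_manifold R.E"
    using atlas_manifold_thick_pullback L.X L.S L.p L.D(1) R.D(1) by blast+
  show "holomorphic_at L.E R.E change (finish a)" "holomorphic_at L.E R.E change (start a)"
    using a by (auto simp: arrow_overlap_def intro: holomorphic_at_change)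
qed (use start_eta finish_eta in auto)

text \<open>The common source of both equivariance properties: \<open>b\<close> and \<open>b'\<close> are arrows with the same image in \<open>E2\<close>.\<close>

lemma eta_arrow_comp:
  assumes a: "a \<in> arrow_overlap" "b \<in> arrow_set (mtop L.E)" "b' \<in> arrow_set (mtop R.E)"
    and J: "Pi1_map R.E2 R.J b' = Pi1_map L.E2 L.J b"
  shows "finish b = start a \<Longrightarrow> finish b' = start (\<eta> a) \<Longrightarrow>
      \<eta> (arrow_comp (mtop L.E) b a) = arrow_comp (mtop R.E) b' (\<eta> a)"
    and "finish a = start b \<Longrightarrow> finish (\<eta> a) = start b' \<Longrightarrow>
      \<eta> (arrow_comp (mtop L.E) a b) = arrow_comp (mtop R.E) (\<eta> a) b'"
proof -
  have aE: "a \<in> arrow_set (mtop L.E)" using a by (simp add: arrow_overlap_def)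
  note eta = eta_in_arrow_set[OF a(1)] Pi1_map_eta[OF a(1)]
  show "\<eta> (arrow_comp (mtop L.E) b a) = arrow_comp (mtop R.E) b' (\<eta> a)"
    if "finish b = start a" "finish b' = start (\<eta> a)"
    by (rule eta_eqI)
       (simp_all only: arrow_comp_in_arrow_set[OF a(3) eta(1) that(2)]
          Pi1_map_arrow_comp[OF a(3) eta(1) that(2) R.cont_J] Pi1_map_arrow_comp[OF a(2) aE that(1) L.cont_J] J eta(2))
  show "\<eta> (arrow_comp (mtop L.E) a b) = arrow_comp (mtop R.E) (\<eta> a) b'"
    if "finish a = start b" "finish (\<eta> a) = start b'"
    by (rule eta_eqI)
       (simp_all only: arrow_comp_in_arrow_set[OF eta(1) a(3) that(2)]
          Pi1_map_arrow_comp[OF eta(1) a(3) that(2) R.cont_J] Pi1_map_arrow_comp[OF aE a(2) that(1) L.cont_J] J eta(2))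
qed

end

section \<open>The morphism of bibundles\<close>

lemma Q_setD:
  assumes "\<alpha> \<in> Q_set X p S \<gamma> D"
  shows "\<alpha> \<in> arrow_set (mtop (thick_pullback X p S D))" "snd (start \<alpha>) = path_graph \<gamma> 0" "snd (finish \<alpha>) = path_graph \<gamma> 1"
proof -
  have \<alpha>: "\<alpha> \<in> arrow_set (mtop (thick_pullback X p S D))"
    "Pi1_map (thick_mfd S D) snd \<alpha> = path_class (mtop (thick_mfd S D)) (path_graph \<gamma>)"
    using assms unfolding Q_set_def Pi1_simps points_arrow_mfd by auto
  show "\<alpha> \<in> arrow_set (mtop (thick_pullback X p S D))" by fact
  obtain k where k: "pathin (mtop (thick_pullback X p S D)) k" "\<alpha> = path_class (mtop (thick_pullback X p S D)) k"
    using \<alpha>(1) by (rule arrow_setE)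
  have k2: "pathin (mtop (thick_mfd S D)) (snd \<circ> k)" using k(1) continuous_map_snd_thick_pullback by (rule pathin_map)
  have "path_homotopic (mtop (thick_mfd S D)) (snd \<circ> k) (path_graph \<gamma>)"
    using \<alpha>(2) path_class_eq_iff[OF k2] unfolding k(2) Pi1_map_path_class[OF k(1) continuous_map_snd_thick_pullback] by simp
  from path_homotopic_imp_pathin(3,4)[OF this] show "snd (start \<alpha>) = path_graph \<gamma> 0" "snd (finish \<alpha>) = path_graph \<gamma> 1"
    using k by simp_all
qed

text \<open>Over a contractible base the class of the graph of \<open>\<gamma>\<close> is determined by its end points, so membership
  in the bibundle only depends on where an arrow starts and ends.\<close>

lemma Q_setI:
  assumes \<alpha>: "\<alpha> \<in> arrow_set (mtop (thick_pullback X p S D))"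
    and ends: "snd (start \<alpha>) = path_graph \<gamma> 0" "snd (finish \<alpha>) = path_graph \<gamma> 1"
    and D: "contractible_space (mtop (thick_mfd S D))" and \<gamma>: "pathin (mtop (thick_mfd S D)) (path_graph \<gamma>)"
  shows "\<alpha> \<in> Q_set X p S \<gamma> D"
proof -
  obtain k where k: "pathin (mtop (thick_pullback X p S D)) k" "\<alpha> = path_class (mtop (thick_pullback X p S D)) k"
    using \<alpha> by (rule arrow_setE)
  have k2: "pathin (mtop (thick_mfd S D)) (snd \<circ> k)" using k(1) continuous_map_snd_thick_pullback by (rule pathin_map)
  have "path_homotopic (mtop (thick_mfd S D)) (snd \<circ> k) (path_graph \<gamma>)"
    by (rule contractible_imp_path_homotopic[OF D k2 \<gamma>]) (use ends k in simp_all)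
  then have "Pi1_map (thick_mfd S D) snd \<alpha> = path_class (mtop (thick_mfd S D)) (path_graph \<gamma>)"
    using path_class_eq_iff[OF k2] unfolding k(2) Pi1_map_path_class[OF k(1) continuous_map_snd_thick_pullback] by simp
  then show ?thesis using \<alpha> unfolding Q_set_def Pi1_simps points_arrow_mfd by blast
qed

lemma continuous_map_fibre:
  assumes "path_graph \<gamma> i \<in> points (thick_mfd S D)" "\<gamma> i = s"
  shows "continuous_map (mtop (fibre X p S s)) (mtop (thick_pullback X p S D)) (\<lambda>x. (x, path_graph \<gamma> i))"
proof (rule continuous_map_into_thick_pullback)
  show "continuous_map (mtop (fibre X p S s)) (mtop X) (\<lambda>x. x)"
    unfolding fibre_def submanifold_simps by (intro continuous_map_from_subtopology) (rule continuous_map_id[unfolded id_def])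
  show "continuous_map (mtop (fibre X p S s)) (mtop (thick_mfd S D)) (\<lambda>x. path_graph \<gamma> i)"
    using assms(1) by simp
  show "p x = fst (path_graph \<gamma> i)" if "x \<in> points (fibre X p S s)" for x
    using that assms(2) unfolding fibre_def submanifold_simps by (auto simp: path_graph_def)
qed

lemma Q_bibundle_simps:
  "total (Q_bibundle X p S \<gamma> D) = submanifold (arrow_mfd (thick_pullback X p S D))
      (2 * cdim (thick_pullback X p S D) - 2 * cdim (thick_mfd S D)) (Q_set X p S \<gamma> D)"
  "lmom (Q_bibundle X p S \<gamma> D) = (\<lambda>\<alpha>. fst (start \<alpha>))"
  "rmom (Q_bibundle X p S \<gamma> D) = (\<lambda>\<alpha>. fst (finish \<alpha>))"
  "lact (Q_bibundle X p S \<gamma> D) = (\<lambda>g \<alpha>. arrow_comp (mtop (thick_pullback X p S D)) (fibre_incl X p S \<gamma> D 0 g) \<alpha>)"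
  "ract (Q_bibundle X p S \<gamma> D) = (\<lambda>\<alpha> h. arrow_comp (mtop (thick_pullback X p S D)) \<alpha> (fibre_incl X p S \<gamma> D 1 h))"
  by (simp_all add: Q_bibundle_def Let_def)

lemma pathin_path_graph:
  assumes "pathin (mtop S) \<gamma>" "path_graph \<gamma> ` {0..1} \<subseteq> D"
  shows "pathin (mtop (thick_mfd S D)) (path_graph \<gamma>)"
proof -
  have "continuous_map unit_interval (prod_topology (mtop S) euclidean) (\<lambda>t. (\<gamma> t, complex_of_real t))"
    using assms(1) unfolding pathin_def by (intro continuous_map_pairedI) (auto intro!: continuous_intros)
  then show ?thesis
    using assms(2) unfolding pathin_def submanifold_simps prod_mfd_simps complex_line_simps path_graph_def
    by (intro continuous_map_into_subtopology) auto
qed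

theorem theorem3p10:
  fixes X :: "'x cmfd" and S :: "'s cmfd" and p :: "'x \<Rightarrow> 's"
    and \<gamma> \<gamma>' :: "real \<Rightarrow> 's" and h :: "real \<times> real \<Rightarrow> 's"
    and q :: "real \<times> real \<Rightarrow> complex" and b0 b1 :: complex and H :: "complex \<Rightarrow> 's"
    and D D' D2 :: "('s \<times> complex) set" and j j' :: "'s \<times> complex \<Rightarrow> 's \<times> complex"
  assumes "complex_manifold S" and "complex_manifold X"
    and "holomorphic_submersion X S p"
    and "serre_fibration (mtop X) (mtop S) p"
    and "pathin (mtop S) \<gamma>" and "pathin (mtop S) \<gamma>'"
    and "homotopy_fixing_endpoints (mtop S) h \<gamma> \<gamma>'"
    and "disk_collapse q b0 b1"
    and "\<forall>s\<in>{0..1}. \<forall>t\<in>{0..1}. H (q (s, t)) = h (s, t)"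
    and "contractible_thickening S (path_graph \<gamma> ` {0..1}) D"
    and "contractible_thickening S (path_graph \<gamma>' ` {0..1}) D'"
    and "contractible_thickening S (disk_graph H (cball 0 1)) D2"
    and "thickening_embedding S \<gamma> D H (q ` ({0} \<times> {0..1})) b0 b1 D2 j"
    and "thickening_embedding S \<gamma>' D' H (q ` ({1} \<times> {0..1})) b0 b1 D2 j'"
  shows "(\<forall>\<alpha>\<in>Q_set X p S \<gamma> D.
            \<exists>!\<beta>. \<beta> \<in> points (arrows (Pi1 (thick_pullback X p S D'))) \<and>
                 pullback_incl X p S D2 j' \<beta> = pullback_incl X p S D2 j \<alpha>)
       \<and> morita_morphism (Pi1 (fibre X p S (\<gamma> 0))) (Pi1 (fibre X p S (\<gamma> 1)))
            (Q_bibundle X p S \<gamma> D) (Q_bibundle X p S \<gamma>' D') (eta X p S D' D2 j j')"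
proof -
  have thick: "openin (mtop (prod_mfd S complex_line)) D" "contractible_space (mtop (thick_mfd S D))" "path_graph \<gamma> ` {0..1} \<subseteq> D"
    "openin (mtop (prod_mfd S complex_line)) D'" "contractible_space (mtop (thick_mfd S D'))" "path_graph \<gamma>' ` {0..1} \<subseteq> D'"
    "openin (mtop (prod_mfd S complex_line)) D2" "contractible_space (mtop (thick_mfd S D2))"
    using assms(10-12) unfolding contractible_thickening_def submanifold_simps by blast+
  have emb: "holomorphic_open_embedding (thick_mfd S D) (thick_mfd S D2) j" "\<And>d. d \<in> D \<Longrightarrow> fst (j d) = fst d"
    "holomorphic_open_embedding (thick_mfd S D') (thick_mfd S D2) j'" "\<And>d. d \<in> D' \<Longrightarrow> fst (j' d) = fst d"
    and ends: "j (path_graph \<gamma> 0) = j' (path_graph \<gamma>' 0)" "j (path_graph \<gamma> 1) = j' (path_graph \<gamma>' 1)"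
    using assms(13,14) unfolding thickening_embedding_def by auto
  interpret thick_cospan X S p D D' D2 j j'
    using assms(1-4) thick emb by unfold_locales (auto simp: holomorphic_submersion_def intro: complex_manifold_imp_atlas)
  have pg: "path_graph \<gamma> i \<in> D" "path_graph \<gamma>' i \<in> D'" if "i \<in> {0..1}" for i
    using thick(3,6) that by blast+
  \<comment> \<open>Both embeddings send the end points of the two graphs to the marked points over \<open>b0\<close> and \<open>b1\<close>.\<close>
  have jj: "j (path_graph \<gamma> i) = j' (path_graph \<gamma>' i)" if "i \<in> {0, 1}" for i using ends that by auto
  have \<gamma>\<gamma>': "\<gamma>' i = \<gamma> i" if i: "i \<in> {0, 1}" for i
  proof -
    have "i \<in> {0..1}" using i by auto
    then have "fst (path_graph \<gamma>' i) = fst (path_graph \<gamma> i)"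
      using jj[OF i] emb(2)[OF pg(1)] emb(4)[OF pg(2)] by metis
    then show ?thesis by (simp add: path_graph_def)
  qed
  have inv_end: "inv_into D' j' (j (path_graph \<gamma> i)) = path_graph \<gamma>' i" if "i \<in> {0, 1}" for i
    unfolding jj[OF that] using pg(2)[of i] that R.inj_j by auto
  have Q: "\<alpha> \<in> arrow_overlap" if \<alpha>: "\<alpha> \<in> Q_set X p S \<gamma> D" for \<alpha>
  proof -
    have "j (snd (start \<alpha>)) \<in> j' ` D'" "j (snd (finish \<alpha>)) \<in> j' ` D'"
      unfolding Q_setD(2,3)[OF \<alpha>] ends using pg(2) by simp_all
    then show ?thesis
      using Q_setD(1)[OF \<alpha>] start_in_topspace finish_in_topspace unfolding arrow_overlap_def overlap_def by blast
  qed
  have etaQ: "\<eta> \<alpha> \<in> Q_set X p S \<gamma>' D'" if \<alpha>: "\<alpha> \<in> Q_set X p S \<gamma> D" for \<alpha>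
  proof (rule Q_setI[OF eta_in_arrow_set[OF Q[OF \<alpha>]] _ _ thick(5) pathin_path_graph[OF assms(6) thick(6)]])
    show "snd (start (\<eta> \<alpha>)) = path_graph \<gamma>' 0" "snd (finish (\<eta> \<alpha>)) = path_graph \<gamma>' 1"
      unfolding start_eta[OF Q[OF \<alpha>]] finish_eta[OF Q[OF \<alpha>]] snd_change Q_setD(2,3)[OF \<alpha>] using inv_end by simp_all
  qed
  \<comment> \<open>The two inclusions of a fibre into \<open>E\<close> and into the pullback to \<open>D'\<close> coincide in \<open>E2\<close>.\<close>
  have incl: "fibre_incl X p S \<gamma> D i g \<in> arrow_set (mtop L.E)" "fibre_incl X p S \<gamma>' D' i g \<in> arrow_set (mtop R.E)"
      "start (fibre_incl X p S \<gamma> D i g) = (start g, path_graph \<gamma> i)" "finish (fibre_incl X p S \<gamma> D i g) = (finish g, path_graph \<gamma> i)"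
      "start (fibre_incl X p S \<gamma>' D' i g) = (start g, path_graph \<gamma>' i)" "finish (fibre_incl X p S \<gamma>' D' i g) = (finish g, path_graph \<gamma>' i)"
      "Pi1_map R.E2 R.J (fibre_incl X p S \<gamma>' D' i g) = Pi1_map L.E2 L.J (fibre_incl X p S \<gamma> D i g)"
    if g: "g \<in> arrow_set (mtop (fibre X p S (\<gamma> i)))" and i: "i \<in> {0, 1}" for i g
  proof -
    have "i \<in> {0..1}" using i by auto
    then have c: "continuous_map (mtop (fibre X p S (\<gamma> i))) (mtop L.E) (\<lambda>x. (x, path_graph \<gamma> i))"
      and c': "continuous_map (mtop (fibre X p S (\<gamma> i))) (mtop R.E) (\<lambda>x. (x, path_graph \<gamma>' i))"
      using pg points_thick[OF thick(1)] points_thick[OF thick(4)] \<gamma>\<gamma>'[OF i] by (auto intro!: continuous_map_fibre)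
    show "fibre_incl X p S \<gamma> D i g \<in> arrow_set (mtop L.E)" "fibre_incl X p S \<gamma>' D' i g \<in> arrow_set (mtop R.E)"
      unfolding fibre_incl_def by (rule Pi1_map_in_arrow_set[OF g c] Pi1_map_in_arrow_set[OF g c'])+
    show "start (fibre_incl X p S \<gamma> D i g) = (start g, path_graph \<gamma> i)" "finish (fibre_incl X p S \<gamma> D i g) = (finish g, path_graph \<gamma> i)"
      "start (fibre_incl X p S \<gamma>' D' i g) = (start g, path_graph \<gamma>' i)" "finish (fibre_incl X p S \<gamma>' D' i g) = (finish g, path_graph \<gamma>' i)"
      unfolding fibre_incl_def start_Pi1_map[OF g c] finish_Pi1_map[OF g c] start_Pi1_map[OF g c'] finish_Pi1_map[OF g c'] by (rule refl)+
    have "L.J \<circ> (\<lambda>x. (x, path_graph \<gamma> i)) = R.J \<circ> (\<lambda>x. (x, path_graph \<gamma>' i))"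
      using jj[OF i] by (simp add: fun_eq_iff)
    then show "Pi1_map R.E2 R.J (fibre_incl X p S \<gamma>' D' i g) = Pi1_map L.E2 L.J (fibre_incl X p S \<gamma> D i g)"
      unfolding fibre_incl_def Pi1_map_compose[OF g c L.cont_J] Pi1_map_compose[OF g c' R.cont_J] by simp
  qed
  show ?thesis
  proof (intro conjI ballI)
    fix \<alpha> assume "\<alpha> \<in> Q_set X p S \<gamma> D"
    then show "\<exists>!\<beta>. \<beta> \<in> points (arrows (Pi1 R.E)) \<and> pullback_incl X p S D2 j' \<beta> = pullback_incl X p S D2 j \<alpha>"
      unfolding pullback_incl_def Pi1_simps points_arrow_mfd by (intro transported_arrow_unique Q)
  next
    have hol: "holomorphic_map (total (Q_bibundle X p S \<gamma> D)) (total (Q_bibundle X p S \<gamma>' D')) \<eta>"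
      unfolding Q_bibundle_simps
      by (rule holomorphic_map_submanifold) (use holomorphic_at_eta Q etaQ in auto)
    have ptsQ: "points (total (Q_bibundle X p S \<gamma> D)) \<subseteq> Q_set X p S \<gamma> D"
      unfolding Q_bibundle_simps submanifold_simps by simp
    have mom: "fst (start (\<eta> \<alpha>)) = fst (start \<alpha>)" "fst (finish (\<eta> \<alpha>)) = fst (finish \<alpha>)"
      if "\<alpha> \<in> Q_set X p S \<gamma> D" for \<alpha>
      using start_eta[OF Q[OF that]] finish_eta[OF Q[OF that]] fst_change by simp_all
    have left: "\<eta> (arrow_comp (mtop L.E) (fibre_incl X p S \<gamma> D 0 g) \<alpha>) = arrow_comp (mtop R.E) (fibre_incl X p S \<gamma>' D' 0 g) (\<eta> \<alpha>)"
      if g: "g \<in> arrow_set (mtop (fibre X p S (\<gamma> 0)))" and \<alpha>: "\<alpha> \<in> Q_set X p S \<gamma> D" and eq: "finish g = fst (start \<alpha>)" for g \<alpha>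
    proof (rule eta_arrow_comp(1)[OF Q[OF \<alpha>] incl(1)[OF g] incl(2)[OF g] incl(7)[OF g]])
      show "finish (fibre_incl X p S \<gamma> D 0 g) = start \<alpha>"
        using incl(4)[OF g] eq Q_setD(2)[OF \<alpha>] by (simp add: prod_eq_iff)
      show "finish (fibre_incl X p S \<gamma>' D' 0 g) = start (\<eta> \<alpha>)"
        using incl(6)[OF g] eq mom(1)[OF \<alpha>] Q_setD(2)[OF etaQ[OF \<alpha>]] by (simp add: prod_eq_iff)
    qed simp_all
    have right: "\<eta> (arrow_comp (mtop L.E) \<alpha> (fibre_incl X p S \<gamma> D 1 g)) = arrow_comp (mtop R.E) (\<eta> \<alpha>) (fibre_incl X p S \<gamma>' D' 1 g)"
      if g: "g \<in> arrow_set (mtop (fibre X p S (\<gamma> 1)))" and \<alpha>: "\<alpha> \<in> Q_set X p S \<gamma> D" and eq: "start g = fst (finish \<alpha>)" for g \<alpha>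
    proof (rule eta_arrow_comp(2)[OF Q[OF \<alpha>] incl(1)[OF g] incl(2)[OF g] incl(7)[OF g]])
      show "finish \<alpha> = start (fibre_incl X p S \<gamma> D 1 g)"
        using incl(3)[OF g] eq Q_setD(3)[OF \<alpha>] by (simp add: prod_eq_iff)
      show "finish (\<eta> \<alpha>) = start (fibre_incl X p S \<gamma>' D' 1 g)"
        using incl(5)[OF g] eq mom(2)[OF \<alpha>] Q_setD(3)[OF etaQ[OF \<alpha>]] by (simp add: prod_eq_iff)
    qed simp_all
    show "morita_morphism (Pi1 (fibre X p S (\<gamma> 0))) (Pi1 (fibre X p S (\<gamma> 1)))
            (Q_bibundle X p S \<gamma> D) (Q_bibundle X p S \<gamma>' D') \<eta>"
      unfolding morita_morphism_def
    proof (intro conjI ballI impI hol)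
      fix \<alpha> assume "\<alpha> \<in> points (total (Q_bibundle X p S \<gamma> D))"
      then have \<alpha>: "\<alpha> \<in> Q_set X p S \<gamma> D" using ptsQ by blast
      show "lmom (Q_bibundle X p S \<gamma>' D') (\<eta> \<alpha>) = lmom (Q_bibundle X p S \<gamma> D) \<alpha>"
        "rmom (Q_bibundle X p S \<gamma>' D') (\<eta> \<alpha>) = rmom (Q_bibundle X p S \<gamma> D) \<alpha>"
        unfolding Q_bibundle_simps using mom[OF \<alpha>] by simp_all
      fix g assume "g \<in> points (arrows (Pi1 (fibre X p S (\<gamma> 1))))" "src (Pi1 (fibre X p S (\<gamma> 1))) g = rmom (Q_bibundle X p S \<gamma> D) \<alpha>"
      then show "\<eta> (ract (Q_bibundle X p S \<gamma> D) \<alpha> g) = ract (Q_bibundle X p S \<gamma>' D') (\<eta> \<alpha>) g"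
        unfolding Q_bibundle_simps Pi1_simps points_arrow_mfd using right \<alpha> by blast
    next
      fix g \<alpha> assume "g \<in> points (arrows (Pi1 (fibre X p S (\<gamma> 0))))" "\<alpha> \<in> points (total (Q_bibundle X p S \<gamma> D))"
        "tgt (Pi1 (fibre X p S (\<gamma> 0))) g = lmom (Q_bibundle X p S \<gamma> D) \<alpha>"
      then show "\<eta> (lact (Q_bibundle X p S \<gamma> D) g \<alpha>) = lact (Q_bibundle X p S \<gamma>' D') g (\<eta> \<alpha>)"
        unfolding Q_bibundle_simps Pi1_simps points_arrow_mfd using left ptsQ[unfolded Q_bibundle_simps] by blast
    qed
  qed
qed

end
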